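(* The probabilistic intersection ring $\mathrm H^+_{\mathbb E}(S^n)$ of the $n$-dimensional sphere $S^n=\mathrm{SO}(n+1)/\mathrm{SO}(n)$ is generated, as a commutative algebra, by the Grassmann class $[B]$ (in degree $1$) of the unit ball $B\subseteq V$ and by the orientation class $[\varpi]$ (in degree $n$). They satisfy the relations $[B]^{n+1}=0$ and $[\varpi]^2=0$. Moreover, the Grassmann class of a submanifold $Y\subseteq S^n$ of finite volume and codimension $d$, $0<d<n$, is given by $$[Y]_{\mathbb E}=\frac{\mathrm{vol}(Y)}{\mathrm{vol}(S^n)}\cdot\frac{1}{\ell(B^{\wedge d})}\cdot[B]^d,$$ and $[Y]_{\mathbb E}=[Y]^+_{\mathbb E}$ when $Y$ is cooriented.
   Context: Zonoids. For a finite-dimensional Euclidean space $W$, a zonoid is a Hausdorff limit of finite Minkowski sums of segments; it has a center of symmetry $c(Z)$ and is centered if $c(Z)=0$. $\widehat{\mathcal Z}(W)$, $\widehat{\mathcal Z}_o(W)$: real vector spaces of formal differences (with respect to Minkowski addition) of zonoids, resp. centered zonoids. For an integrable random vector $\xi\in W$, $Z(\xi)$ and $K(\xi)$ are the zonoids with support functions $\mathbb E\max\{0,\langle u,\xi\rangle\}$ and $\frac12\mathbb E|\langle u,\xi\rangle|$; $Z(\xi)=K(\xi)+\frac12\mathbb E\xi$; every centered zonoid is some $K(\xi)$. The length $\ell$ is the translation invariant linear functional on $\widehat{\mathcal Z}(W)$ with $\ell(K(\xi))=\mathbb E\|\xi\|$. Algebra. Let $V$ be Euclidean of dimension $n$;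 $\Lambda^dV$ has the induced inner product. $\bigoplus_{d=0}^n\widehat{\mathcal Z}(\Lambda^dV)$ is a graded commutative real algebra with bilinear product determined by $Z(\xi_1)\wedge Z(\xi_2)=Z(\xi_1\wedge\xi_2)$ for independent integrable $\xi_i$ (then also $K(\xi_1)\wedge K(\xi_2)=K(\xi_1\wedge\xi_2)$); $Z(\xi)\mapsto(K(\xi),\mathbb E\xi)$ identifies it with $\big(\bigoplus_d\widehat{\mathcal Z}_o(\Lambda^dV)\big)\oplus\Lambda(V)$, with componentwise multiplication. $\widehat{\mathcal G}_o^d(V)$ is the span of the $K(\xi)$ with $\xi\in\Lambda^dV$ integrable and almost surely simple (of the form $v_1\wedge\dots\wedge v_d$); $\widehat{\mathcal G}^d(V)$ is the span of the $K+p$ with $K$ such a zonoid and $p\in\Lambda^dV$. With the bilinear pairing determined by $\langle K(\xi),K(\zeta)\rangle=\mathbb E|\langle\xi,\zeta\rangle|$ ($\xi,\zeta$ independent), $\mathcal I^d(V)=\{K\in\widehat{\mathcal G}_o^d(V):\langle K,L\rangle=0\text{ for all }L\in\widehat{\mathcal G}_o^d(V)\}$; $\mathcal I(V)=\bigoplus_d\mathcal I^d(V)$ is an ideal on which $\ell$ vanishes. $\mathcal Q(V)=\bigoplus_d\widehat{\mathcal G}^d(V)/\mathcal I^d(V)$, $\mathcal Q_o(V)=\bigoplus_d\widehat{\mathcal G}_o^d(V)/\mathcal I^d(V)$, so $\mathcal Q(V)=\mathcal Q_o(V)\oplus\Lambda(V)$. Homogeneous space. $M=S^n=G/H$, $G=\mathrm{SO}(n+1)$,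 $H=\mathrm{SO}(n)$, with the round metric; $\mathbf o=eH$, $V=T^*_{\mathbf o}M\cong\mathbb R^n$ with the standard $H$-action. The probabilistic intersection ring is $\mathrm H^+_{\mathbb E}(M)=\mathcal Q(V)^H=\mathrm H_{\mathbb E}(M)\oplus\mathrm H_c(M)$ with $\mathrm H_{\mathbb E}(M)=\mathcal Q_o(V)^H$, $\mathrm H_c(M)=\Lambda(V)^H$. $\varpi\in\Lambda^nV$ is an orientation (unit vector), and $[\varpi]$ is the corresponding element of the summand $\mathrm H_c(M)$; $[B]\in\mathrm H_{\mathbb E}(M)$ is the class of $B$. Classes of submanifolds. $g\in G$ acts on covectors by $g\eta=(D_{gy}a_{g^{-1}})^*\eta\in T^*_{gy}M$ for $\eta\in T_y^*M$, where $a_g(x)=gx$. Fix a measurable $\tau:M\to G$ with $\tau(y)y=\mathbf o$. For a submanifold $Y\subseteq M$ of codimension $d$ and finite volume and $y\in Y$ let $\pm\nu_Y(y)\in\Lambda^dT^*_yM$ be the unit simple vector representing the conormal space at $y$. Let $\xi_Y=\varepsilon\,\nu_{h\tau(y)Y}(\mathbf o)\in\Lambda^dV$ with $(h,y,\varepsilon)\in H\times Y\times\{\pm1\}$ uniform; $K(Y)=\frac{\mathrm{vol}(Y)}{\mathrm{vol}(M)}K(\xi_Y)$ and the Grassmann class of $Y$ is $[Y]_{\mathbb E}=[K(Y)]$. If $Y$ is cooriented (continuous choice of orientation of its conormal spaces), signs are chosen accordingly, $\xi_Y^+=\nu_{h\tau(y)Y}(\mathbf o)$, $Z(Y)=\frac{\mathrm{vol}(Y)}{\mathrm{vol}(M)}Z(\xi^+_Y)$,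 and $[Y]^+_{\mathbb E}=[Z(Y)]$.
   Formalization: In degree 0 the ring is R×R but [B] and [ϖ] generate only multiples of 1 there, so generation is stated by [B], [ϖ] together with the degree-0 part, and every homogeneous element of positive degree is shown to lie in the algebra generated by [B] and [ϖ] alone (for n ≥ 1). *)

theory Defs
  imports "HOL-Analysis.Analysis" "HOL-Probability.Probability" "HOL-Algebra.QuotRing"
begin

subsection \<open>Virtual zonoids\<close>

text \<open>
  A convex body is represented by its support function, a formal difference of bodies by the
  difference of the support functions. By \<open>formal_difference_eq_iff\<close> below, equality of such
  functions is equality of formal differences with respect to Minkowski addition. Virtual zonoids
  in a subspace of \<open>'a\<close> are thus functions on all of \<open>'a\<close>, and their vector space operations
  are the pointwise ones.
\<close>

definition support_fun :: "'a::euclidean_space set \<Rightarrow> 'a \<Rightarrow> real" where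
  "support_fun K u = (SUP x\<in>K. x \<bullet> u)"

lemma support_fun_upper:
  assumes "compact K" "x \<in> K"
  shows "x \<bullet> u \<le> support_fun K u"
  unfolding support_fun_def
proof (rule cSUP_upper[OF assms(2)])
  have "compact ((\<lambda>x. x \<bullet> u) ` K)"
    by (intro compact_continuous_image continuous_intros assms)
  then show "bdd_above ((\<lambda>x. x \<bullet> u) ` K)"
    by (simp add: bounded_imp_bdd_above compact_imp_bounded)
qed

lemma support_fun_least:
  assumes "K \<noteq> {}" "\<And>x. x \<in> K \<Longrightarrow> x \<bullet> u \<le> c"
  shows "support_fun K u \<le> c"
  unfolding support_fun_def by (intro cSUP_least assms)

lemma support_fun_attained:
  assumes "compact K" "K \<noteq> {}"
  obtains x where "x \<in> K" "support_fun K u = x \<bullet> u"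
proof -
  have "continuous_on K (\<lambda>x. x \<bullet> u)"
    by (intro continuous_intros)
  then obtain x where "x \<in> K" "\<forall>y\<in>K. y \<bullet> u \<le> x \<bullet> u"
    using continuous_attains_sup[OF assms] by blast
  then show ?thesis
    using that support_fun_upper[OF assms(1)] support_fun_least[OF assms(2)]
    by (simp add: order_antisym)
qed

lemma support_fun_minkowski_sum:
  assumes "compact K" "K \<noteq> {}" "compact L" "L \<noteq> {}"
  shows "support_fun {x + y |x y. x \<in> K \<and> y \<in> L} u = support_fun K u + support_fun L u"
proof (rule antisym)
  show "support_fun {x + y |x y. x \<in> K \<and> y \<in> L} u \<le> support_fun K u + support_fun L u"
  proof (rule support_fun_least)
    show "{x + y |x y. x \<in> K \<and> y \<in> L} \<noteq> {}"
      using assms by blast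
  next
    fix z assume "z \<in> {x + y |x y. x \<in> K \<and> y \<in> L}"
    then obtain x y where "z = x + y" "x \<in> K" "y \<in> L"
      by blast
    then show "z \<bullet> u \<le> support_fun K u + support_fun L u"
      using support_fun_upper[OF assms(1)] support_fun_upper[OF assms(3)]
      by (simp add: inner_add_left add_mono)
  qed
next
  obtain x where x: "x \<in> K" "support_fun K u = x \<bullet> u"
    using support_fun_attained[OF assms(1,2)] by blast
  obtain y where y: "y \<in> L" "support_fun L u = y \<bullet> u"
    using support_fun_attained[OF assms(3,4)] by blast
  have "(x + y) \<bullet> u \<le> support_fun {x + y |x y. x \<in> K \<and> y \<in> L} u"
    using x y by (intro support_fun_upper compact_sums assms) blast
  then show "support_fun K u + support_fun L u \<le> support_fun {x + y |x y. x \<in> K \<and> y \<in> L} u"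
    using x y by (simp add: inner_add_left)
qed

lemma support_fun_le_imp_subset:
  assumes "compact L" "convex L" "L \<noteq> {}" "compact K" "\<And>u. support_fun K u \<le> support_fun L u"
  shows "K \<subseteq> L"
proof
  fix z assume z: "z \<in> K"
  show "z \<in> L"
  proof (rule ccontr)
    assume "z \<notin> L"
    then obtain a b where ab: "a \<bullet> z < b" "\<forall>x\<in>L. b < a \<bullet> x"
      using separating_hyperplane_closed_point[of L z] assms compact_imp_closed by blast
    have "support_fun L (- a) \<le> - b"
      using ab assms(3) by (intro support_fun_least) (auto simp: inner_commute less_imp_le)
    moreover have "z \<bullet> (- a) \<le> support_fun K (- a)"
      using support_fun_upper[OF assms(4) z] .
    ultimately show False
      using assms(5)[of "- a"] ab(1) by (simp add: inner_commute)
  qed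
qed

lemma convex_minkowski_sum:
  assumes "convex K" "convex L"
  shows "convex {x + y |x y. x \<in> K \<and> y \<in> L}"
proof -
  have "{x + y |x y. x \<in> K \<and> y \<in> L} = (\<Union>x\<in>K. \<Union>y\<in>L. {x + y})"
    by blast
  then show ?thesis
    using convex_sums[OF assms] by simp
qed

lemma formal_difference_eq_iff:
  assumes "compact K" "convex K" "K \<noteq> {}" "compact L" "convex L" "L \<noteq> {}"
    and "compact K'" "convex K'" "K' \<noteq> {}" "compact L'" "convex L'" "L' \<noteq> {}"
  shows "(\<lambda>u. support_fun K u - support_fun L u) = (\<lambda>u. support_fun K' u - support_fun L' u)
    \<longleftrightarrow> {x + y |x y. x \<in> K \<and> y \<in> L'} = {x + y |x y. x \<in> K' \<and> y \<in> L}"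
    (is "_ \<longleftrightarrow> ?A = ?B")
proof
  assume eq: "(\<lambda>u. support_fun K u - support_fun L u) = (\<lambda>u. support_fun K' u - support_fun L' u)"
  have A: "compact ?A" "convex ?A" "?A \<noteq> {}"
    using compact_sums[OF assms(1,10)] convex_minkowski_sum[OF assms(2,11)] assms(3,12) by blast+
  have B: "compact ?B" "convex ?B" "?B \<noteq> {}"
    using compact_sums[OF assms(7,4)] convex_minkowski_sum[OF assms(8,5)] assms(9,6) by blast+
  have "support_fun ?A u = support_fun ?B u" for u
    using fun_cong[OF eq, of u] assms by (simp add: support_fun_minkowski_sum)
  then show "?A = ?B"
    using A B by (intro subset_antisym support_fun_le_imp_subset) simp_all
next
  assume "?A = ?B"
  then have "support_fun ?A u = support_fun ?B u" for u
    by simp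
  then have "support_fun K u + support_fun L' u = support_fun K' u + support_fun L u" for u
    using assms by (simp add: support_fun_minkowski_sum)
  then show "(\<lambda>u. support_fun K u - support_fun L u) = (\<lambda>u. support_fun K' u - support_fun L' u)"
    by (simp add: fun_eq_iff algebra_simps)
qed

text \<open>Integrable random vectors in \<open>W\<close> are given by their laws.\<close>

definition integrable_laws :: "'a::euclidean_space set \<Rightarrow> 'a measure set" where
  "integrable_laws W = {\<mu>. prob_space \<mu> \<and> sets \<mu> = sets borel \<and> integrable \<mu> (\<lambda>x. x)
     \<and> (AE x in \<mu>. x \<in> W)}"

definition zonoid_Z :: "'a::euclidean_space measure \<Rightarrow> 'a \<Rightarrow> real" where
  "zonoid_Z \<mu> u = (\<integral>x. max 0 (u \<bullet> x) \<partial>\<mu>)"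

definition zonoid_K :: "'a::euclidean_space measure \<Rightarrow> 'a \<Rightarrow> real" where
  "zonoid_K \<mu> u = 1 / 2 * (\<integral>x. \<bar>u \<bullet> x\<bar> \<partial>\<mu>)"

definition linear_span :: "('a \<Rightarrow> real) set \<Rightarrow> ('a \<Rightarrow> real) set" where
  "linear_span S = {f. \<exists>(N::nat) c g. (\<forall>i<N. g i \<in> S) \<and> f = (\<lambda>u. \<Sum>i<N. c i * g i u)}"

text \<open>The value at \<open>(f, g)\<close> of the bilinear map determined by its values \<open>\<beta> \<mu> \<nu>\<close> at the pairs
  \<open>(\<zeta> \<mu>, \<zeta> \<nu>)\<close> with \<open>\<mu> \<in> A\<close> and \<open>\<nu> \<in> B\<close>.\<close>

definition bilinear_extension ::
  "('l \<Rightarrow> 'a \<Rightarrow> real) \<Rightarrow> 'l set \<Rightarrow> 'l set \<Rightarrow> ('l \<Rightarrow> 'l \<Rightarrow> real) \<Rightarrow>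
    ('a \<Rightarrow> real) \<Rightarrow> ('a \<Rightarrow> real) \<Rightarrow> real" where
  "bilinear_extension \<zeta> A B \<beta> f g =
    (THE r. \<forall>(N::nat) a \<mu> (M::nat) b \<nu>.
       (\<forall>i<N. \<mu> i \<in> A) \<and> f = (\<lambda>u. \<Sum>i<N. a i * \<zeta> (\<mu> i) u) \<and>
       (\<forall>j<M. \<nu> j \<in> B) \<and> g = (\<lambda>u. \<Sum>j<M. b j * \<zeta> (\<nu> j) u) \<longrightarrow>
       r = (\<Sum>i<N. \<Sum>j<M. a i * b j * \<beta> (\<mu> i) (\<nu> j)))"

definition zonoid_length :: "'a::euclidean_space set \<Rightarrow> ('a \<Rightarrow> real) \<Rightarrow> real" where
  "zonoid_length W f =
    (THE r. \<forall>(N::nat) c \<mu> p.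
       (\<forall>i<N. \<mu> i \<in> integrable_laws W) \<and> p \<in> W \<and>
       f = (\<lambda>u. (\<Sum>i<N. c i * zonoid_K (\<mu> i) u) + u \<bullet> p) \<longrightarrow>
       r = (\<Sum>i<N. c i * (\<integral>x. norm x \<partial>\<mu> i)))"

subsection \<open>Exterior algebra\<close>

text \<open>
  The exterior algebra of \<open>E = real ^ 'm\<close> has the orthonormal basis \<open>axis S 1\<close>, which stands for
  the wedge product of the \<open>axis i 1\<close> with \<open>i \<in> S\<close> in increasing order. The inner product of
  \<open>real ^ 'm set\<close> is then the one induced from \<open>E\<close>. For a subspace \<open>V\<close> of \<open>E\<close>, the exterior
  powers of \<open>V\<close> are subspaces of it.
\<close>

type_synonym 'm evec = "(real, 'm) vec"
type_synonym 'm emat = "((real, 'm) vec, 'm) vec"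
type_synonym 'm ext = "real ^ 'm set"

definition shuffle_sign :: "'m::linorder set \<Rightarrow> 'm set \<Rightarrow> real" where
  "shuffle_sign S T = (-1) ^ card {(s, t). s \<in> S \<and> t \<in> T \<and> t < s}"

definition wedge :: "('m::{finite,linorder}) ext \<Rightarrow> 'm ext \<Rightarrow> 'm ext" where
  "wedge x y = (\<chi> U. \<Sum>S\<in>Pow U. shuffle_sign S (U - S) * x $ S * y $ (U - S))"

definition ext_vec :: "('m::{finite,linorder}) evec \<Rightarrow> 'm ext" where
  "ext_vec v = (\<Sum>i\<in>UNIV. v $ i *\<^sub>R axis {i} 1)"

definition wedges :: "('m::{finite,linorder}) evec list \<Rightarrow> 'm ext" where
  "wedges vs = foldr (\<lambda>v. wedge (ext_vec v)) vs (axis {} 1)"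

definition ext_power :: "('m::{finite,linorder}) evec set \<Rightarrow> nat \<Rightarrow> 'm ext set" where
  "ext_power V d = span {wedges vs |vs. length vs = d \<and> set vs \<subseteq> V}"

text \<open>The scalar factor only matters for \<open>d = 0\<close>.\<close>

definition simple_vectors :: "('m::{finite,linorder}) evec set \<Rightarrow> nat \<Rightarrow> 'm ext set" where
  "simple_vectors V d = {c *\<^sub>R wedges vs |c vs. length vs = d \<and> set vs \<subseteq> V}"

text \<open>The algebra endomorphism of the exterior algebra induced by a linear map of \<open>E\<close>.\<close>

definition ext_map :: "('m::{finite,linorder}) emat \<Rightarrow> 'm ext \<Rightarrow> 'm ext" where
  "ext_map g x = (\<Sum>S\<in>UNIV. x $ S *\<^sub>R wedges (map (\<lambda>i. g *v axis i 1) (sorted_list_of_set S)))"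

subsection \<open>The ring of Grassmann zonoids and its quotient\<close>

definition grassmann_laws ::
  "('m::{finite,linorder}) evec set \<Rightarrow> nat \<Rightarrow> 'm ext measure set" where
  "grassmann_laws V d =
    {\<mu> \<in> integrable_laws (ext_power V d). AE x in \<mu>. x \<in> simple_vectors V d}"

definition centered_grassmann ::
  "('m::{finite,linorder}) evec set \<Rightarrow> nat \<Rightarrow> ('m ext \<Rightarrow> real) set" where
  "centered_grassmann V d = linear_span (zonoid_K ` grassmann_laws V d)"

definition grassmann ::
  "('m::{finite,linorder}) evec set \<Rightarrow> nat \<Rightarrow> ('m ext \<Rightarrow> real) set" where
  "grassmann V d =
    linear_span {\<lambda>u. zonoid_K \<mu> u + u \<bullet> p |\<mu> p. \<mu> \<in> grassmann_laws V d \<and> p \<in> ext_power V d}"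

definition wedge_law ::
  "('m::{finite,linorder}) ext measure \<Rightarrow> 'm ext measure \<Rightarrow> 'm ext measure" where
  "wedge_law \<mu> \<nu> = distr (\<mu> \<Otimes>\<^sub>M \<nu>) borel (\<lambda>(x, y). wedge x y)"

definition zonoid_wedge ::
  "('m::{finite,linorder}) evec set \<Rightarrow> nat \<Rightarrow> nat \<Rightarrow>
    ('m ext \<Rightarrow> real) \<Rightarrow> ('m ext \<Rightarrow> real) \<Rightarrow> 'm ext \<Rightarrow> real" where
  "zonoid_wedge V d e f g u =
    bilinear_extension zonoid_Z (integrable_laws (ext_power V d)) (integrable_laws (ext_power V e))
      (\<lambda>\<mu> \<nu>. zonoid_Z (wedge_law \<mu> \<nu>) u) f g"

definition zonoid_pairing ::
  "('m::{finite,linorder}) evec set \<Rightarrow> nat \<Rightarrow> ('m ext \<Rightarrow> real) \<Rightarrow> ('m ext \<Rightarrow> real) \<Rightarrow> real" where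
  "zonoid_pairing V d =
    bilinear_extension zonoid_K (integrable_laws (ext_power V d)) (integrable_laws (ext_power V d))
      (\<lambda>\<mu> \<nu>. \<integral>z. \<bar>fst z \<bullet> snd z\<bar> \<partial>(\<mu> \<Otimes>\<^sub>M \<nu>))"

definition in_degree :: "nat \<Rightarrow> ('a \<Rightarrow> real) \<Rightarrow> nat \<Rightarrow> 'a \<Rightarrow> real" where
  "in_degree d f = (\<lambda>e. if e = d then f else (\<lambda>_. 0))"

text \<open>The direct sum over \<open>d \<le> dim V\<close>, as families indexed by all \<open>d\<close>: the component in degree
  \<open>d > dim V\<close> is \<open>0\<close> because the \<open>d\<close>-th exterior power is. The unit is the segment from \<open>0\<close> to \<open>1\<close>
  in degree \<open>0\<close>.\<close>

definition grassmann_ring ::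
  "('m::{finite,linorder}) evec set \<Rightarrow> (nat \<Rightarrow> 'm ext \<Rightarrow> real) ring" where
  "grassmann_ring V =
    \<lparr> carrier = {x. \<forall>d. x d \<in> grassmann V d},
      mult = (\<lambda>x y d u. \<Sum>i\<le>d. zonoid_wedge V i (d - i) (x i) (y (d - i)) u),
      one = in_degree 0 (zonoid_Z (return borel (axis {} 1))),
      zero = (\<lambda>d u. 0),
      add = (\<lambda>x y d u. x d u + y d u) \<rparr>"

definition null_ideal ::
  "('m::{finite,linorder}) evec set \<Rightarrow> (nat \<Rightarrow> 'm ext \<Rightarrow> real) set" where
  "null_ideal V =
    {x. \<forall>d. x d \<in> centered_grassmann V d \<and> (\<forall>L\<in>centered_grassmann V d. zonoid_pairing V d (x d) L = 0)}"

definition Q_ring ::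
  "('m::{finite,linorder}) evec set \<Rightarrow> (nat \<Rightarrow> 'm ext \<Rightarrow> real) set ring" where
  "Q_ring V = grassmann_ring V Quot null_ideal V"

definition Q_class ::
  "('m::{finite,linorder}) evec set \<Rightarrow> (nat \<Rightarrow> 'm ext \<Rightarrow> real) \<Rightarrow> (nat \<Rightarrow> 'm ext \<Rightarrow> real) set" where
  "Q_class V x = null_ideal V +>\<^bsub>grassmann_ring V\<^esub> x"

text \<open>Plain \<open>image\<close> would not give a coset for \<open>c = 0\<close>.\<close>

definition Q_scale ::
  "('m::{finite,linorder}) evec set \<Rightarrow> real \<Rightarrow>
    (nat \<Rightarrow> 'm ext \<Rightarrow> real) set \<Rightarrow> (nat \<Rightarrow> 'm ext \<Rightarrow> real) set" where
  "Q_scale V c X = (\<Union>x\<in>X. Q_class V (\<lambda>d u. c * x d u))"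

text \<open>Degree \<open>0\<close> consists of the formal differences of compact intervals and has dimension \<open>2\<close>: it
  contains, besides the real multiples of the unit, the idempotents of the two summands
  (centered zonoids and points).\<close>

definition Q_degree ::
  "('m::{finite,linorder}) evec set \<Rightarrow> nat \<Rightarrow> (nat \<Rightarrow> 'm ext \<Rightarrow> real) set set" where
  "Q_degree V d = {Q_class V (in_degree d f) |f. f \<in> grassmann V d}"

inductive_set generated_subalgebra :: "('a, 'b) ring_scheme \<Rightarrow> (real \<Rightarrow> 'a \<Rightarrow> 'a) \<Rightarrow> 'a set \<Rightarrow> 'a set"
  for R (structure) and scale and S where
  one: "\<one> \<in> generated_subalgebra R scale S"
| incl: "x \<in> S \<Longrightarrow> x \<in> generated_subalgebra R scale S"
| add: "x \<in> generated_subalgebra R scale S \<Longrightarrow> y \<in> generated_subalgebra R scale S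
    \<Longrightarrow> x \<oplus> y \<in> generated_subalgebra R scale S"
| mult: "x \<in> generated_subalgebra R scale S \<Longrightarrow> y \<in> generated_subalgebra R scale S
    \<Longrightarrow> x \<otimes> y \<in> generated_subalgebra R scale S"
| scale: "x \<in> generated_subalgebra R scale S \<Longrightarrow> scale c x \<in> generated_subalgebra R scale S"

subsection \<open>The sphere as a homogeneous space\<close>

text \<open>
  The round metric identifies the cotangent space of the unit sphere at \<open>y\<close> with the orthogonal
  complement of \<open>y\<close> in \<open>E\<close>. As rotations are isometries, the action of a rotation \<open>g\<close> on covectors
  (pulling back along the differential of the action of the inverse of \<open>g\<close>) becomes the linear
  action of \<open>g\<close>.
\<close>

definition cotangent :: "('m::finite) evec \<Rightarrow> 'm evec set" where
  "cotangent y = {v. v \<bullet> y = 0}"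

definition stabilizer :: "('m::finite) evec \<Rightarrow> 'm emat set" where
  "stabilizer pt = {g. rotation_matrix g \<and> g *v pt = pt}"

text \<open>The support function of the image of \<open>K\<close> under a linear map is the support function of \<open>K\<close>
  composed with the transposed map.\<close>

definition zonoid_act ::
  "('m::{finite,linorder}) emat \<Rightarrow> (nat \<Rightarrow> 'm ext \<Rightarrow> real) \<Rightarrow> nat \<Rightarrow> 'm ext \<Rightarrow> real" where
  "zonoid_act g x = (\<lambda>d u. x d (ext_map (transpose g) u))"

definition prob_intersection_ring ::
  "('m::{finite,linorder}) evec \<Rightarrow> (nat \<Rightarrow> 'm ext \<Rightarrow> real) set set" where
  "prob_intersection_ring pt =
    {X \<in> carrier (Q_ring (cotangent pt)). \<forall>g\<in>stabilizer pt. zonoid_act g ` X = X}"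

definition ball_element ::
  "('m::{finite,linorder}) evec set \<Rightarrow> nat \<Rightarrow> 'm ext \<Rightarrow> real" where
  "ball_element V = in_degree 1 (support_fun (ext_vec ` (V \<inter> cball 0 1)))"

text \<open>Under \<open>Z(\<xi>) \<mapsto> (K(\<xi>), E \<xi>)\<close> the pair \<open>(0, p)\<close> corresponds to the point \<open>p / 2\<close>, because the
  center of \<open>Z(\<xi>)\<close> is \<open>E \<xi> / 2\<close>.\<close>

definition orientation_element :: "nat \<Rightarrow> ('m::{finite,linorder}) ext \<Rightarrow> nat \<Rightarrow> 'm ext \<Rightarrow> real" where
  "orientation_element n p = in_degree n (\<lambda>u. 1 / 2 * (u \<bullet> p))"

subsection \<open>Submanifolds and volume\<close>

text \<open>For open \<open>S\<close>.\<close>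

primrec Ck_on :: "nat \<Rightarrow> 'a::euclidean_space set \<Rightarrow> ('a \<Rightarrow> 'b::euclidean_space) \<Rightarrow> bool" where
  "Ck_on 0 S = (\<lambda>f. continuous_on S f)"
| "Ck_on (Suc k) S = (\<lambda>f. (\<forall>x\<in>S. f differentiable (at x)) \<and>
     (\<forall>v. Ck_on k S (\<lambda>x. frechet_derivative f (at x) v)))"

definition smooth_submanifold :: "nat \<Rightarrow> 'a::euclidean_space set \<Rightarrow> bool" where
  "smooth_submanifold k Y \<longleftrightarrow>
    (\<forall>y\<in>Y. \<exists>U W (\<phi>::'a \<Rightarrow> 'a) \<psi> L. open U \<and> y \<in> U \<and> open W \<and> homeomorphism U W \<phi> \<psi> \<and>
       (\<forall>j. Ck_on j U \<phi> \<and> Ck_on j W \<psi>) \<and> subspace L \<and> dim L = k \<and> \<phi> ` (U \<inter> Y) = W \<inter> L)"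

definition tangent_space :: "'a::euclidean_space set \<Rightarrow> 'a \<Rightarrow> 'a set" where
  "tangent_space Y y = {t. \<exists>\<gamma>. \<gamma> 0 = y \<and> (\<forall>\<^sub>F s in at 0. \<gamma> s \<in> Y) \<and>
     (\<gamma> has_vector_derivative t) (at (0::real))}"

definition conormal_space :: "('m::finite) evec set \<Rightarrow> 'm evec \<Rightarrow> 'm evec set" where
  "conormal_space Y y = {v \<in> cotangent y. \<forall>t\<in>tangent_space Y y. v \<bullet> t = 0}"

text \<open>The possible values of \<open>\<plusminus>\<nu>\<^sub>Y(y)\<close>.\<close>

definition unit_conormals ::
  "nat \<Rightarrow> ('m::{finite,linorder}) evec set \<Rightarrow> 'm evec \<Rightarrow> 'm ext set" where
  "unit_conormals d Y y =
    {w. norm w = 1 \<and> (\<exists>vs. length vs = d \<and> span (set vs) = conormal_space Y y \<and> w = wedges vs)}"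

text \<open>Hausdorff measure, normalised so that it is the Riemannian volume on \<open>k\<close>-dimensional
  submanifolds. Bounded covering sets are required since \<open>diameter\<close> is meaningless for unbounded
  ones; the case distinction makes empty covering sets free for \<open>k = 0\<close>.\<close>

definition hausdorff_outer :: "nat \<Rightarrow> 'a::euclidean_space set \<Rightarrow> ennreal" where
  "hausdorff_outer k A =
    (SUP \<delta>\<in>{0<..}. INF C\<in>{C :: nat \<Rightarrow> 'a set. A \<subseteq> (\<Union>i. C i) \<and> (\<forall>i. bounded (C i) \<and> diameter (C i) \<le> \<delta>)}.
       \<Sum>i. if C i = {} then 0 else ennreal (unit_ball_vol (real k) * (diameter (C i) / 2) ^ k))"

definition hausdorff_measure :: "nat \<Rightarrow> 'a::euclidean_space measure" where
  "hausdorff_measure k = measure_of UNIV (sets borel) (hausdorff_outer k)"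

subsection \<open>Classes of submanifolds\<close>

text \<open>Normalised Haar measure on a compact matrix group.\<close>

definition uniform_law :: "('m::finite) emat set \<Rightarrow> 'm emat measure \<Rightarrow> bool" where
  "uniform_law H \<mu> \<longleftrightarrow> prob_space \<mu> \<and> sets \<mu> = sets borel \<and> (AE g in \<mu>. g \<in> H) \<and>
     (\<forall>h\<in>H. distr \<mu> borel (\<lambda>g. h ** g) = \<mu>)"

definition uniform_on :: "nat \<Rightarrow> 'a::euclidean_space set \<Rightarrow> 'a measure" where
  "uniform_on k Y = uniform_measure (restrict_space (hausdorff_measure k) Y) Y"

text \<open>In the following laws, \<open>ext_map (h ** \<tau> y) (\<nu> y)\<close> is the unit conormal vector at the base point
  of the translate of \<open>Y\<close> by \<open>h ** \<tau> y\<close>, with its sign carried along from \<open>\<nu>\<close>.\<close>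

definition submanifold_law ::
  "nat \<Rightarrow> 'm emat measure \<Rightarrow> ('m evec \<Rightarrow> 'm emat) \<Rightarrow>
    'm evec set \<Rightarrow> (('m::{finite,linorder}) evec \<Rightarrow> 'm ext) \<Rightarrow> 'm ext measure" where
  "submanifold_law k \<mu> \<tau> Y \<nu> =
    distr (\<mu> \<Otimes>\<^sub>M (uniform_on k Y \<Otimes>\<^sub>M uniform_count_measure {1, - 1})) borel
      (\<lambda>(h, y, \<epsilon>). \<epsilon> *\<^sub>R ext_map (h ** \<tau> y) (\<nu> y))"

definition cooriented_law ::
  "nat \<Rightarrow> 'm emat measure \<Rightarrow> ('m evec \<Rightarrow> 'm emat) \<Rightarrow>
    'm evec set \<Rightarrow> (('m::{finite,linorder}) evec \<Rightarrow> 'm ext) \<Rightarrow> 'm ext measure" where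
  "cooriented_law k \<mu> \<tau> Y \<nu> =
    distr (\<mu> \<Otimes>\<^sub>M uniform_on k Y) borel (\<lambda>(h, y). ext_map (h ** \<tau> y) (\<nu> y))"

definition volume_ratio :: "nat \<Rightarrow> nat \<Rightarrow> ('m::finite) evec set \<Rightarrow> real" where
  "volume_ratio n k Y =
    measure (hausdorff_measure k) Y / measure (hausdorff_measure n) (sphere (0 :: 'm evec) 1)"

definition grassmann_class ::
  "nat \<Rightarrow> nat \<Rightarrow> 'm evec \<Rightarrow> 'm emat measure \<Rightarrow> ('m evec \<Rightarrow> 'm emat) \<Rightarrow>
    'm evec set \<Rightarrow> (('m::{finite,linorder}) evec \<Rightarrow> 'm ext) \<Rightarrow> (nat \<Rightarrow> 'm ext \<Rightarrow> real) set" where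
  "grassmann_class n d pt \<mu> \<tau> Y \<nu> = Q_class (cotangent pt)
    (in_degree d (\<lambda>u. volume_ratio n (n - d) Y * zonoid_K (submanifold_law (n - d) \<mu> \<tau> Y \<nu>) u))"

definition cooriented_class ::
  "nat \<Rightarrow> nat \<Rightarrow> 'm evec \<Rightarrow> 'm emat measure \<Rightarrow> ('m evec \<Rightarrow> 'm emat) \<Rightarrow>
    'm evec set \<Rightarrow> (('m::{finite,linorder}) evec \<Rightarrow> 'm ext) \<Rightarrow> (nat \<Rightarrow> 'm ext \<Rightarrow> real) set" where
  "cooriented_class n d pt \<mu> \<tau> Y \<nu> = Q_class (cotangent pt)
    (in_degree d (\<lambda>u. volume_ratio n (n - d) Y * zonoid_Z (cooriented_law (n - d) \<mu> \<tau> Y \<nu>) u))"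

end

theory Submission
  imports Defs
begin

text \<open>
  Pairing a Grassmann zonoid with the segment spanned by a simple vector \<open>w\<close> evaluates its support
  function at \<open>w\<close>. Hence two elements have the same class iff their support functions agree on simple
  vectors, and products descend to classes because contracting a simple vector with a simple vector
  gives a simple vector. The stabilizer of a point of the sphere acts transitively on the unit simple
  vectors of degree \<open>0 < d < n\<close>, so that an invariant class is a multiple of the norm there, and the
  powers of the ball are nonzero multiples. In degree \<open>n\<close> the simple vectors form a line, on which a
  positively homogeneous function is a combination of \<open>\<bar>t\<bar>\<close> (a power of the ball) and \<open>t\<close> (the
  orientation). The law of a submanifold is invariant under the stabilizer; the factor in its class
  is found by pairing its zonoid with a power of the ball in two ways. In the cooriented case \<open>- w\<close>
  lies in the orbit of \<open>w\<close>, so \<open>Z\<close> is even on simple vectors and agrees with \<open>K\<close>.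
\<close>

text \<open>Products, pairings and lengths are definite descriptions, so each must first be shown
  independent of how a function is written as a combination of zonoids. For the bilinear operations
  Fubini does this: integrating out one factor leaves the function represented by the other,
  evaluated at a contraction.

  The standard Gaussian law supplies the constants. The mean of
  \<open>\<bar>u \<bullet> x\<bar>\<close> is \<open>sqrt (2 / pi) * norm u\<close>, so a projected
  and rescaled Gaussian vector has the unit ball as its centered zonoid, and the Gaussian mean of a
  centered zonoid is a fixed multiple of its length. No spherical integral has to be computed.

  Transitivity must be achieved by rotations, not merely by orthogonal maps. For
  \<open>d < n\<close> a direction orthogonal to the base point and to the \<open>d\<close> given
  vectors is left over, and reflecting it repairs the determinant; for \<open>0 < d\<close> there is
  a vector whose sign can be flipped. In degrees \<open>0\<close> and \<open>n\<close> the
  stabilizer acts trivially instead.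

  A submanifold of volume zero has no uniform law. Its classes are compared separately: they carry
  the factor zero.\<close>

section \<open>Signs of shuffles\<close>

lemma shuffle_sign_prod:
  "shuffle_sign (S :: 'm::{finite,linorder} set) T = (\<Prod>s\<in>S. \<Prod>t\<in>T. if t < s then - 1 else 1)"
proof -
  have "(\<Prod>s\<in>S. \<Prod>t\<in>T. if t < s then - 1 else (1::real))
      = (\<Prod>p\<in>S \<times> T. if snd p < fst p then - 1 else 1)"
    by (simp add: prod.cartesian_product split_beta)
  also have "\<dots> = (- 1) ^ card ((S \<times> T) \<inter> {p. snd p < fst p})"
    by (simp add: prod.If_cases)
  also have "(S \<times> T) \<inter> {p. snd p < fst p} = {(s, t). s \<in> S \<and> t \<in> T \<and> t < s}"
    by auto
  finally show ?thesis by (simp add: shuffle_sign_def)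
qed

lemma shuffle_sign_empty [simp]: "shuffle_sign {} T = 1" "shuffle_sign S {} = 1"
  by (simp_all add: shuffle_sign_def)

text \<open>Multiplicativity in each argument is what associativity of the wedge product needs on
  basis vectors. It is immediate once the sign is a product over pairs.\<close>

lemma shuffle_sign_Un_left:
  fixes S T U :: "'m::{finite,linorder} set"
  assumes "S \<inter> T = {}"
  shows "shuffle_sign (S \<union> T) U = shuffle_sign S U * shuffle_sign T U"
  using assms by (simp add: shuffle_sign_prod prod.union_disjoint)

lemma shuffle_sign_Un_right:
  fixes S T U :: "'m::{finite,linorder} set"
  assumes "T \<inter> U = {}"
  shows "shuffle_sign S (T \<union> U) = shuffle_sign S T * shuffle_sign S U"
  using assms by (simp add: shuffle_sign_prod prod.union_disjoint prod.distrib)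

lemma shuffle_sign_insert_right:
  fixes T S :: "'m::{finite,linorder} set"
  assumes "i \<notin> T"
  shows "shuffle_sign S (insert i T) = shuffle_sign S {i} * shuffle_sign S T"
  using shuffle_sign_Un_right[of "{i}" T S] assms by simp

lemma shuffle_sign_square [simp]: "shuffle_sign S T * shuffle_sign S T = 1"
  by (simp add: shuffle_sign_def flip: power_add mult_2)

lemma shuffle_sign_cancel [simp]: "shuffle_sign S T * (shuffle_sign S T * x) = x"
  by (simp flip: mult.assoc)

lemma shuffle_sign_singletons:
  "shuffle_sign {i} {j} = (if (j::'m::{finite,linorder}) < i then - 1 else 1)"
  by (simp add: shuffle_sign_prod)

text \<open>Every element of \<open>S\<close> lies on exactly one side of \<open>i\<close>, so
  exchanging the arguments negates each of the \<open>card S\<close> factors.\<close>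

lemma shuffle_sign_commute:
  fixes i :: "'m::{finite,linorder}"
  assumes "i \<notin> S"
  shows "shuffle_sign S {i} = (- 1) ^ card S * shuffle_sign {i} S"
proof -
  have *: "(if i < s then - 1 else (1::real)) = - 1 * (if s < i then - 1 else 1)" if "s \<in> S" for s
    using that assms by (cases s i rule: linorder_cases) auto
  have "shuffle_sign S {i} = (\<Prod>s\<in>S. - 1 * (if s < i then - 1 else (1::real)))"
    by (simp add: shuffle_sign_prod * cong: prod.cong)
  also have "\<dots> = (- 1) ^ card S * shuffle_sign {i} S"
    by (simp only: prod.distrib) (simp add: shuffle_sign_prod)
  finally show ?thesis .
qed

lemma shuffle_sign_less:
  fixes i :: "'m::{finite,linorder}"
  assumes "\<And>s. s \<in> S \<Longrightarrow> i < s"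
  shows "shuffle_sign {i} S = 1"
  using assms by (auto simp: shuffle_sign_prod not_less less_imp_le intro!: prod.neutral dest: less_asym)

subsection \<open>The wedge product\<close>

lemma bilinear_wedge: "bilinear (wedge :: ('m::{finite,linorder}) ext \<Rightarrow> 'm ext \<Rightarrow> 'm ext)"
  by (auto simp: bilinear_def wedge_def vec_eq_iff algebra_simps sum.distrib sum_distrib_left
      intro!: linearI)

interpretation wedge: bounded_bilinear "wedge :: ('m::{finite,linorder}) ext \<Rightarrow> 'm ext \<Rightarrow> 'm ext"
  using bilinear_wedge by (simp add: bilinear_conv_bounded_bilinear)

declare wedge.zero_left [simp] wedge.zero_right [simp]

lemma wedge_axis:
  "wedge (axis S 1) (axis T 1) =
    (if S \<inter> T = {} then shuffle_sign S T *\<^sub>R axis (S \<union> T) 1 else (0::('m::{finite,linorder}) ext))"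
proof -
  have "wedge (axis S 1) (axis T 1) $ U =
      (if S \<inter> T = {} then shuffle_sign S T *\<^sub>R axis (S \<union> T) 1 else (0 :: 'm ext)) $ U" for U
  proof -
    have "wedge (axis S 1 :: 'm ext) (axis T 1) $ U =
        (\<Sum>A\<in>Pow U. if A = S then shuffle_sign S (U - S) * (if U - S = T then 1 else 0) else 0)"
      unfolding wedge_def vec_lambda_beta by (rule sum.cong) (simp_all add: axis_def)
    also have "\<dots> = (if S \<subseteq> U \<and> U - S = T then shuffle_sign S T else 0)"
      by (simp add: sum.delta)
    also have "S \<subseteq> U \<and> U - S = T \<longleftrightarrow> S \<inter> T = {} \<and> U = S \<union> T"
      by blast
    finally show ?thesis
      by (auto simp: axis_def)
  qed
  then show ?thesis
    by (simp add: vec_eq_iff)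
qed

lemma ext_expand: "(x :: ('m::finite) ext) = (\<Sum>S\<in>UNIV. x $ S *\<^sub>R axis S 1)"
  by (simp add: vec_eq_iff axis_def if_distrib cong: if_cong)

text \<open>Multilinear identities are proved by repeated use of this rule, releasing one argument
  after another from being a basis vector.\<close>

lemma linear_eq_axis:
  fixes f g :: "('m::finite) ext \<Rightarrow> 'b::real_vector"
  assumes "linear f" "linear g" "\<And>S. f (axis S 1) = g (axis S 1)"
  shows "f x = g x"
proof -
  have "f (\<Sum>S\<in>UNIV. x $ S *\<^sub>R axis S 1) = g (\<Sum>S\<in>UNIV. x $ S *\<^sub>R axis S 1)"
    using assms by (simp add: linear_sum linear_cmul)
  then show ?thesis
    by (simp flip: ext_expand)
qed

lemma linear_eq_vec_axis:
  fixes f g :: "('m::finite) evec \<Rightarrow> 'b::real_vector"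
  assumes "linear f" "linear g" "\<And>i. f (axis i 1) = g (axis i 1)"
  shows "f x = g x"
proof -
  have "(\<Sum>i\<in>UNIV. x $ i *\<^sub>R axis i 1) = x"
    by (simp add: vec_eq_iff axis_def if_distrib cong: if_cong)
  moreover have "f (\<Sum>i\<in>UNIV. x $ i *\<^sub>R axis i 1) = g (\<Sum>i\<in>UNIV. x $ i *\<^sub>R axis i 1)"
    using assms by (simp add: linear_sum linear_cmul)
  ultimately show ?thesis by simp
qed

lemma linear_wedge_left: "linear (\<lambda>x. wedge x (y :: ('m::{finite,linorder}) ext))"
  by (simp add: linear_iff wedge.add_left wedge.scaleR_left)

lemma linear_wedge_right: "linear (wedge (x :: ('m::{finite,linorder}) ext))"
  by (simp add: linear_iff wedge.add_right wedge.scaleR_right)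

text \<open>On basis vectors both sides vanish unless the three index sets are pairwise disjoint,
  and otherwise both carry the product of the three pairwise signs.\<close>

lemma wedge_assoc:
  "wedge (wedge x y) z = wedge x (wedge y (z :: ('m::{finite,linorder}) ext))"
proof -
  have *: "wedge (wedge (axis A 1) (axis B 1)) (axis C 1) =
      wedge (axis A 1) (wedge (axis B 1) (axis C 1 :: 'm ext))" for A B C
    by (auto simp: wedge_axis wedge.scaleR_left wedge.scaleR_right shuffle_sign_Un_left
        shuffle_sign_Un_right Un_assoc Int_Un_distrib Int_Un_distrib2)
  have **: "wedge (wedge (axis A 1) (axis B 1)) z = wedge (axis A 1) (wedge (axis B 1) z)" for A B
    by (rule linear_eq_axis[where x = z])
      (auto simp: * linear_iff wedge.add_right wedge.scaleR_right)
  have ***: "wedge (wedge (axis A 1) y) z = wedge (axis A 1) (wedge y z)" for A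
    by (rule linear_eq_axis[where x = y])
      (auto simp: ** linear_iff wedge.add_right wedge.scaleR_right wedge.add_left wedge.scaleR_left)
  show ?thesis
    by (rule linear_eq_axis[where x = x])
      (auto simp: *** linear_iff wedge.add_left wedge.scaleR_left)
qed

lemma wedge_one_left [simp]: "wedge (axis {} 1) x = (x :: ('m::{finite,linorder}) ext)"
  by (rule linear_eq_axis[where x = x]) (auto simp: linear_iff wedge.add_right wedge.scaleR_right wedge_axis)

lemma wedge_one_right [simp]: "wedge x (axis {} 1) = (x :: ('m::{finite,linorder}) ext)"
  by (rule linear_eq_axis[where x = x]) (auto simp: linear_iff wedge.add_left wedge.scaleR_left wedge_axis)

lemma linear_ext_vec: "linear (ext_vec :: ('m::{finite,linorder}) evec \<Rightarrow> 'm ext)"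
  by (simp add: linear_iff ext_vec_def algebra_simps sum.distrib scaleR_sum_right)

lemmas ext_vec_linear_simps =
  linear_add[OF linear_ext_vec] linear_cmul[OF linear_ext_vec] linear_0[OF linear_ext_vec]
  linear_diff[OF linear_ext_vec] linear_neg[OF linear_ext_vec] linear_sum[OF linear_ext_vec]

lemma ext_vec_axis [simp]: "ext_vec (axis i 1) = (axis {i} 1 :: ('m::{finite,linorder}) ext)"
  by (simp add: ext_vec_def axis_def vec_eq_iff if_distrib if_distribR cong: if_cong)

text \<open>The adjoint of \<open>ext_vec\<close>: it turns support functions of bodies of degree
  one into functions on the underlying space.\<close>

definition ext_coords :: "('m::finite) ext \<Rightarrow> 'm evec" where
  "ext_coords u = (\<chi> i. u $ {i})"

lemma inner_ext_vec: "u \<bullet> ext_vec v = ext_coords u \<bullet> (v :: ('m::{finite,linorder}) evec)"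
  unfolding ext_vec_def inner_sum_right inner_scaleR_right inner_axis
  by (simp add: ext_coords_def inner_vec_def mult.commute)

lemma ext_coords_ext_vec [simp]: "ext_coords (ext_vec v) = (v :: ('m::{finite,linorder}) evec)"
  by (simp add: ext_coords_def ext_vec_def vec_eq_iff axis_def if_distrib cong: if_cong)

lemma norm_ext_vec [simp]: "norm (ext_vec v) = norm (v :: ('m::{finite,linorder}) evec)"
  by (simp add: norm_eq_sqrt_inner inner_ext_vec)

lemma wedge_ext_vec_commute:
  "wedge (ext_vec v) (ext_vec w) = - wedge (ext_vec w) (ext_vec (v :: ('m::{finite,linorder}) evec))"
proof -
  have *: "wedge (ext_vec (axis i 1)) (ext_vec (axis j 1)) =
      - wedge (ext_vec (axis j 1)) (ext_vec (axis i 1 :: 'm evec))" for i j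
    by (auto simp: wedge_axis shuffle_sign_singletons insert_commute)
  have **: "wedge (ext_vec (axis i 1)) (ext_vec w) = - wedge (ext_vec w) (ext_vec (axis i 1))" for i
    by (rule linear_eq_vec_axis[where x = w])
     (rule * | force simp: linear_iff wedge.add_right wedge.scaleR_right wedge.add_left wedge.scaleR_left ext_vec_linear_simps
       simp del: ext_vec_axis)+
  show ?thesis
    by (rule linear_eq_vec_axis[where x = v])
     (rule ** | force simp: linear_iff wedge.add_right wedge.scaleR_right wedge.add_left wedge.scaleR_left ext_vec_linear_simps
       simp del: ext_vec_axis)+
qed

lemma wedge_ext_vec_swap:
  "wedge (ext_vec v) (wedge (ext_vec w) x) = - wedge (ext_vec w) (wedge (ext_vec v) (x :: ('m::{finite,linorder}) ext))"
  by (metis wedge_assoc wedge_ext_vec_commute wedge.minus_left)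

lemma wedge_ext_vec_same [simp]:
  "wedge (ext_vec v) (wedge (ext_vec v) x) = (0 :: ('m::{finite,linorder}) ext)"
proof -
  have "(2::real) *\<^sub>R wedge (ext_vec v) (wedge (ext_vec v) x) = 0"
    using wedge_ext_vec_swap[of v v x] by (simp add: scaleR_2 eq_neg_iff_add_eq_0)
  then show ?thesis by simp
qed

lemma wedges_Nil [simp]: "wedges [] = axis {} 1"
  and wedges_Cons [simp]: "wedges (v # vs) = wedge (ext_vec v) (wedges vs)"
  by (simp_all add: wedges_def)

lemma wedges_append: "wedges (xs @ ys) = wedge (wedges xs) (wedges (ys :: ('m::{finite,linorder}) evec list))"
  by (induction xs) (simp_all add: wedge_assoc)

lemma wedge_mem_wedges: "v \<in> set vs \<Longrightarrow> wedge (ext_vec v) (wedges vs) = (0 :: ('m::{finite,linorder}) ext)"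
proof (induction vs)
  case (Cons w vs)
  then show ?case
    by (cases "v = w") (auto simp: wedge_ext_vec_swap[of v w] wedge.zero_right)
qed simp

lemma wedge_span_wedges:
  assumes "v \<in> span (set vs)"
  shows "wedge (ext_vec v) (wedges vs) = (0 :: ('m::{finite,linorder}) ext)"
  using assms
proof (induction rule: span_induct_alt)
  case base then show ?case by (simp add: ext_vec_linear_simps wedge.zero_left)
next
  case (step c x y)
  then show ?case
    by (simp add: ext_vec_linear_simps wedge.add_left wedge.scaleR_left wedge_mem_wedges)
qed

text \<open>Insertion moves the new factor past the entries smaller than \<open>i\<close>, at the
  cost of one sign each; these are the pairs counted by \<open>shuffle_sign {i}\<close>.\<close>

lemma wedges_insort:
  fixes f :: "'m::{finite,linorder} \<Rightarrow> 'm evec"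
  assumes "sorted xs" "i \<notin> set xs" "distinct xs"
  shows "wedges (map f (insort i xs)) = shuffle_sign {i} (set xs) *\<^sub>R wedge (ext_vec (f i)) (wedges (map f xs))"
  using assms
proof (induction xs)
  case (Cons x xs)
  show ?case
  proof (cases "i \<le> x")
    case True
    then have "shuffle_sign {i} (set (x # xs)) = 1"
      using Cons.prems by (intro shuffle_sign_less) (auto simp: less_le)
    then show ?thesis using True by simp
  next
    case False
    have "shuffle_sign {i} (set (x # xs)) = - shuffle_sign {i} (set xs)"
      using False Cons.prems by (simp add: shuffle_sign_insert_right shuffle_sign_singletons)
    then show ?thesis
      using False Cons by (simp add: wedge.scaleR_right wedge_ext_vec_swap[of "f x" "f i"])
  qed
qed simp

lemma wedges_sorted_list_insert:
  fixes f :: "'m::{finite,linorder} \<Rightarrow> 'm evec"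
  assumes "i \<notin> S"
  shows "wedges (map f (sorted_list_of_set (insert i S))) =
    shuffle_sign {i} S *\<^sub>R wedge (ext_vec (f i)) (wedges (map f (sorted_list_of_set S)))"
  using wedges_insort[of "sorted_list_of_set S" i f] assms by simp

text \<open>Products of vectors therefore span, and linear identities can be tested on
  \<open>wedges vs\<close>, where induction on the list replaces the bookkeeping of signs.\<close>

lemma axis_eq_wedges:
  "axis S 1 = wedges (map (\<lambda>i. axis i 1) (sorted_list_of_set (S :: 'm::{finite,linorder} set)))"
proof (induction S rule: infinite_finite_induct)
  case (insert i S)
  have "axis (insert i S) 1 = shuffle_sign {i} S *\<^sub>R wedge (ext_vec (axis i 1)) (axis S 1 :: 'm ext)"
    using insert(2) by (simp add: wedge_axis)
  then show ?case
    unfolding wedges_sorted_list_insert[OF insert(2)] insert(3)[symmetric] .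
qed simp_all

lemma linear_eq_wedges:
  fixes f g :: "('m::{finite,linorder}) ext \<Rightarrow> 'b::real_vector"
  assumes "linear f" "linear g" "\<And>vs. f (wedges vs) = g (wedges vs)"
  shows "f x = g x"
  by (rule linear_eq_axis[OF assms(1,2)]) (simp only: axis_eq_wedges assms(3))

subsection \<open>Induced maps\<close>

lemma linear_ext_map: "linear (ext_map (g :: ('m::{finite,linorder}) emat))"
  by (simp add: linear_iff ext_map_def algebra_simps sum.distrib scaleR_sum_right)

lemma ext_map_axis:
  "ext_map g (axis S 1) =
    wedges (map (\<lambda>i. g *v axis i 1) (sorted_list_of_set (S :: 'm::{finite,linorder} set)))"
proof -
  have "ext_map g (axis S 1) = (\<Sum>T\<in>UNIV. if T = S then
      wedges (map (\<lambda>i. g *v axis i 1) (sorted_list_of_set T)) else 0)"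
    unfolding ext_map_def by (rule sum.cong) (simp_all add: axis_def[of S])
  then show ?thesis by simp
qed

text \<open>\<open>ext_map\<close> is defined through sorted products of basis vectors; splitting
  off an arbitrary vector is the step from which multiplicativity follows. On basis vectors both
  sides vanish for a repeated index, and otherwise the sign of the insertion occurs twice and
  cancels.\<close>

lemma ext_map_wedge_ext_vec:
  "ext_map g (wedge (ext_vec v) x) = wedge (ext_vec (g *v v)) (ext_map g (x :: ('m::{finite,linorder}) ext))"
proof -
  have *: "ext_map g (wedge (ext_vec (axis i 1)) (axis S 1)) = wedge (ext_vec (g *v axis i 1)) (ext_map g (axis S 1))" for i S
  proof (cases "i \<in> S")
    case True
    then have "wedge (ext_vec (g *v axis i 1)) (ext_map g (axis S 1)) = 0"
      unfolding ext_map_axis by (intro wedge_mem_wedges) auto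
    then show ?thesis
      using True by (simp add: wedge_axis linear_0[OF linear_ext_map])
  next
    case False
    have "ext_map g (axis (insert i S) 1) =
        shuffle_sign {i} S *\<^sub>R wedge (ext_vec (g *v axis i 1)) (ext_map g (axis S 1))"
      unfolding ext_map_axis by (rule wedges_sorted_list_insert[OF False])
    then show ?thesis
      using False by (simp add: wedge_axis linear_cmul[OF linear_ext_map])
  qed
  have **: "ext_map g (wedge (ext_vec v) (axis S 1)) = wedge (ext_vec (g *v v)) (ext_map g (axis S 1))" for S
    by (rule linear_eq_vec_axis[where x = v])
      (auto simp: * linear_iff wedge.add_left wedge.scaleR_left ext_vec_linear_simps
       matrix_vector_right_distrib linear_add[OF linear_ext_map] linear_cmul[OF linear_ext_map]
       matrix_vector_mult_scaleR simp del: ext_vec_axis)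
  show ?thesis
    by (rule linear_eq_axis[where x = x])
      (auto simp: ** linear_iff wedge.add_right wedge.scaleR_right
        linear_add[OF linear_ext_map] linear_cmul[OF linear_ext_map])
qed

lemma ext_map_one [simp]: "ext_map g (axis {} 1) = (axis {} 1 :: ('m::{finite,linorder}) ext)"
  by (simp add: ext_map_axis)

lemma ext_map_wedges: "ext_map g (wedges vs) = wedges (map ((*v) g) (vs :: ('m::{finite,linorder}) evec list))"
  by (induction vs) (simp_all add: ext_map_wedge_ext_vec)

lemma ext_map_wedge: "ext_map g (wedge x y) = wedge (ext_map g x) (ext_map g (y :: ('m::{finite,linorder}) ext))"
proof (rule linear_eq_wedges[where x = x])
  fix vs :: "'m evec list"
  show "ext_map g (wedge (wedges vs) y) = wedge (ext_map g (wedges vs)) (ext_map g y)"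
    by (induction vs) (simp_all add: ext_map_wedge_ext_vec wedge_assoc)
qed (auto simp: linear_iff wedge.add_left wedge.scaleR_left linear_add[OF linear_ext_map] linear_cmul[OF linear_ext_map])

lemma ext_map_mult: "ext_map (A ** B) x = ext_map A (ext_map B (x :: ('m::{finite,linorder}) ext))"
  by (rule linear_eq_wedges[where x = x])
    (auto simp: ext_map_wedges matrix_vector_mul_assoc comp_def linear_iff linear_add[OF linear_ext_map] linear_cmul[OF linear_ext_map])

lemma ext_map_id [simp]: "ext_map (mat 1) x = (x :: ('m::{finite,linorder}) ext)"
proof (rule linear_eq_wedges[where x = x])
  have "(*v) (mat 1) = (id :: 'm evec \<Rightarrow> 'm evec)"
    by auto
  then show "ext_map (mat 1) (wedges vs) = wedges vs" for vs :: "'m evec list"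
    by (simp add: ext_map_wedges)
qed (auto simp: linear_iff linear_add[OF linear_ext_map] linear_cmul[OF linear_ext_map])

lemmas ext_map_linear_simps =
  linear_add[OF linear_ext_map] linear_cmul[OF linear_ext_map] linear_0[OF linear_ext_map]
  linear_diff[OF linear_ext_map] linear_neg[OF linear_ext_map]

subsection \<open>Contractions\<close>

text \<open>The interior product, taken as an adjoint so that \<open>u \<bullet> wedge x y\<close>
  becomes \<open>contr x u \<bullet> y\<close>. Integrating over \<open>y\<close> then gives a
  zonoid function evaluated at \<open>contr x u\<close>.\<close>

definition contr :: "('m::{finite,linorder}) ext \<Rightarrow> 'm ext \<Rightarrow> 'm ext" where
  "contr a = adjoint (wedge a)"

definition contr_right :: "('m::{finite,linorder}) ext \<Rightarrow> 'm ext \<Rightarrow> 'm ext" where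
  "contr_right b = adjoint (\<lambda>x. wedge x b)"

lemma inner_contr: "contr a u \<bullet> x = u \<bullet> wedge a (x :: ('m::{finite,linorder}) ext)"
  unfolding contr_def using adjoint_works[OF linear_wedge_right] by (metis inner_commute)

lemma inner_contr_right: "contr_right b u \<bullet> x = u \<bullet> wedge x (b :: ('m::{finite,linorder}) ext)"
  unfolding contr_right_def using adjoint_works[OF linear_wedge_left] by (metis inner_commute)

lemma inner_eqI: "(\<And>z. x \<bullet> z = y \<bullet> z) \<Longrightarrow> x = (y :: 'a::real_inner)"
  using vector_eq_rdot by blast

lemma contr_wedge: "contr (wedge a b) u = contr b (contr a (u :: ('m::{finite,linorder}) ext))"
  by (rule inner_eqI) (simp add: inner_contr wedge_assoc)

lemma contr_right_wedge:
  "contr_right (wedge a b) u = contr_right a (contr_right b (u :: ('m::{finite,linorder}) ext))"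
  by (rule inner_eqI) (simp add: inner_contr_right wedge_assoc)

lemma bilinear_contr: "bilinear (contr :: ('m::{finite,linorder}) ext \<Rightarrow> 'm ext \<Rightarrow> 'm ext)"
  unfolding bilinear_def
  by (intro conjI allI linearI; rule inner_eqI)
    (simp_all add: inner_contr inner_add_left inner_add_right wedge.add_left wedge.scaleR_left)

lemma bilinear_contr_right: "bilinear (contr_right :: ('m::{finite,linorder}) ext \<Rightarrow> 'm ext \<Rightarrow> 'm ext)"
  unfolding bilinear_def
  by (intro conjI allI linearI; rule inner_eqI)
    (simp_all add: inner_contr_right inner_add_left inner_add_right wedge.add_right wedge.scaleR_right)

interpretation contr: bounded_bilinear "contr :: ('m::{finite,linorder}) ext \<Rightarrow> 'm ext \<Rightarrow> 'm ext"
  using bilinear_contr by (simp add: bilinear_conv_bounded_bilinear)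

interpretation contr_right: bounded_bilinear "contr_right :: ('m::{finite,linorder}) ext \<Rightarrow> 'm ext \<Rightarrow> 'm ext"
  using bilinear_contr_right by (simp add: bilinear_conv_bounded_bilinear)

declare contr.zero_left [simp] contr.zero_right [simp]
  contr_right.zero_left [simp] contr_right.zero_right [simp]

lemma contr_axis:
  fixes i :: "'m::{finite,linorder}"
  shows "contr (axis {i} 1) (axis T 1) =
    (if i \<in> T then shuffle_sign {i} (T - {i}) *\<^sub>R axis (T - {i}) 1 else 0)"
proof (rule inner_eqI, rule linear_eq_axis[OF bounded_linear.linear[OF bounded_linear_inner_right]
      bounded_linear.linear[OF bounded_linear_inner_right]])
  fix S :: "'m set"
  have "contr (axis {i} 1) (axis T 1) \<bullet> axis S 1 =
      (if i \<in> S then 0 else shuffle_sign {i} S * (if T = insert i S then 1 else 0))"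
    by (simp add: inner_contr wedge_axis inner_axis_axis)
  also have "\<dots> = (if i \<in> T then shuffle_sign {i} (T - {i}) *\<^sub>R axis (T - {i}) 1 else 0) \<bullet> axis S (1::real)"
    by (auto simp: inner_axis_axis)
  finally show "contr (axis {i} 1) (axis T 1) \<bullet> axis S 1 =
      (if i \<in> T then shuffle_sign {i} (T - {i}) *\<^sub>R axis (T - {i}) 1 else 0) \<bullet> axis S (1::real)" .
qed

text \<open>The antiderivation rule. For distinct basis vectors \<open>i\<close> and
  \<open>j\<close>, the only case with signs to compare is \<open>i \<in> S\<close> and
  \<open>j \<notin> S\<close>; in all others both sides vanish.\<close>

lemma contr_ext_vec_wedge:
  "contr (ext_vec v) (wedge (ext_vec w) x) =
    (v \<bullet> w) *\<^sub>R x - wedge (ext_vec w) (contr (ext_vec v) (x :: ('m::{finite,linorder}) ext))"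
proof -
  have ax: "contr (ext_vec (axis i 1)) (wedge (ext_vec (axis j 1)) (axis S 1)) =
    (axis i 1 \<bullet> axis j (1::real)) *\<^sub>R axis S 1 -
      wedge (ext_vec (axis j 1)) (contr (ext_vec (axis i 1)) (axis S 1 :: 'm ext))" for i j S
  proof (cases "i = j")
    case True
    then show ?thesis
      by (cases "i \<in> S")
        (auto simp: wedge_axis contr_axis contr.scaleR_right wedge.scaleR_right inner_axis_axis insert_absorb)
  next
    case False
    show ?thesis
    proof (cases "i \<in> S \<and> j \<notin> S")
      case True
      define U where "U = S - {i}"
      have U: "S = insert i U" "i \<notin> U" "j \<notin> U" using True U_def by auto
      have "insert j (insert i U) - {i} = insert j U" "insert j (insert i U) = insert i (insert j U)"
        using False U by auto
      then show ?thesis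
        using False U
        by (auto simp: wedge_axis contr_axis contr.scaleR_right wedge.scaleR_right inner_axis_axis
            shuffle_sign_insert_right shuffle_sign_singletons dest: less_asym)
    next
      case False': False
      then show ?thesis
        using False
        by (auto simp: wedge_axis contr_axis contr.scaleR_right wedge.scaleR_right inner_axis_axis)
    qed
  qed
  have 1: "contr (ext_vec (axis i 1)) (wedge (ext_vec (axis j 1)) x) =
    (axis i 1 \<bullet> axis j (1::real)) *\<^sub>R x - wedge (ext_vec (axis j 1)) (contr (ext_vec (axis i 1)) x)" for i j
    by (rule linear_eq_axis[where x = x]; (rule ax)?)
      (auto simp: linear_iff wedge.add_right wedge.scaleR_right contr.add_right contr.scaleR_right algebra_simps)
  have 2: "contr (ext_vec (axis i 1)) (wedge (ext_vec w) x) =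
    (axis i 1 \<bullet> w) *\<^sub>R x - wedge (ext_vec w) (contr (ext_vec (axis i 1)) x)" for i
    by (rule linear_eq_vec_axis[where x = w]; (rule 1)?)
      (auto simp: linear_iff wedge.add_left wedge.scaleR_left contr.add_right contr.scaleR_right
        ext_vec_linear_simps inner_add_right algebra_simps)
  show ?thesis
    by (rule linear_eq_vec_axis[where x = v]; (rule 2)?)
      (auto simp: linear_iff wedge.add_right wedge.scaleR_right contr.add_left contr.scaleR_left
        ext_vec_linear_simps inner_add_left algebra_simps)
qed

lemma contr_ext_vec_one [simp]: "contr (ext_vec v) (axis {} 1) = (0 :: ('m::{finite,linorder}) ext)"
  by (rule linear_eq_vec_axis[where x = v])
    (auto simp: linear_iff contr.add_left contr.scaleR_left ext_vec_linear_simps contr_axis)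

lemma contr_orthogonal_wedges:
  assumes "\<And>w. w \<in> set vs \<Longrightarrow> v \<bullet> w = 0"
  shows "contr (ext_vec v) (wedges vs) = (0 :: ('m::{finite,linorder}) ext)"
  using assms by (induction vs) (auto simp: contr_ext_vec_wedge)

lemma inner_transpose: "v \<bullet> (transpose g *v w) = (g *v v) \<bullet> (w :: ('m::finite) evec)"
  by (metis dot_lmul_matrix inner_commute transpose_matrix_vector)

lemma inner_vector_matrix: "v \<bullet> (w v* g) = (g *v v) \<bullet> (w :: ('m::finite) evec)"
  by (metis dot_lmul_matrix inner_commute)

text \<open>The one-vector case of \<open>contr_ext_map\<close>. It comes straight from the
  antiderivation rule, because the adjointness of \<open>ext_map\<close> is itself deduced from
  it.\<close>

lemma contr_ext_map_transpose:
  "contr (ext_vec v) (ext_map (transpose g) y) =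
    ext_map (transpose g) (contr (ext_vec (g *v v)) (y :: ('m::{finite,linorder}) ext))"
proof (rule linear_eq_wedges[where x = y])
  fix vs :: "'m evec list"
  show "contr (ext_vec v) (ext_map (transpose g) (wedges vs)) =
      ext_map (transpose g) (contr (ext_vec (g *v v)) (wedges vs))"
    by (induction vs)
      (simp_all add: contr_ext_vec_wedge ext_map_wedge_ext_vec ext_map_linear_simps inner_vector_matrix)
qed (auto simp: linear_iff contr.add_right contr.scaleR_right ext_map_linear_simps)

text \<open>Each leading factor is moved to the other side as a contraction and passed through the
  transposed map, until only the unit is left. The inner product with the unit reads off the part of
  degree zero, which induced maps preserve.\<close>

lemma ext_map_inner: "ext_map g x \<bullet> y = x \<bullet> ext_map (transpose g) (y :: ('m::{finite,linorder}) ext)"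
proof -
  have one: "axis {} 1 \<bullet> y = axis {} 1 \<bullet> ext_map (transpose g) (y :: 'm ext)" for y
  proof (rule linear_eq_wedges[where x = y])
    show "axis {} 1 \<bullet> wedges vs = axis {} 1 \<bullet> ext_map (transpose g) (wedges vs)" for vs :: "'m evec list"
      by (cases vs) (simp_all add: ext_map_wedge_ext_vec flip: inner_contr)
  qed (auto simp: linear_iff inner_add_right ext_map_linear_simps)
  have "ext_map g (wedges vs) \<bullet> y = wedges vs \<bullet> ext_map (transpose g) y" for vs :: "'m evec list" and y
  proof (induction vs arbitrary: y)
    case (Cons v vs)
    have "ext_map g (wedges (v # vs)) \<bullet> y = ext_map g (wedges vs) \<bullet> contr (ext_vec (g *v v)) y"
      using inner_contr[of "ext_vec (g *v v)" y "ext_map g (wedges vs)"]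
      by (simp add: ext_map_wedge_ext_vec inner_commute)
    also have "\<dots> = wedges vs \<bullet> contr (ext_vec v) (ext_map (transpose g) y)"
      by (simp add: Cons contr_ext_map_transpose)
    also have "\<dots> = wedges (v # vs) \<bullet> ext_map (transpose g) y"
      using inner_contr[of "ext_vec v" "ext_map (transpose g) y" "wedges vs"]
      by (simp add: inner_commute)
    finally show ?case .
  qed (use one in simp)
  then show ?thesis
    by (rule linear_eq_wedges[where x = x, rotated 2]) (auto simp: linear_iff inner_add_left ext_map_linear_simps)
qed

lemma ext_map_transpose_inner: "ext_map (transpose g) x \<bullet> y = x \<bullet> ext_map g (y :: ('m::{finite,linorder}) ext)"
  using ext_map_inner[of "transpose g" x y] by simp

lemma contr_ext_map:
  "contr a (ext_map (transpose g) u) = ext_map (transpose g) (contr (ext_map g a) (u :: ('m::{finite,linorder}) ext))"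
  by (rule inner_eqI) (simp add: inner_contr ext_map_transpose_inner ext_map_wedge)

lemma norm_ext_map:
  assumes "orthogonal_matrix g"
  shows "norm (ext_map g x) = norm (x :: ('m::{finite,linorder}) ext)"
  using assms by (simp add: norm_eq_sqrt_inner ext_map_inner orthogonal_matrix_def flip: ext_map_mult)

subsection \<open>Degrees\<close>

definition homogeneous :: "nat \<Rightarrow> ('m::finite) ext \<Rightarrow> bool" where
  "homogeneous d x \<longleftrightarrow> (\<forall>S. card S \<noteq> d \<longrightarrow> x $ S = 0)"

definition grade_involution :: "('m::finite) ext \<Rightarrow> 'm ext" where
  "grade_involution x = (\<chi> S. (- 1) ^ card S * x $ S)"

lemma grade_involution_homogeneous: "homogeneous d x \<Longrightarrow> grade_involution x = (- 1) ^ d *\<^sub>R x"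
  by (auto simp: homogeneous_def grade_involution_def vec_eq_iff)

lemma inner_grade_involution: "grade_involution x \<bullet> y = x \<bullet> grade_involution y"
  by (simp add: inner_vec_def grade_involution_def algebra_simps)

lemma linear_grade_involution: "linear grade_involution"
  by (simp add: linear_iff grade_involution_def vec_eq_iff algebra_simps)

text \<open>Carrying a vector past a product of \<open>d\<close> vectors costs \<open>d\<close>
  signs; the grade involution records this for inhomogeneous elements as well. Contractions from the
  left and from the right thus differ only by signs.\<close>

lemma wedge_ext_vec_right:
  "wedge x (ext_vec v) = wedge (ext_vec v) (grade_involution (x :: ('m::{finite,linorder}) ext))"
proof -
  have gr: "grade_involution (axis S 1) = (- 1) ^ card S *\<^sub>R (axis S 1 :: 'm ext)" for S
    by (auto simp: grade_involution_def axis_def vec_eq_iff)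
  have 1: "wedge (axis S 1) (ext_vec (axis i 1)) = wedge (ext_vec (axis i 1)) (grade_involution (axis S 1 :: 'm ext))" for S i
    by (auto simp: gr wedge.scaleR_right wedge_axis shuffle_sign_commute)
  have 2: "wedge x (ext_vec (axis i 1)) = wedge (ext_vec (axis i 1)) (grade_involution x)" for i
    by (rule linear_eq_axis[where x = x]; (rule 1)?)
      (auto simp: linear_iff wedge.add_left wedge.scaleR_left wedge.add_right wedge.scaleR_right
        linear_add[OF linear_grade_involution] linear_cmul[OF linear_grade_involution])
  show ?thesis
    by (rule linear_eq_vec_axis[where x = v]; (rule 2)?)
      (auto simp: linear_iff wedge.add_left wedge.scaleR_left wedge.add_right wedge.scaleR_right
        ext_vec_linear_simps)
qed

lemma contr_right_ext_vec:
  "contr_right (ext_vec v) u = grade_involution (contr (ext_vec v) (u :: ('m::{finite,linorder}) ext))"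
  by (rule inner_eqI) (simp add: inner_contr_right inner_grade_involution inner_contr wedge_ext_vec_right)

lemma homogeneous_scaleR: "homogeneous d x \<Longrightarrow> homogeneous d (c *\<^sub>R x)"
  by (simp add: homogeneous_def)

lemma homogeneous_wedges: "homogeneous (length vs) (wedges (vs :: ('m::{finite,linorder}) evec list))"
proof (induction vs)
  case Nil
  then show ?case by (auto simp: homogeneous_def axis_def)
next
  case (Cons v vs)
  have "wedge (ext_vec v) (wedges vs) $ U = 0" if "card U \<noteq> Suc (length vs)" for U
    unfolding wedge_def vec_lambda_beta
  proof (rule sum.neutral, intro ballI)
    fix S assume S: "S \<in> Pow U"
    show "shuffle_sign S (U - S) * ext_vec v $ S * wedges vs $ (U - S) = 0"
    proof (cases "\<exists>i. S = {i}")
      case True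
      then obtain i where "S = {i}" by blast
      then have "card (U - S) \<noteq> length vs"
        using S that card_Suc_Diff1[of U i] by auto
      then show ?thesis
        using Cons by (simp add: homogeneous_def)
    next
      case False
      then have "ext_vec v $ S = 0"
        by (simp add: ext_vec_def axis_def)
      then show ?thesis by simp
    qed
  qed
  then show ?case
    by (simp add: homogeneous_def)
qed


subsection \<open>Simple vectors\<close>

lemma simple_vectorsI: "length vs = d \<Longrightarrow> set vs \<subseteq> V \<Longrightarrow> c *\<^sub>R wedges vs \<in> simple_vectors V d"
  by (auto simp: simple_vectors_def)

lemma simple_vectors_scaleR: "x \<in> simple_vectors V d \<Longrightarrow> c *\<^sub>R x \<in> simple_vectors V d"
  by (force simp: simple_vectors_def)

lemma simple_vectors_minus: "x \<in> simple_vectors V d \<Longrightarrow> - x \<in> simple_vectors V d"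
  using simple_vectors_scaleR[of x V d "- 1"] by simp

lemma simple_vectors_zero: "V \<noteq> {} \<Longrightarrow> 0 \<in> simple_vectors V d"
proof -
  assume "V \<noteq> {}"
  then obtain v where "v \<in> V" by blast
  then have "0 *\<^sub>R wedges (replicate d v) \<in> simple_vectors V d"
    by (intro simple_vectorsI) auto
  then show ?thesis by simp
qed

lemma simple_vectors_Cons:
  "v \<in> V \<Longrightarrow> x \<in> simple_vectors V d \<Longrightarrow> wedge (ext_vec v) x \<in> simple_vectors V (Suc d)"
proof -
  assume "v \<in> V" "x \<in> simple_vectors V d"
  then obtain c vs where "x = c *\<^sub>R wedges vs" "length vs = d" "set vs \<subseteq> V" "v \<in> V"
    by (auto simp: simple_vectors_def)
  then show ?thesis
    using simple_vectorsI[of "v # vs" "Suc d" V c] by (simp add: wedge.scaleR_right)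
qed

lemma simple_vectors_SucE:
  assumes "x \<in> simple_vectors V (Suc d)"
  obtains v y where "v \<in> V" "y \<in> simple_vectors V d" "x = wedge (ext_vec v) y"
proof -
  obtain c vs where vs: "x = c *\<^sub>R wedges vs" "length vs = Suc d" "set vs \<subseteq> V"
    using assms by (auto simp: simple_vectors_def)
  then obtain v ws where "vs = v # ws"
    by (cases vs) auto
  with vs show ?thesis
    by (intro that[of v "c *\<^sub>R wedges ws"] simple_vectorsI) (auto simp: wedge.scaleR_right)
qed

lemma simple_vectors_0: "simple_vectors V 0 = range (\<lambda>c. c *\<^sub>R axis {} 1)"
  by (auto simp: simple_vectors_def)

lemma simple_vectors_1:
  assumes "subspace V"
  shows "simple_vectors V 1 = ext_vec ` (V :: ('m::{finite,linorder}) evec set)"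
proof (intro subset_antisym subsetI)
  fix x assume "x \<in> simple_vectors V 1"
  then obtain v c where "v \<in> V" "x = wedge (ext_vec v) (c *\<^sub>R axis {} 1)"
    by (auto simp: simple_vectors_0 elim!: simple_vectors_SucE[of x V 0, simplified])
  then have "x = ext_vec (c *\<^sub>R v)"
    by (simp add: wedge.scaleR_right ext_vec_linear_simps)
  then show "x \<in> ext_vec ` V"
    using \<open>v \<in> V\<close> assms by (auto simp: subspace_def)
next
  fix x :: "'m ext" assume "x \<in> ext_vec ` V"
  then show "x \<in> simple_vectors V 1"
    using simple_vectorsI[of "[_]" 1 V 1] by auto
qed

lemma simple_vectors_homogeneous: "x \<in> simple_vectors V d \<Longrightarrow> homogeneous d x"
  by (auto simp: simple_vectors_def intro!: homogeneous_scaleR homogeneous_wedges)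

lemma subspace_ext_power: "subspace (ext_power V d)"
  by (simp add: ext_power_def)

lemma simple_vectors_subset: "simple_vectors V d \<subseteq> ext_power V d"
  unfolding simple_vectors_def ext_power_def by (blast intro: span_scale span_base)

lemma ext_power_eq_span: "ext_power V d = span (simple_vectors V d)"
proof
  show "ext_power V d \<subseteq> span (simple_vectors V d)"
    unfolding ext_power_def
  proof (rule span_mono, rule subsetI)
    fix x assume "x \<in> {wedges vs |vs. length vs = d \<and> set vs \<subseteq> V}"
    then obtain vs where "x = wedges vs" "length vs = d" "set vs \<subseteq> V"
      by blast
    then show "x \<in> simple_vectors V d"
      using simple_vectorsI[of vs d V 1] by simp
  qed
  show "span (simple_vectors V d) \<subseteq> ext_power V d"
    by (intro span_minimal simple_vectors_subset subspace_ext_power)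
qed

lemma ext_power_induct [consumes 1, case_names zero add]:
  assumes "x \<in> ext_power V d" "P 0"
    "\<And>y z. y \<in> simple_vectors V d \<Longrightarrow> z \<in> ext_power V d \<Longrightarrow> P z \<Longrightarrow> P (y + z)"
  shows "P x"
proof -
  have "x \<in> ext_power V d \<and> P x"
    using assms(1) unfolding ext_power_eq_span
  proof (induction rule: span_induct_alt)
    case base
    then show ?case using assms(2) by (simp add: span_zero)
  next
    case (step c y z)
    then have "c *\<^sub>R y \<in> simple_vectors V d" by (simp add: simple_vectors_scaleR)
    then show ?case
      using assms(3)[of "c *\<^sub>R y" z] step
      by (auto simp: ext_power_eq_span intro: span_add span_base)
  qed
  then show ?thesis ..
qed

lemma simple_vectors_wedge:
  assumes "x \<in> simple_vectors V d" "y \<in> simple_vectors V e"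
  shows "wedge x y \<in> simple_vectors (V :: ('m::{finite,linorder}) evec set) (d + e)"
proof -
  obtain c vs b ws where "x = c *\<^sub>R wedges vs" "length vs = d" "set vs \<subseteq> V"
    "y = b *\<^sub>R wedges ws" "length ws = e" "set ws \<subseteq> V"
    using assms by (auto simp: simple_vectors_def)
  then show ?thesis
    using simple_vectorsI[of "vs @ ws" "d + e" V "c * b"]
    by (simp add: wedges_append wedge.scaleR_left wedge.scaleR_right mult.commute)
qed

lemma ext_map_simple_vectors:
  assumes "x \<in> simple_vectors V d" "\<And>v. v \<in> V \<Longrightarrow> g *v v \<in> V'"
  shows "ext_map g x \<in> simple_vectors (V' :: ('m::{finite,linorder}) evec set) d"
proof -
  obtain c vs where "x = c *\<^sub>R wedges vs" "length vs = d" "set vs \<subseteq> V"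
    using assms by (auto simp: simple_vectors_def)
  then show ?thesis
    using assms(2) by (auto simp: ext_map_linear_simps ext_map_wedges subset_iff intro!: simple_vectorsI)
qed

text \<open>The leading factor \<open>w\<close> annihilates the multiples of itself that are
  subtracted further down. The coefficients \<open>k\<close> are free, so that the other factors can
  be made orthogonal to a prescribed vector.\<close>

lemma wedges_shear:
  "wedge (ext_vec w) (wedges (map (\<lambda>x. x - k x *\<^sub>R w) vs)) =
    wedge (ext_vec w) (wedges (vs :: ('m::{finite,linorder}) evec list))"
proof (induction vs)
  case (Cons v vs)
  have "wedge (ext_vec w) (wedge (ext_vec (v - k v *\<^sub>R w)) (wedges (map (\<lambda>x. x - k x *\<^sub>R w) vs))) =
    wedge (ext_vec w) (wedge (ext_vec v) (wedges (map (\<lambda>x. x - k x *\<^sub>R w) vs)))"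
    by (simp add: ext_vec_linear_simps wedge.diff_left wedge.diff_right wedge.scaleR_left wedge.scaleR_right)
  also have "\<dots> = wedge (ext_vec w) (wedge (ext_vec v) (wedges vs))"
    using Cons by (simp add: wedge_ext_vec_swap[of w v])
  finally show ?case by simp
qed simp

text \<open>If \<open>v\<close> is not orthogonal to the first factor \<open>w\<close>, then subtracting multiples of \<open>w\<close> makes
  the other factors orthogonal to \<open>v\<close>, and the contraction just removes \<open>w\<close>.\<close>

lemma contr_wedges_simple:
  assumes "subspace V" "length vs = Suc d" "set vs \<subseteq> (V :: ('m::{finite,linorder}) evec set)"
  shows "contr (ext_vec v) (wedges vs) \<in> simple_vectors V d"
  using assms(2,3)
proof (induction vs arbitrary: d)
  case (Cons w vs)
  show ?case
  proof (cases "v \<bullet> w = 0")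
    case True
    show ?thesis
    proof (cases d)
      case 0
      then show ?thesis
        using True Cons contr_ext_vec_wedge[of v w "axis {} 1"] simple_vectors_zero[of V 0] by auto
    next
      case (Suc d')
      then have "contr (ext_vec v) (wedges vs) \<in> simple_vectors V d'"
        using Cons by auto
      then show ?thesis
        using True Cons.prems Suc simple_vectors_Cons[of w V _ d']
        by (simp add: contr_ext_vec_wedge simple_vectors_minus)
    qed
  next
    case False
    define ws where "ws = map (\<lambda>x. x - ((v \<bullet> x) / (v \<bullet> w)) *\<^sub>R w) vs"
    have "contr (ext_vec v) (wedges ws) = 0"
      by (rule contr_orthogonal_wedges) (use False in \<open>auto simp: ws_def inner_diff_right\<close>)
    moreover have "wedges (w # vs) = wedges (w # ws)"
      by (simp add: ws_def wedges_shear)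
    ultimately have "contr (ext_vec v) (wedges (w # vs)) = (v \<bullet> w) *\<^sub>R wedges ws"
      by (simp add: contr_ext_vec_wedge)
    moreover have "set ws \<subseteq> V" "length ws = d"
      using Cons.prems assms(1) by (auto simp: ws_def subspace_diff subspace_scale subset_iff)
    ultimately show ?thesis
      by (simp add: simple_vectorsI)
  qed
qed simp

lemma contr_ext_vec_simple:
  assumes "subspace V" "u \<in> simple_vectors (V :: ('m::{finite,linorder}) evec set) (Suc d)"
  shows "contr (ext_vec v) u \<in> simple_vectors V d"
  using assms contr_wedges_simple[OF assms(1)]
  by (auto simp: simple_vectors_def[of V "Suc d"] contr.scaleR_right intro!: simple_vectors_scaleR)

text \<open>The left contraction is simple, hence homogeneous, and the grade involution merely
  multiplies it by a sign.\<close>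

lemma contr_right_ext_vec_simple:
  assumes "subspace V" "u \<in> simple_vectors (V :: ('m::{finite,linorder}) evec set) (Suc d)"
  shows "contr_right (ext_vec v) u \<in> simple_vectors V d"
  using contr_ext_vec_simple[OF assms, of v]
  by (simp add: contr_right_ext_vec grade_involution_homogeneous[OF simple_vectors_homogeneous]
      simple_vectors_scaleR)

text \<open>Contraction by a product is the iterated contraction by its factors. This is why
  products of zonoids, evaluated at simple vectors, see the factors only at simple vectors.\<close>

lemma contr_simple:
  assumes "subspace V" "y \<in> simple_vectors V d" "u \<in> simple_vectors (V :: ('m::{finite,linorder}) evec set) (d + e)"
  shows "contr y u \<in> simple_vectors V e"
proof -
  have "contr (wedges vs) u \<in> simple_vectors V e"
    if "length vs = d" "u \<in> simple_vectors V (d + e)" for vs u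
    using that
  proof (induction vs arbitrary: u d)
    case Nil
    moreover have "contr (axis {} 1) u = u"
      by (rule inner_eqI) (simp add: inner_contr)
    ultimately show ?case by simp
  next
    case (Cons v vs)
    then show ?case
      using contr_ext_vec_simple[OF assms(1), of u "length vs + e" v] by (auto simp: contr_wedge)
  qed
  then show ?thesis
    using assms(2,3) by (auto simp: simple_vectors_def[of V d] contr.scaleR_left intro!: simple_vectors_scaleR)
qed

lemma contr_right_simple:
  assumes "subspace V" "y \<in> simple_vectors V e" "u \<in> simple_vectors (V :: ('m::{finite,linorder}) evec set) (d + e)"
  shows "contr_right y u \<in> simple_vectors V d"
proof -
  have "contr_right (wedges vs) u \<in> simple_vectors V d"
    if "length vs = e" "u \<in> simple_vectors V (d + e)" for vs u
    using that
  proof (induction vs arbitrary: d e)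
    case Nil
    moreover have "contr_right (axis {} 1) u = u"
      by (rule inner_eqI) (simp add: inner_contr_right)
    ultimately show ?case by simp
  next
    case (Cons v vs)
    then have "contr_right (wedges vs) u \<in> simple_vectors V (Suc d)"
      by auto
    then show ?case
      using contr_right_ext_vec_simple[OF assms(1)] by (simp add: contr_right_wedge)
  qed
  then show ?thesis
    using assms(2,3) by (auto simp: simple_vectors_def[of V e] contr_right.scaleR_left intro!: simple_vectors_scaleR)
qed

section \<open>Measurability of the set of simple vectors\<close>

text \<open>This property passes to continuous images of products and implies Borel measurability.
  It spares a proof that the simple vectors form a closed cone.\<close>

definition sigma_compact :: "'a::topological_space set \<Rightarrow> bool" where
  "sigma_compact S \<longleftrightarrow> (\<exists>C :: nat \<Rightarrow> 'a set. (\<forall>i. compact (C i)) \<and> S = (\<Union>i. C i))"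

lemma sigma_compact_borel: "sigma_compact (S :: 'a::t2_space set) \<Longrightarrow> S \<in> sets borel"
  by (auto simp: sigma_compact_def borel_compact)

lemma sigma_compact_closed: "closed (S :: 'a::heine_borel set) \<Longrightarrow> sigma_compact S"
proof -
  assume "closed S"
  have "S = (\<Union>i::nat. S \<inter> cball undefined (real i))"
    using real_arch_simple by fastforce
  moreover have "\<forall>i. compact (S \<inter> cball undefined (real i))"
    using \<open>closed S\<close> by (simp add: closed_Int_compact)
  ultimately show ?thesis
    unfolding sigma_compact_def by (intro exI[of _ "\<lambda>i. S \<inter> cball undefined (real i)"] conjI)
qed

lemma sigma_compact_image_Times:
  assumes "sigma_compact S" "sigma_compact T" "continuous_on (S \<times> T) f"
  shows "sigma_compact (f ` (S \<times> T))"
proof -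
  obtain C D where CD: "\<And>i::nat. compact (C i)" "S = (\<Union>i. C i)" "\<And>i::nat. compact (D i)" "T = (\<Union>i. D i)"
    using assms by (auto simp: sigma_compact_def)
  \<comment> \<open>\<open>prod_decode\<close> merges the two sequences of compact pieces into one
    sequence of products.\<close>
  define F where "F k = f ` (C (fst (prod_decode k)) \<times> D (snd (prod_decode k)))" for k
  have "compact (F k)" for k
    unfolding F_def using CD assms(3)
    by (intro compact_continuous_image compact_Times continuous_on_subset[OF assms(3)]) auto
  moreover have "f ` (S \<times> T) = (\<Union>k. F k)"
  proof (intro subset_antisym subsetI)
    fix z assume "z \<in> f ` (S \<times> T)"
    then obtain i j x y where "x \<in> C i" "y \<in> D j" "z = f (x, y)"
      using CD by auto
    then have "z \<in> F (prod_encode (i, j))"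
      by (auto simp: F_def)
    then show "z \<in> (\<Union>k. F k)" by blast
  qed (auto simp: F_def CD)
  ultimately show ?thesis
    unfolding sigma_compact_def by blast
qed

lemma sigma_compact_simple_vectors:
  assumes "closed (V :: ('m::{finite,linorder}) evec set)"
  shows "sigma_compact (simple_vectors V d)"
proof (induction d)
  case 0
  have "simple_vectors V 0 = span {axis {} 1}"
    by (simp add: simple_vectors_0 span_singleton)
  then show ?case
    by (simp add: sigma_compact_closed)
next
  case (Suc d)
  have "simple_vectors V (Suc d) = (\<lambda>(v, x). wedge (ext_vec v) x) ` (V \<times> simple_vectors V d)"
    by (auto intro: simple_vectors_Cons elim!: simple_vectors_SucE)
  moreover have "continuous_on (V \<times> simple_vectors V d) (\<lambda>(v, x). wedge (ext_vec v) x)"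
    unfolding split_beta
    by (intro wedge.continuous_on continuous_intros
        linear_continuous_on_compose[OF _ linear_ext_vec])
  ultimately show ?case
    using sigma_compact_image_Times[OF sigma_compact_closed[OF assms] Suc] by simp
qed

lemma simple_vectors_borel:
  "closed V \<Longrightarrow> simple_vectors (V :: ('m::{finite,linorder}) evec set) d \<in> sets borel"
  by (intro sigma_compact_borel sigma_compact_simple_vectors)

subsection \<open>Orthogonal maps and the top degree\<close>

lemma homogeneous_high: "homogeneous d (x :: ('m::finite) ext) \<Longrightarrow> d > CARD('m) \<Longrightarrow> x = 0"
proof -
  assume "homogeneous d x" "d > CARD('m)"
  moreover have "card S \<noteq> d" for S :: "'m set"
    using \<open>d > CARD('m)\<close> card_mono[of UNIV S] by auto
  ultimately show "x = 0"
    by (simp add: homogeneous_def vec_eq_iff)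
qed

lemma homogeneous_top:
  "homogeneous CARD('m) (x :: ('m::finite) ext) \<Longrightarrow> x = x $ UNIV *\<^sub>R axis UNIV 1"
  using card_eq_UNIV_imp_eq_UNIV[of S for S :: "'m set"] by (auto simp: homogeneous_def vec_eq_iff axis_def)

text \<open>Every orthogonal matrix is a product of reflections, for which this can be checked directly.\<close>

definition det_on_top :: "('m::{finite,linorder}) emat \<Rightarrow> bool" where
  "det_on_top g \<longleftrightarrow> ext_map g (axis UNIV 1) = det g *\<^sub>R axis UNIV 1"

text \<open>The top degree is a line, so that some scalar exists. It is identified with the
  determinant only later, for orthogonal matrices.\<close>

lemma ext_map_top: "\<exists>c. ext_map (g :: ('m::{finite,linorder}) emat) (axis UNIV 1) = c *\<^sub>R axis UNIV 1"
proof -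
  have "homogeneous CARD('m) (ext_map g (axis UNIV 1))"
    unfolding ext_map_axis using homogeneous_wedges by (metis length_map length_sorted_list_of_set)
  then show ?thesis
    using homogeneous_top by blast
qed

lemma det_on_top_mult:
  "det_on_top g \<Longrightarrow> det_on_top h \<Longrightarrow> det_on_top (g ** (h :: ('m::{finite,linorder}) emat))"
  by (simp add: det_on_top_def ext_map_mult ext_map_linear_simps det_mul)

lemma det_on_top_id: "det_on_top (mat 1 :: ('m::{finite,linorder}) emat)"
  by (simp add: det_on_top_def)

lemma wedges_scaled:
  fixes v :: "'m::{finite,linorder} \<Rightarrow> 'm evec"
  shows "distinct xs \<Longrightarrow> wedges (map (\<lambda>i. d i *\<^sub>R v i) xs) = (\<Prod>i\<in>set xs. d i) *\<^sub>R wedges (map v xs)"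
  by (induction xs) (simp_all add: ext_vec_linear_simps wedge.scaleR_left wedge.scaleR_right)

lemma det_on_top_diagonal:
  assumes "\<And>i j. i \<noteq> j \<Longrightarrow> D $ i $ j = 0"
  shows "det_on_top (D :: ('m::{finite,linorder}) emat)"
proof -
  have "D *v axis i 1 = D $ i $ i *\<^sub>R axis i 1" for i
  proof -
    have "(D *v axis i 1) $ j = (D $ i $ i *\<^sub>R axis i 1) $ j" for j
      using assms[of j i] unfolding matrix_vector_mult_basis by (auto simp: column_def axis_def)
    then show ?thesis by (simp add: vec_eq_iff)
  qed
  then have "ext_map D (axis UNIV 1) = (\<Prod>i\<in>UNIV. D $ i $ i) *\<^sub>R axis UNIV 1"
    using axis_eq_wedges[of "UNIV :: 'm set"] unfolding ext_map_axis by (simp add: wedges_scaled)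
  then show ?thesis
    by (simp add: det_on_top_def det_diagonal[OF assms])
qed

lemma orthogonal_matrix_mult_vec:
  assumes "orthogonal_matrix (A :: ('m::finite) emat)"
  shows "A *v (transpose A *v x) = x" "transpose A *v (A *v x) = x"
  using assms by (simp_all only: matrix_vector_mul_assoc orthogonal_matrix_def matrix_vector_mul_lid)

lemma orthogonal_matrix_inner:
  assumes "orthogonal_matrix (A :: ('m::finite) emat)"
  shows "(A *v x) \<bullet> (A *v y) = x \<bullet> y"
  using inner_transpose[of x A "A *v y"] orthogonal_matrix_mult_vec(2)[OF assms, of y] by simp

text \<open>Conjugate the diagonal matrix with a single entry \<open>- 1\<close> by an orthogonal
  matrix that carries the corresponding basis vector to \<open>f\<close>.\<close>

lemma reflection_exists:
  fixes f :: "('m::{finite,linorder}) evec"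
  assumes "norm f = 1"
  obtains r where "orthogonal_matrix r" "det r = - 1" "det_on_top r" "r *v f = - f"
    "\<And>x. x \<bullet> f = 0 \<Longrightarrow> r *v x = x"
proof -
  define k :: 'm where "k = undefined"
  obtain A where A: "orthogonal_matrix A" "A *v axis k 1 = f"
    using orthogonal_matrix_exists_basis[OF assms] by blast
  define D :: "'m emat" where "D = (\<chi> i j. if i = j then if i = k then - 1 else 1 else 0)"
  have Dv: "(D *v y) $ i = (if i = k then - y $ i else y $ i)" for y i
  proof -
    have "(D *v y) $ i = (\<Sum>j\<in>UNIV. if j = i then (if i = k then - 1 else 1) * y $ j else 0)"
      unfolding matrix_vector_mult_def D_def vec_lambda_beta by (rule sum.cong) auto
    then show ?thesis by simp
  qed
  have "D *v (D *v y) = y" for y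
    by (simp add: vec_eq_iff Dv)
  then have "D ** D = mat 1"
    by (simp add: matrix_eq matrix_vector_mul_assoc)
  moreover have "transpose D = D"
    by (auto simp: D_def transpose_def vec_eq_iff)
  ultimately have oD: "orthogonal_matrix D"
    by (simp add: orthogonal_matrix_def)
  have dD: "det D = - 1"
    by (subst det_diagonal) (auto simp: D_def prod.delta)
  define r where "r = A ** D ** transpose A"
  have r: "r *v x = A *v (D *v (transpose A *v x))" for x
    by (simp only: r_def matrix_vector_mul_assoc matrix_mul_assoc)
  have Af: "transpose A *v f = axis k 1"
    using orthogonal_matrix_mult_vec(2)[OF A(1)] A(2) by metis
  show thesis
  proof
    show "orthogonal_matrix r"
      unfolding r_def by (intro orthogonal_matrix_mul A oD) (simp add: A)
    show "det r = - 1"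
      using det_orthogonal_matrix[OF A(1)] by (auto simp: r_def det_mul dD)
    show "r *v f = - f"
    proof -
      have "D *v axis k 1 = - axis k 1"
        by (simp add: vec_eq_iff Dv axis_def)
      then have "r *v f = A *v (- axis k 1)"
        unfolding r Af by simp
      also have "\<dots> = - f"
        by (simp only: linear_neg[OF matrix_vector_mul_linear] A)
      finally show ?thesis .
    qed
    show "r *v x = x" if "x \<bullet> f = 0" for x
    proof -
      have "(transpose A *v x) $ k = (transpose A *v x) \<bullet> axis k 1"
        by (simp only: inner_axis) simp
      also have "\<dots> = x \<bullet> f"
        using inner_transpose[of "axis k 1" A x] A(2) by (simp only: inner_commute)
      finally have "D *v (transpose A *v x) = transpose A *v x"
        using that by (simp add: vec_eq_iff Dv)
      then show ?thesis
        unfolding r by (simp only: orthogonal_matrix_mult_vec[OF A(1)])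
    qed
    obtain c where c: "ext_map A (axis UNIV 1) = c *\<^sub>R axis UNIV 1"
      using ext_map_top by blast
    obtain c' where c': "ext_map (transpose A) (axis UNIV 1) = c' *\<^sub>R axis UNIV 1"
      using ext_map_top by blast
    have "ext_map (A ** transpose A) (axis UNIV 1) = (axis UNIV 1 :: 'm ext)"
      using A(1) by (simp add: orthogonal_matrix_def)
    then have "(c * c') *\<^sub>R axis UNIV 1 = (axis UNIV 1 :: 'm ext)"
      by (simp add: ext_map_mult c c' ext_map_linear_simps mult.commute)
    then have "((c * c') *\<^sub>R axis UNIV 1 :: 'm ext) $ UNIV = (axis UNIV 1 :: 'm ext) $ UNIV"
      by (rule arg_cong[of _ _ "\<lambda>z. z $ UNIV"])
    then have cc: "c * c' = 1"
      by (simp add: axis_def)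
    have "det_on_top D"
      by (rule det_on_top_diagonal) (simp add: D_def)
    then have "ext_map r (axis UNIV 1) = (c * c' * - 1) *\<^sub>R axis UNIV 1"
      by (simp add: r_def ext_map_mult c c' ext_map_linear_simps det_on_top_def dD mult_ac)
    then show "det_on_top r"
      using \<open>det r = - 1\<close> cc by (simp add: det_on_top_def)
  qed
qed

definition orthonormal :: "'a::real_inner list \<Rightarrow> bool" where
  "orthonormal vs \<longleftrightarrow> sorted_wrt (\<lambda>x y. x \<bullet> y = 0) vs \<and> (\<forall>v\<in>set vs. norm v = 1)"

lemma orthonormal_Nil [simp]: "orthonormal []"
  and orthonormal_Cons [simp]:
    "orthonormal (v # vs) \<longleftrightarrow> norm v = 1 \<and> (\<forall>w\<in>set vs. v \<bullet> w = 0) \<and> orthonormal vs"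
  by (auto simp: orthonormal_def)

lemma orthonormal_map:
  assumes "orthogonal_matrix (g :: ('m::finite) emat)" "orthonormal vs"
  shows "orthonormal (map ((*v) g) vs)"
  using assms(2)
  by (induction vs) (auto simp: orthogonal_matrix_inner[OF assms(1)] norm_eq_sqrt_inner)

text \<open>The reflection in the hyperplane orthogonal to \<open>a - b\<close> exchanges two
  vectors of equal norm and fixes everything orthogonal to both.\<close>

lemma move_vector:
  fixes a b :: "('m::{finite,linorder}) evec"
  assumes "norm a = norm b"
  obtains r where "orthogonal_matrix r" "det_on_top r" "r *v a = b"
    "\<And>x. x \<bullet> a = 0 \<Longrightarrow> x \<bullet> b = 0 \<Longrightarrow> r *v x = x"
proof (cases "a = b")
  case True
  show ?thesis
    by (rule that[of "mat 1"]) (simp_all add: True det_on_top_id orthogonal_matrix_id)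
next
  case False
  define f where "f = (1 / norm (a - b)) *\<^sub>R (a - b)"
  have "norm f = 1" using False by (simp add: f_def)
  then obtain r where r: "orthogonal_matrix r" "det_on_top r" "r *v f = - f"
    "\<And>x. x \<bullet> f = 0 \<Longrightarrow> r *v x = x"
    using reflection_exists[OF \<open>norm f = 1\<close>] by metis
  define c where "c = norm (a - b)"
  have ab: "a - b = c *\<^sub>R f" using False by (simp add: f_def c_def)
  have "(a + b) \<bullet> (a - b) = 0"
    using assms by (simp add: inner_add_left inner_diff_right inner_commute[of b a] norm_eq_sqrt_inner)
  then have "(a + b) \<bullet> f = 0"
    by (simp add: f_def)
  then have 1: "r *v (a + b) = a + b" by (rule r)
  have 2: "r *v (a - b) = - (a - b)"
    by (simp only: ab matrix_vector_mult_scaleR r) simp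
  have "2 *\<^sub>R (r *v a) = r *v (a + b) + r *v (a - b)"
    by (simp add: matrix_vector_right_distrib matrix_vector_mult_diff_distrib scaleR_2)
  also have "\<dots> = 2 *\<^sub>R b" unfolding 1 2 by (simp add: scaleR_2)
  finally have "r *v a = b" by simp
  then show ?thesis
    using r by (intro that[of r]) (auto simp: f_def inner_diff_right)
qed

text \<open>Once the tails are matched, one more reflection carries the image of the head to its
  target. It leaves the tail in place, since those vectors are orthogonal to both. The property
  \<open>det_on_top\<close> is carried along because the map is a product of reflections.\<close>

lemma orthonormal_transport:
  fixes vs ws :: "('m::{finite,linorder}) evec list"
  assumes "orthonormal vs" "orthonormal ws" "length vs = length ws"
  shows "\<exists>g. orthogonal_matrix g \<and> det_on_top g \<and> map ((*v) g) vs = ws"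
  using assms
proof (induction vs arbitrary: ws)
  case Nil
  then show ?case using det_on_top_id orthogonal_matrix_id by auto
next
  case (Cons v vs ws')
  then obtain w ws where ws': "ws' = w # ws" by (cases ws') auto
  obtain g where g: "orthogonal_matrix g" "det_on_top g" "map ((*v) g) vs = ws"
    using Cons ws' by auto
  have "norm (g *v v) = norm w"
    using Cons.prems ws' by (simp add: norm_eq_sqrt_inner orthogonal_matrix_inner[OF g(1)])
  then obtain r where r: "orthogonal_matrix r" "det_on_top r" "r *v (g *v v) = w"
    "\<And>x. x \<bullet> (g *v v) = 0 \<Longrightarrow> x \<bullet> w = 0 \<Longrightarrow> r *v x = x"
    by (rule move_vector) blast
  have "r *v (g *v x) = g *v x" if "x \<in> set vs" for x
  proof (rule r(4))
    show "(g *v x) \<bullet> (g *v v) = 0"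
      using Cons.prems(1) that by (simp add: orthogonal_matrix_inner[OF g(1)] inner_commute[of x v])
    have "g *v x \<in> set ws" using g(3) that by auto
    then show "(g *v x) \<bullet> w = 0"
      using Cons.prems(2) ws' by (simp add: inner_commute[of _ w])
  qed
  then have "map ((*v) (r ** g)) vs = ws"
    unfolding g(3)[symmetric] by (simp add: matrix_vector_mul_assoc[symmetric])
  moreover have "(r ** g) *v v = w"
    using r(3) by (simp only: matrix_vector_mul_assoc)
  ultimately have "map ((*v) (r ** g)) (v # vs) = ws'"
    by (simp add: ws')
  then show ?case
    using r g det_on_top_mult orthogonal_matrix_mul by blast
qed

text \<open>Transporting the standard basis to its image under \<open>g\<close> yields a product of
  reflections that agrees with \<open>g\<close> on a basis, and so equals \<open>g\<close>.\<close>

lemma det_on_top_orthogonal: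
  assumes "orthogonal_matrix (g :: ('m::{finite,linorder}) emat)"
  shows "det_on_top g"
proof -
  define es :: "'m evec list" where "es = map (\<lambda>i. axis i 1) (sorted_list_of_set UNIV)"
  have "orthonormal (map (\<lambda>i. axis i 1 :: 'm evec) xs)" if "distinct xs" for xs
    using that by (induction xs) (auto simp: inner_axis_axis)
  then have "orthonormal es"
    by (simp add: es_def)
  then obtain h where h: "orthogonal_matrix h" "det_on_top h" "map ((*v) h) es = map ((*v) g) es"
    using orthonormal_transport[of es "map ((*v) g) es"] orthonormal_map[OF assms] by auto
  have "h *v axis i 1 = g *v axis i 1" for i
    using h(3) by (auto simp: es_def)
  then have "h *v x = g *v x" for x
    by (rule linear_eq_vec_axis[OF matrix_vector_mul_linear matrix_vector_mul_linear])
  then have "h = g" by (simp add: matrix_eq)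
  with h show ?thesis by simp
qed

subsection \<open>Transitivity on simple vectors\<close>

text \<open>Gram-Schmidt, beginning with the last factor: the part of \<open>v\<close> in the span
  of the vectors already found drops out of the product, and the length of the orthogonal remainder
  goes into the scalar. The remainder is nonzero because the product is.\<close>

lemma wedges_orthonormal:
  assumes "subspace V" "set vs \<subseteq> V" "wedges vs \<noteq> (0 :: ('m::{finite,linorder}) ext)"
  shows "\<exists>es c. orthonormal es \<and> set es \<subseteq> V \<and> length es = length vs \<and> wedges vs = c *\<^sub>R wedges es"
  using assms(2,3)
proof (induction vs)
  case Nil
  then show ?case by (intro exI[of _ "[]"] exI[of _ 1]) simp
next
  case (Cons v vs)
  then obtain es c where es: "orthonormal es" "set es \<subseteq> V" "length es = length vs" "wedges vs = c *\<^sub>R wedges es"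
    by fastforce
  obtain y z where yz: "y \<in> span (set es)" "\<And>w. w \<in> span (set es) \<Longrightarrow> orthogonal z w" "v = y + z"
    using orthogonal_subspace_decomp_exists[of "set es" v] by metis
  have "y \<in> V" using yz(1) es(2) assms(1) span_minimal by blast
  then have "z \<in> V"
    using yz(3) Cons.prems(1) assms(1) subspace_diff[of V v y] by simp
  have eq: "wedges (v # vs) = c *\<^sub>R wedge (ext_vec z) (wedges es)"
    using wedge_span_wedges[OF yz(1)]
    by (simp add: es(4) yz(3) ext_vec_linear_simps wedge.add_left wedge.scaleR_right)
  then have "z \<noteq> 0"
    using Cons.prems(2) by (auto simp: ext_vec_linear_simps)
  define e where "e = (1 / norm z) *\<^sub>R z"
  have "orthonormal (e # es)"
    using \<open>z \<noteq> 0\<close> es(1) yz(2) by (auto simp: e_def orthogonal_def span_base)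
  moreover have "set (e # es) \<subseteq> V"
    using \<open>z \<in> V\<close> es(2) assms(1) by (simp add: e_def subspace_scale)
  moreover have "z = norm z *\<^sub>R e"
    using \<open>z \<noteq> 0\<close> by (simp add: e_def)
  then have "wedges (v # vs) = (c * norm z) *\<^sub>R wedges (e # es)"
    using eq by (metis ext_vec_linear_simps(2) scaleR_scaleR wedge.scaleR_left wedges_Cons)
  ultimately show ?case
    using es(3) by (metis length_Cons)
qed

lemma simple_vectors_orthonormal:
  assumes "subspace V" "x \<in> simple_vectors V d" "x \<noteq> (0 :: ('m::{finite,linorder}) ext)"
  obtains es c where "orthonormal es" "set es \<subseteq> V" "length es = d" "x = c *\<^sub>R wedges es"
proof -
  obtain b vs where vs: "x = b *\<^sub>R wedges vs" "length vs = d" "set vs \<subseteq> V"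
    using assms(2) by (auto simp: simple_vectors_def)
  with assms(3) have "wedges vs \<noteq> 0" by auto
  then obtain es c where "orthonormal es" "set es \<subseteq> V" "length es = length vs" "wedges vs = c *\<^sub>R wedges es"
    using wedges_orthonormal[OF assms(1) vs(3)] by blast
  with vs show ?thesis
    by (intro that[of es "b * c"]) auto
qed

lemma subspace_cotangent: "subspace (cotangent pt)"
  by (auto simp: cotangent_def subspace_def inner_add_left)

lemma closed_cotangent: "closed (cotangent pt)"
  using closed_subspace subspace_cotangent by blast

lemma stabilizer_orthogonal: "g \<in> stabilizer pt \<Longrightarrow> orthogonal_matrix g"
  by (simp add: stabilizer_def rotation_matrix_def)

lemma stabilizer_cotangent: "g \<in> stabilizer pt \<Longrightarrow> v \<in> cotangent pt \<Longrightarrow> g *v v \<in> cotangent pt"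
  using orthogonal_matrix_inner[of g v pt] by (auto simp: stabilizer_def cotangent_def rotation_matrix_def)

lemma stabilizer_transpose: "g \<in> stabilizer pt \<Longrightarrow> transpose g \<in> stabilizer pt"
  using orthogonal_matrix_mult_vec(2)[of g pt]
  by (auto simp: stabilizer_def rotation_matrix_def det_transpose simp del: transpose_matrix_vector)

lemma stabilizer_id: "mat 1 \<in> stabilizer pt"
  by (simp add: stabilizer_def rotation_matrix_def orthogonal_matrix_id)

lemma stabilizer_transitive:
  fixes pt :: "('m::{finite,linorder}) evec"
  assumes "norm pt = 1" "0 < d" "d + 1 < CARD('m)" "norm x = norm y"
    and "x \<in> simple_vectors (cotangent pt) d" "y \<in> simple_vectors (cotangent pt) d"
  shows "\<exists>g\<in>stabilizer pt. ext_map g x = y"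
proof (cases "x = 0")
  case True
  then have "y = 0" using assms(4) by simp
  then show ?thesis
    using True stabilizer_id by (intro bexI[of _ "mat 1"]) simp_all
next
  case False
  then have "y \<noteq> 0" using assms(4) by auto
  obtain es a where es: "orthonormal es" "set es \<subseteq> cotangent pt" "length es = d" "x = a *\<^sub>R wedges es"
    using simple_vectors_orthonormal[OF subspace_cotangent assms(5) False] by blast
  obtain fs b where fs: "orthonormal fs" "set fs \<subseteq> cotangent pt" "length fs = d" "y = b *\<^sub>R wedges fs"
    using simple_vectors_orthonormal[OF subspace_cotangent assms(6) \<open>y \<noteq> 0\<close>] by blast
  have move: "\<exists>g\<in>stabilizer pt. ext_map g (wedges es) = wedges hs"
    if hs: "orthonormal hs" "set hs \<subseteq> cotangent pt" "length hs = d" for hs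
  proof -
    have "orthonormal (pt # es)" "orthonormal (pt # hs)"
      using es hs assms(1) by (auto simp: cotangent_def inner_commute)
    then obtain g where g: "orthogonal_matrix g" "map ((*v) g) (pt # es) = pt # hs"
      using orthonormal_transport[of "pt # es" "pt # hs"] es hs by auto
    \<comment> \<open>Here \<open>d + 1 < CARD('m)\<close> enters: some unit vector is orthogonal to
      \<open>pt\<close> and to all of \<open>hs\<close>, and the reflection along it corrects a
      determinant of \<open>- 1\<close> without disturbing them.\<close>
    have "dim (set (pt # hs)) < DIM('m evec)"
      using dim_le_card'[of "set (pt # hs)"] card_length[of "pt # hs"] hs(3) assms(3) by simp
    then obtain f0 where f0: "f0 \<noteq> 0" "\<And>y. y \<in> span (set (pt # hs)) \<Longrightarrow> orthogonal f0 y"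
      using orthogonal_to_subspace_exists by blast
    define f where "f = (1 / norm f0) *\<^sub>R f0"
    have f: "norm f = 1" "\<And>y. y \<in> set (pt # hs) \<Longrightarrow> y \<bullet> f = 0"
      using f0 span_base[of _ "set (pt # hs)"] by (auto simp: f_def orthogonal_def inner_commute)
    obtain r where r: "orthogonal_matrix r" "det r = - 1" "\<And>x. x \<bullet> f = 0 \<Longrightarrow> r *v x = x"
      using reflection_exists[OF f(1)] by metis
    define h where "h = (if det g = 1 then g else r ** g)"
    have "map ((*v) r) (pt # hs) = pt # hs"
      using r(3) f(2) by (intro map_idI) blast
    then have "map ((*v) (r ** g)) (pt # es) = pt # hs"
      using g(2) by (metis (mono_tags, lifting) list.map_comp comp_def matrix_vector_mul_assoc map_eq_conv)
    then have h: "map ((*v) h) (pt # es) = pt # hs"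
      using g(2) by (simp only: h_def split: if_split) simp
    have "h \<in> stabilizer pt"
      using h g(1) r det_orthogonal_matrix[OF g(1)]
      by (auto simp: h_def stabilizer_def rotation_matrix_def det_mul orthogonal_matrix_mul split: if_splits)
    then show ?thesis
      using h by (intro bexI[of _ h]) (simp_all add: ext_map_wedges)
  qed
  obtain g where g: "g \<in> stabilizer pt" "ext_map g (wedges es) = wedges fs"
    using move fs by blast
  have nn: "norm (wedges es) = norm (wedges fs)"
    using norm_ext_map[OF stabilizer_orthogonal[OF g(1)], of "wedges es"] g(2) by simp
  have "wedges es \<noteq> 0" "wedges fs \<noteq> 0" using False \<open>y \<noteq> 0\<close> es fs by auto
  then have "\<bar>a\<bar> = \<bar>b\<bar>"
    using assms(4) es(4) fs(4) nn by simp
  then consider "a = b" | "a = - b" by linarith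
  then show ?thesis
  proof cases
    case 1
    then show ?thesis
      using g es fs by (auto simp: ext_map_linear_simps)
  next
    case 2
    \<comment> \<open>Since \<open>d > 0\<close> there is a first vector; negating it keeps the list
      orthonormal and changes the sign of the product.\<close>
    obtain e hs where hs: "fs = e # hs" using fs(3) assms(2) by (cases fs) auto
    have "\<exists>g\<in>stabilizer pt. ext_map g (wedges es) = wedges (- e # hs)"
      by (rule move) (use fs hs in \<open>auto simp: cotangent_def\<close>)
    then obtain g where "g \<in> stabilizer pt" "ext_map g (wedges es) = - wedges fs"
      by (auto simp: hs ext_vec_linear_simps wedge.minus_left)
    then show ?thesis
      using 2 es fs by (intro bexI[of _ g]) (auto simp: ext_map_linear_simps)
  qed
qed

lemma contr_pt_ext_power:
  assumes "x \<in> ext_power (cotangent pt) d"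
  shows "contr (ext_vec pt) x = (0 :: ('m::{finite,linorder}) ext)"
  using assms
proof (induction rule: ext_power_induct)
  case (add y z)
  obtain c vs where "y = c *\<^sub>R wedges vs" "set vs \<subseteq> cotangent pt"
    using add(1) by (auto simp: simple_vectors_def)
  then have "contr (ext_vec pt) y = 0"
    by (auto simp: contr.scaleR_right cotangent_def inner_commute intro!: contr_orthogonal_wedges)
  then show ?case using add by (simp add: contr.add_right)
qed simp

lemma wedge_pt_ext_power:
  assumes "x \<in> ext_power (cotangent pt) d"
  shows "homogeneous (Suc d) (wedge (ext_vec pt) (x :: ('m::{finite,linorder}) ext))"
  using assms
proof (induction rule: ext_power_induct)
  case zero then show ?case by (simp add: homogeneous_def)
next
  case (add y z)
  obtain c vs where "y = c *\<^sub>R wedges vs" "length vs = d"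
    using add(1) by (auto simp: simple_vectors_def)
  then have "homogeneous (Suc d) (wedge (ext_vec pt) y)"
    using homogeneous_scaleR[OF homogeneous_wedges[of "pt # vs"], of c] by (simp add: wedge.scaleR_right)
  then show ?case using add by (simp add: wedge.add_right homogeneous_def)
qed

text \<open>Multiplication by \<open>pt\<close> embeds the exterior powers of its orthogonal
  complement into those of the whole space, one degree higher, with contraction as a left inverse.
  Dimension arguments in the complement thus reduce to counting index sets.\<close>

lemma contr_wedge_pt:
  assumes "norm pt = 1" "x \<in> ext_power (cotangent pt) d"
  shows "contr (ext_vec pt) (wedge (ext_vec pt) x) = (x :: ('m::{finite,linorder}) ext)"
  using assms contr_pt_ext_power[OF assms(2)] by (simp add: contr_ext_vec_wedge norm_eq_1)

lemma ext_power_high: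
  assumes "norm pt = 1" "d \<ge> CARD('m)" "x \<in> ext_power (cotangent pt) d"
  shows "x = (0 :: ('m::{finite,linorder}) ext)"
  using contr_wedge_pt[OF assms(1,3)] homogeneous_high[OF wedge_pt_ext_power[OF assms(3)]] assms(2)
  by simp

lemma ext_power_top:
  assumes "norm pt = 1" "CARD('m) = Suc n" "x \<in> ext_power (cotangent pt) n"
  shows "\<exists>t. x = t *\<^sub>R contr (ext_vec pt) (axis UNIV 1 :: ('m::{finite,linorder}) ext)"
proof -
  have "wedge (ext_vec pt) x = wedge (ext_vec pt) x $ UNIV *\<^sub>R axis UNIV 1"
    using homogeneous_top wedge_pt_ext_power[OF assms(3)] assms(2) by metis
  then have "x = wedge (ext_vec pt) x $ UNIV *\<^sub>R contr (ext_vec pt) (axis UNIV 1)"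
    using contr_wedge_pt[OF assms(1,3)] by (metis contr.scaleR_right)
  then show ?thesis ..
qed

text \<open>The top power of the complement is spanned by the contraction of the full volume element
  with \<open>pt\<close>, and a rotation fixing \<open>pt\<close> preserves both of these.\<close>

lemma ext_map_ext_power_top:
  assumes "norm pt = 1" "CARD('m) = Suc n" "x \<in> ext_power (cotangent pt) n" "g \<in> stabilizer pt"
  shows "ext_map g x = (x :: ('m::{finite,linorder}) ext)"
proof -
  let ?\<omega> = "contr (ext_vec pt) (axis UNIV 1 :: 'm ext)"
  define h where "h = transpose g"
  have h: "h \<in> stabilizer pt" "g = transpose h"
    using assms(4) stabilizer_transpose by (auto simp: h_def)
  have "ext_map g ?\<omega> = contr (ext_vec pt) (ext_map g (axis UNIV 1))"
    using contr_ext_map_transpose[of pt h "axis UNIV 1"] h by (simp add: stabilizer_def)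
  also have "ext_map g (axis UNIV 1) = axis UNIV 1"
    using det_on_top_orthogonal[OF stabilizer_orthogonal[OF assms(4)]] assms(4)
    by (simp add: det_on_top_def stabilizer_def rotation_matrix_def)
  finally show ?thesis
    using ext_power_top[OF assms(1-3)] by (auto simp: ext_map_linear_simps)
qed

lemma ext_power_top_line:
  assumes "norm pt = 1" "CARD('m) = Suc n" "x \<in> ext_power (cotangent pt) n"
    "\<omega> \<in> ext_power (cotangent pt) n" "\<omega> \<noteq> (0 :: ('m::{finite,linorder}) ext)"
  shows "\<exists>t. x = t *\<^sub>R \<omega>"
proof -
  obtain s t where "x = s *\<^sub>R contr (ext_vec pt) (axis UNIV 1)" "\<omega> = t *\<^sub>R contr (ext_vec pt) (axis UNIV 1)"
    using ext_power_top[OF assms(1,2)] assms(3,4) by blast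
  then have "x = (s / t) *\<^sub>R \<omega>" using assms(5) by auto
  then show ?thesis ..
qed

subsection \<open>The standard Gaussian law\<close>

definition normal_product :: "('k::finite \<Rightarrow> real) measure" where
  "normal_product = Pi\<^sub>M UNIV (\<lambda>_. density lborel std_normal_density)"

text \<open>A rotation invariant law whose linear functionals have an explicit distribution; this is
  what makes the mean of \<open>\<bar>u \<bullet> x\<bar>\<close> computable.\<close>

definition gauss_law :: "(real ^ 'k::finite) measure" where
  "gauss_law = distr normal_product borel (\<lambda>\<omega>. \<Sum>i\<in>UNIV. \<omega> i *\<^sub>R axis i 1)"

lemma prob_space_normal_product: "prob_space normal_product"
  unfolding normal_product_def by (intro prob_space_PiM prob_space_normal_density) simp

lemma normal_product_component:
  "distr (normal_product :: ('k::finite \<Rightarrow> real) measure) borel (\<lambda>\<omega>. \<omega> i) = density lborel std_normal_density"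
proof -
  have "distr (normal_product :: ('k \<Rightarrow> real) measure) borel (\<lambda>\<omega>. \<omega> i) =
      distr normal_product (density lborel std_normal_density) (\<lambda>\<omega>. \<omega> i)"
    by (rule distr_cong) auto
  also have "\<dots> = density lborel std_normal_density"
    unfolding normal_product_def by (rule distr_PiM_component) (auto intro: prob_space_normal_density)
  finally show ?thesis .
qed

lemma normal_product_measurable [measurable]:
  "(\<lambda>\<omega>. \<omega> i) \<in> borel_measurable (normal_product :: ('k::finite \<Rightarrow> real) measure)"
proof -
  have "(\<lambda>\<omega>. \<omega> i) \<in> measurable (normal_product :: ('k \<Rightarrow> real) measure) (density lborel std_normal_density)"
    unfolding normal_product_def by (rule measurable_component_singleton) simp
  then show ?thesis by simp
qed

lemma normal_product_distributed:
  "distributed (normal_product :: ('k::finite \<Rightarrow> real) measure) lborel (\<lambda>\<omega>. \<omega> i) std_normal_density"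
proof -
  have "distr (normal_product :: ('k \<Rightarrow> real) measure) lborel (\<lambda>\<omega>. \<omega> i) = distr normal_product borel (\<lambda>\<omega>. \<omega> i)"
    by (rule distr_cong) auto
  then show ?thesis
    by (simp add: distributed_def normal_product_component)
qed

lemma normal_product_indep:
  "prob_space.indep_vars (normal_product :: ('k::finite \<Rightarrow> real) measure) (\<lambda>_. borel) (\<lambda>i \<omega>. \<omega> i) UNIV"
proof -
  interpret prob_space "normal_product :: ('k \<Rightarrow> real) measure"
    by (rule prob_space_normal_product)
  have "distr (normal_product :: ('k \<Rightarrow> real) measure) (Pi\<^sub>M UNIV (\<lambda>_. borel)) (\<lambda>\<omega>. \<lambda>i\<in>UNIV. \<omega> i) =
      distr normal_product normal_product (\<lambda>\<omega>. \<omega>)"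
    by (rule distr_cong) (auto simp: normal_product_def intro!: sets_PiM_cong)
  also have "\<dots> = (Pi\<^sub>M UNIV (\<lambda>i. distr normal_product borel (\<lambda>\<omega>. \<omega> i)))"
    unfolding normal_product_component by (simp add: normal_product_def)
  finally show ?thesis
    by (subst indep_vars_iff_distr_eq_PiM) auto
qed

lemma normal_product_sum_distributed:
  fixes u :: "real ^ 'k::finite"
  assumes "u \<noteq> 0"
  shows "distributed normal_product lborel (\<lambda>\<omega>. (\<Sum>i\<in>UNIV. u $ i * \<omega> i) / norm u) std_normal_density"
proof -
  interpret prob_space "normal_product :: ('k \<Rightarrow> real) measure"
    by (rule prob_space_normal_product)
  \<comment> \<open>Coordinates with coefficient zero are removed, because the sum rule for
    independent normal variables requires positive standard deviations.\<close>
  define I where "I = {i. u $ i \<noteq> 0}"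
  have "I \<noteq> {}" using assms by (auto simp: I_def vec_eq_iff)
  have "indep_vars (\<lambda>_. borel) (\<lambda>i \<omega>. u $ i * \<omega> i) I"
    by (rule indep_vars_compose2[OF indep_vars_subset[OF normal_product_indep subset_UNIV]]) simp
  moreover have "distributed normal_product lborel (\<lambda>\<omega>. u $ i * \<omega> i) (normal_density 0 \<bar>u $ i\<bar>)" if "i \<in> I" for i
    using normal_density_affine[OF normal_product_distributed, of "u $ i" 0 i] that by (simp add: I_def)
  ultimately have "distributed normal_product lborel (\<lambda>\<omega>. \<Sum>i\<in>I. u $ i * \<omega> i)
      (normal_density (\<Sum>i\<in>I. 0) (sqrt (\<Sum>i\<in>I. \<bar>u $ i\<bar>\<^sup>2)))"
    using \<open>I \<noteq> {}\<close> by (intro sum_indep_normal) (auto simp: I_def)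
  moreover have "(\<Sum>i\<in>I. u $ i * \<omega> i) = (\<Sum>i\<in>UNIV. u $ i * \<omega> i)" for \<omega>
    by (rule sum.mono_neutral_left) (auto simp: I_def)
  moreover have "(\<Sum>i\<in>I. \<bar>u $ i\<bar>\<^sup>2) = (\<Sum>i\<in>UNIV. (u $ i)\<^sup>2)"
    by (rule sum.mono_neutral_cong_left) (auto simp: I_def)
  ultimately have "distributed normal_product lborel (\<lambda>\<omega>. \<Sum>i\<in>UNIV. u $ i * \<omega> i) (normal_density 0 (norm u))"
    by (simp add: norm_vec_def L2_set_def)
  then show ?thesis
    using normal_standard_normal_convert[of "norm u" "\<lambda>\<omega>. \<Sum>i\<in>UNIV. u $ i * \<omega> i" 0] assms by simp
qed

lemma inner_gauss: "u \<bullet> (\<Sum>i\<in>UNIV. \<omega> i *\<^sub>R axis i 1) = (\<Sum>i\<in>UNIV. u $ i * (\<omega> i :: real))"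
  by (simp add: inner_sum_right inner_axis mult.commute)

lemma prob_space_gauss_law: "prob_space gauss_law"
  unfolding gauss_law_def by (intro prob_space.prob_space_distr prob_space_normal_product) simp

lemma sets_gauss_law [simp, measurable_cong]: "sets gauss_law = sets borel"
  by (simp add: gauss_law_def)

lemma space_gauss_law [simp]: "space gauss_law = UNIV"
  by (simp add: gauss_law_def)

lemma integrable_gauss_law: "integrable gauss_law (\<lambda>x :: real ^ 'k::finite. x)"
proof -
  have "integrable (normal_product :: ('k \<Rightarrow> real) measure) (\<lambda>\<omega>. \<omega> i)" for i
    using distributed_integrable[OF normal_product_distributed[of i], of "\<lambda>x. x"]
      integrable_std_normal_moment[of 1] by simp
  then show ?thesis
    unfolding gauss_law_def by (subst integrable_distr_eq) auto
qed

text \<open>Divided by \<open>norm u\<close>, the functional is standard normal, and the mean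
  absolute value of a standard normal variable is \<open>sqrt (2 / pi)\<close>.\<close>

lemma gauss_law_average: "(\<integral>x. \<bar>u \<bullet> x\<bar> \<partial>gauss_law) = sqrt (2 / pi) * norm u"
proof (cases "u = 0")
  case False
  have "(\<integral>x. \<bar>u \<bullet> x\<bar> \<partial>gauss_law) = (\<integral>\<omega>. \<bar>\<Sum>i\<in>UNIV. u $ i * \<omega> i\<bar> \<partial>normal_product)"
    unfolding gauss_law_def by (subst integral_distr) (simp_all add: inner_gauss)
  also have "\<dots> = (\<integral>\<omega>. norm u * \<bar>(\<Sum>i\<in>UNIV. u $ i * \<omega> i) / norm u\<bar> \<partial>normal_product)"
    using False by simp
  also have "\<dots> = norm u * (\<integral>\<omega>. \<bar>(\<Sum>i\<in>UNIV. u $ i * \<omega> i) / norm u\<bar> \<partial>normal_product)"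
    by (rule integral_mult_right_zero)
  also have "(\<integral>\<omega>. \<bar>(\<Sum>i\<in>UNIV. u $ i * \<omega> i) / norm u\<bar> \<partial>normal_product) = (\<integral>x. std_normal_density x * \<bar>x\<bar> \<partial>lborel)"
    by (rule distributed_integral[OF normal_product_sum_distributed[OF False], symmetric]) auto
  also have "\<dots> = sqrt (2 / pi)"
    using integral_std_normal_moment_abs_odd[of 0] by simp
  finally show ?thesis by simp
qed simp

lemma gauss_law_odd: "(\<integral>x. u \<bullet> x \<partial>gauss_law) = 0"
proof (cases "u = 0")
  case False
  have "(\<integral>x. u \<bullet> x \<partial>gauss_law) = (\<integral>\<omega>. (\<Sum>i\<in>UNIV. u $ i * \<omega> i) \<partial>normal_product)"
    unfolding gauss_law_def by (subst integral_distr) (simp_all add: inner_gauss)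
  also have "\<dots> = (\<integral>\<omega>. norm u * ((\<Sum>i\<in>UNIV. u $ i * \<omega> i) / norm u) \<partial>normal_product)"
    using False by simp
  also have "\<dots> = norm u * (\<integral>\<omega>. (\<Sum>i\<in>UNIV. u $ i * \<omega> i) / norm u \<partial>normal_product)"
    by (rule integral_mult_right_zero)
  also have "\<dots> = 0"
    by (simp only: prob_space.standard_normal_distributed_expectation[OF prob_space_normal_product
        normal_product_sum_distributed[OF False]] mult_zero_right)
  finally show ?thesis .
qed simp

subsection \<open>Linear spans of functions\<close>

lemma linear_span_zero: "(\<lambda>_. 0) \<in> linear_span S"
  unfolding linear_span_def by (rule CollectI, rule exI[of _ 0]) simp

lemma linear_span_base: "f \<in> S \<Longrightarrow> f \<in> linear_span S"
  unfolding linear_span_def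
  by (rule CollectI, rule exI[of _ "1::nat"], rule exI[of _ "\<lambda>_. 1"], rule exI[of _ "\<lambda>_. f"]) simp

lemma linear_span_scale: "f \<in> linear_span S \<Longrightarrow> (\<lambda>u. c * f u) \<in> linear_span S"
proof -
  assume "f \<in> linear_span S"
  then obtain N :: nat and b g where "\<forall>i<N. g i \<in> S" "f = (\<lambda>u. \<Sum>i<N. b i * g i u)"
    by (auto simp: linear_span_def)
  then show ?thesis
    unfolding linear_span_def
    by (intro CollectI exI[of _ N] exI[of _ "\<lambda>i. c * b i"] exI[of _ g]) (simp add: sum_distrib_left mult.assoc)
qed

lemma linear_span_add:
  assumes "f \<in> linear_span S" "h \<in> linear_span S"
  shows "(\<lambda>u. f u + h u) \<in> linear_span S"
proof -
  obtain N :: nat and b g where f: "\<forall>i<N. g i \<in> S" "f = (\<lambda>u. \<Sum>i<N. b i * g i u)"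
    using assms by (auto simp: linear_span_def)
  obtain M :: nat and c k where h: "\<forall>i<M. k i \<in> S" "h = (\<lambda>u. \<Sum>i<M. c i * k i u)"
    using assms by (auto simp: linear_span_def)
  define d where "d i = (if i < N then b i else c (i - N))" for i
  define l where "l i = (if i < N then g i else k (i - N))" for i
  have split: "(\<Sum>i<N + L. F i) = (\<Sum>i<N. F i) + (\<Sum>i<L. F (N + i))" for F :: "nat \<Rightarrow> real" and L
    by (induction L) simp_all
  have "(\<lambda>u. f u + h u) = (\<lambda>u. \<Sum>i<N + M. d i * l i u)"
    by (simp add: split f h d_def l_def)
  moreover have "\<forall>i<N + M. l i \<in> S"
    using f h by (auto simp: l_def)
  ultimately show ?thesis
    unfolding linear_span_def by blast
qed

lemma linear_span_induct [consumes 1, case_names zero add]: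
  assumes "f \<in> linear_span S" "P (\<lambda>_. 0)"
    "\<And>c g h. g \<in> S \<Longrightarrow> h \<in> linear_span S \<Longrightarrow> P h \<Longrightarrow> P (\<lambda>u. c * g u + h u)"
  shows "P f"
proof -
  obtain N :: nat and b g where f: "\<forall>i<N. g i \<in> S" "f = (\<lambda>u. \<Sum>i<N. b i * g i u)"
    using assms by (auto simp: linear_span_def)
  have "P (\<lambda>u. \<Sum>i<k. b i * g i u)" if "k \<le> N" for k
    using that
  proof (induction k)
    case (Suc k)
    have "(\<lambda>u. \<Sum>i<k. b i * g i u) \<in> linear_span S"
      using f(1) Suc.prems unfolding linear_span_def
      by (intro CollectI exI[of _ k] exI[of _ b] exI[of _ g]) auto
    then show ?case
      using assms(3)[of "g k" "\<lambda>u. \<Sum>i<k. b i * g i u" "b k"] Suc f(1) by (simp add: add.commute)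
  qed (simp add: assms)
  then show ?thesis using f(2) by blast
qed

lemma linear_span_sum:
  "finite I \<Longrightarrow> (\<And>i. i \<in> I \<Longrightarrow> F i \<in> linear_span S) \<Longrightarrow> (\<lambda>u. \<Sum>i\<in>I. F i u) \<in> linear_span S"
  by (induction I rule: finite_induct) (auto simp: linear_span_zero linear_span_add)

lemma linear_span_diff:
  "f \<in> linear_span S \<Longrightarrow> h \<in> linear_span S \<Longrightarrow> (\<lambda>u. f u - h u) \<in> linear_span S"
  using linear_span_add[OF _ linear_span_scale[of h S "- 1"], of f] by simp

lemma linear_span_minimal: "S \<subseteq> linear_span T \<Longrightarrow> linear_span S \<subseteq> linear_span T"
proof
  fix f assume "S \<subseteq> linear_span T" "f \<in> linear_span S"
  then show "f \<in> linear_span T"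
    by (induction rule: linear_span_induct[OF \<open>f \<in> linear_span S\<close>])
      (auto simp: linear_span_zero intro!: linear_span_add linear_span_scale)
qed

text \<open>One of the many ways of writing \<open>f\<close> over which
  \<open>bilinear_extension\<close> quantifies. The coefficients and laws stay explicit so that two
  representations of the same function can be compared.\<close>

definition represents ::
  "('l \<Rightarrow> 'a \<Rightarrow> real) \<Rightarrow> 'l set \<Rightarrow> ('a \<Rightarrow> real) \<Rightarrow> nat \<Rightarrow> (nat \<Rightarrow> real) \<Rightarrow> (nat \<Rightarrow> 'l) \<Rightarrow> bool" where
  "represents \<zeta> A f N a \<mu> \<longleftrightarrow> (\<forall>i<N. \<mu> i \<in> A) \<and> f = (\<lambda>u. \<Sum>i<N. a i * \<zeta> (\<mu> i) u)"

lemma representsE: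
  assumes "f \<in> linear_span (\<zeta> ` A)"
  obtains N a \<mu> where "represents \<zeta> A f N a \<mu>"
proof -
  obtain N :: nat and a g where f: "\<forall>i<N. g i \<in> \<zeta> ` A" "f = (\<lambda>u. \<Sum>i<N. a i * g i u)"
    using assms by (auto simp: linear_span_def)
  then have "\<forall>i. \<exists>m. i < N \<longrightarrow> m \<in> A \<and> g i = \<zeta> m" by blast
  then obtain \<mu> where "\<forall>i<N. \<mu> i \<in> A \<and> g i = \<zeta> (\<mu> i)" by metis
  with f show ?thesis
    by (intro that[of N a \<mu>]) (simp add: represents_def)
qed

lemma represents_linear_span: "represents \<zeta> A f N a \<mu> \<Longrightarrow> f \<in> linear_span (\<zeta> ` A)"
  unfolding represents_def
  by (elim conjE ssubst, intro linear_span_sum linear_span_scale) (auto intro: linear_span_base)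

lemma represents_mono: "represents \<zeta> A f N a \<mu> \<Longrightarrow> A \<subseteq> B \<Longrightarrow> represents \<zeta> B f N a \<mu>"
  by (auto simp: represents_def)

lemma represents_single: "\<mu> \<in> A \<Longrightarrow> represents \<zeta> A (\<zeta> \<mu>) 1 (\<lambda>_. 1) (\<lambda>_. \<mu>)"
  by (simp add: represents_def)

text \<open>The bilinear extension is well defined as soon as the form depends on each of the two
  arguments only through the function which the argument represents.\<close>

lemma bilinear_extension_eq:
  assumes F: "\<And>N a \<mu> \<nu>. represents \<zeta> A f N a \<mu> \<Longrightarrow> \<nu> \<in> B \<Longrightarrow> (\<Sum>i<N. a i * \<beta> (\<mu> i) \<nu>) = F \<nu>"
    and G: "\<And>M b \<nu> \<mu>. represents \<zeta> B g M b \<nu> \<Longrightarrow> \<mu> \<in> A \<Longrightarrow> (\<Sum>j<M. b j * \<beta> \<mu> (\<nu> j)) = G \<mu>"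
    and f: "represents \<zeta> A f N a \<mu>" and g: "represents \<zeta> B g M b \<nu>"
  shows "bilinear_extension \<zeta> A B \<beta> f g = (\<Sum>i<N. \<Sum>j<M. a i * b j * \<beta> (\<mu> i) (\<nu> j))" (is ?double)
    and "bilinear_extension \<zeta> A B \<beta> f g = (\<Sum>j<M. b j * F (\<nu> j))" (is ?right)
    and "bilinear_extension \<zeta> A B \<beta> f g = (\<Sum>i<N. a i * G (\<mu> i))" (is ?left)
proof -
  have FF: "(\<Sum>i<N. \<Sum>j<M. a i * b j * \<beta> (\<mu> i) (\<nu> j)) = (\<Sum>j<M. b j * F (\<nu> j))"
    if f: "represents \<zeta> A f N a \<mu>" and g: "represents \<zeta> B g M b \<nu>" for N a \<mu> M b \<nu>
  proof -
    have "(\<Sum>i<N. \<Sum>j<M. a i * b j * \<beta> (\<mu> i) (\<nu> j)) = (\<Sum>j<M. b j * (\<Sum>i<N. a i * \<beta> (\<mu> i) (\<nu> j)))"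
      by (subst sum.swap) (simp add: sum_distrib_left mult_ac)
    also have "\<dots> = (\<Sum>j<M. b j * F (\<nu> j))"
      using F[OF f] g by (intro sum.cong) (auto simp: represents_def)
    finally show ?thesis .
  qed
  have GG: "(\<Sum>i<N. \<Sum>j<M. a i * b j * \<beta> (\<mu> i) (\<nu> j)) = (\<Sum>i<N. a i * G (\<mu> i))"
    if f: "represents \<zeta> A f N a \<mu>" and g: "represents \<zeta> B g M b \<nu>" for N a \<mu> M b \<nu>
  proof -
    have "(\<Sum>i<N. \<Sum>j<M. a i * b j * \<beta> (\<mu> i) (\<nu> j)) = (\<Sum>i<N. a i * (\<Sum>j<M. b j * \<beta> (\<mu> i) (\<nu> j)))"
      by (simp add: sum_distrib_left mult_ac)
    also have "\<dots> = (\<Sum>i<N. a i * G (\<mu> i))"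
      using G[OF g] f by (intro sum.cong) (auto simp: represents_def)
    finally show ?thesis .
  qed
  have "(\<Sum>i<N. \<Sum>j<M. a i * b j * \<beta> (\<mu> i) (\<nu> j)) = (\<Sum>i<N'. \<Sum>j<M'. a' i * b' j * \<beta> (\<mu>' i) (\<nu>' j))"
    if "represents \<zeta> A f N' a' \<mu>'" "represents \<zeta> B g M' b' \<nu>'" for N' a' \<mu>' M' b' \<nu>'
    using FF[OF f g] FF[OF that(1) g] GG[OF that(1) g] GG[OF that] by simp
  then show ?double
    unfolding bilinear_extension_def represents_def[symmetric] conj_assoc[symmetric]
    using f g by (intro the_equality) (auto simp: represents_def conj_assoc)
  then show ?right ?left
    using FF[OF f g] GG[OF f g] by simp_all
qed

subsection \<open>Laws of integrable random vectors\<close>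

lemma law_prob_space: "\<mu> \<in> integrable_laws W \<Longrightarrow> prob_space \<mu>"
  and law_sets: "\<mu> \<in> integrable_laws W \<Longrightarrow> sets \<mu> = sets borel"
  and law_integrable_id: "\<mu> \<in> integrable_laws W \<Longrightarrow> integrable \<mu> (\<lambda>x. x)"
  and law_AE: "\<mu> \<in> integrable_laws W \<Longrightarrow> AE x in \<mu>. x \<in> W"
  by (simp_all add: integrable_laws_def)

lemma law_measurable: "\<mu> \<in> integrable_laws W \<Longrightarrow> measurable \<mu> N = measurable borel N"
  by (rule measurable_cong_sets) (simp_all add: law_sets)

lemma law_integrable:
  fixes f :: "'a::euclidean_space \<Rightarrow> 'b::{banach, second_countable_topology}"
  assumes "\<mu> \<in> integrable_laws W" "f \<in> borel_measurable borel" "\<And>x. norm (f x) \<le> C * norm x"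
  shows "integrable \<mu> f"
proof (rule Bochner_Integration.integrable_bound)
  show "integrable \<mu> (\<lambda>x. C * norm x)"
    using law_integrable_id[OF assms(1)] by simp
  show "AE x in \<mu>. norm (f x) \<le> norm (C * norm x)"
    using assms(3) by (intro AE_I2) (metis abs_ge_self order_trans real_norm_def)
qed (use assms in \<open>simp add: law_measurable\<close>)

lemma law_pair_integrable:
  fixes h :: "'a::euclidean_space \<times> 'b::euclidean_space \<Rightarrow> 'c::{banach, second_countable_topology}"
  assumes "\<mu> \<in> integrable_laws W" "\<nu> \<in> integrable_laws W'" "h \<in> borel_measurable (borel \<Otimes>\<^sub>M borel)"
    "\<And>x y. norm (h (x, y)) \<le> C * norm x * norm y"
  shows "integrable (\<mu> \<Otimes>\<^sub>M \<nu>) h"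
proof -
  note [measurable_cong] = law_sets[OF assms(1)] law_sets[OF assms(2)]
  interpret \<mu>: prob_space \<mu> by (rule law_prob_space[OF assms(1)])
  interpret \<nu>: prob_space \<nu> by (rule law_prob_space[OF assms(2)])
  interpret pair_sigma_finite \<mu> \<nu> ..
  have h[measurable]: "h \<in> borel_measurable (\<mu> \<Otimes>\<^sub>M \<nu>)"
    using assms(3) by measurable
  have "integrable (\<mu> \<Otimes>\<^sub>M \<nu>) (\<lambda>p. C * norm (fst p) * norm (snd p))"
    using law_integrable_id[OF assms(1)] law_integrable_id[OF assms(2)]
    by (intro Fubini_integrable) (auto simp: abs_mult)
  then show ?thesis
  proof (rule Bochner_Integration.integrable_bound)
    show "AE p in \<mu> \<Otimes>\<^sub>M \<nu>. norm (h p) \<le> norm (C * norm (fst p) * norm (snd p))"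
      using assms(4) by (intro AE_I2) (metis abs_ge_self order_trans real_norm_def prod.collapse)
  qed simp
qed

lemma law_pair_integral:
  fixes h :: "'a::euclidean_space \<Rightarrow> 'b::euclidean_space \<Rightarrow> real"
  assumes "\<mu> \<in> integrable_laws W" "\<nu> \<in> integrable_laws W'" "(\<lambda>p. h (fst p) (snd p)) \<in> borel_measurable (borel \<Otimes>\<^sub>M borel)"
    "\<And>x y. \<bar>h x y\<bar> \<le> C * norm x * norm y"
  shows "(\<integral>p. h (fst p) (snd p) \<partial>(\<mu> \<Otimes>\<^sub>M \<nu>)) = (\<integral>x. \<integral>y. h x y \<partial>\<nu> \<partial>\<mu>)"
    and "(\<integral>p. h (fst p) (snd p) \<partial>(\<mu> \<Otimes>\<^sub>M \<nu>)) = (\<integral>y. \<integral>x. h x y \<partial>\<mu> \<partial>\<nu>)"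
proof -
  interpret \<mu>: prob_space \<mu> by (rule law_prob_space[OF assms(1)])
  interpret \<nu>: prob_space \<nu> by (rule law_prob_space[OF assms(2)])
  interpret pair_sigma_finite \<mu> \<nu> ..
  have i: "integrable (\<mu> \<Otimes>\<^sub>M \<nu>) (\<lambda>p. h (fst p) (snd p))"
    using assms by (intro law_pair_integrable[where C = C]) auto
  then have j: "integrable (\<mu> \<Otimes>\<^sub>M \<nu>) (\<lambda>(x, y). h x y)"
    by (simp add: split_beta')
  show "(\<integral>p. h (fst p) (snd p) \<partial>(\<mu> \<Otimes>\<^sub>M \<nu>)) = (\<integral>x. \<integral>y. h x y \<partial>\<nu> \<partial>\<mu>)"
    using integral_fst'[OF i] by simp
  show "(\<integral>p. h (fst p) (snd p) \<partial>(\<mu> \<Otimes>\<^sub>M \<nu>)) = (\<integral>y. \<integral>x. h x y \<partial>\<mu> \<partial>\<nu>)"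
    using integral_snd[OF j] by (simp add: split_beta')
qed

lemma return_law: "x \<in> W \<Longrightarrow> return borel x \<in> integrable_laws W"
proof -
  assume "x \<in> W"
  have "AE y in return borel x. y = x"
    by (subst AE_return) auto
  then have "AE y in return borel x. y \<in> W"
    by eventually_elim (use \<open>x \<in> W\<close> in simp)
  moreover have "integrable (return borel x) (\<lambda>y. y)"
    unfolding integrable_iff_bounded by (auto simp: nn_integral_return)
  ultimately show ?thesis
    by (simp add: integrable_laws_def prob_space_return)
qed

lemma distr_law:
  assumes "\<mu> \<in> integrable_laws W" "linear T" "T ` W \<subseteq> W'" "W' \<in> sets borel"
  shows "distr \<mu> borel T \<in> integrable_laws W'"
proof -
  have bl: "bounded_linear T" using assms(2) by (simp add: linear_conv_bounded_linear)
  then have T[measurable]: "T \<in> borel_measurable borel"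
    by (intro borel_measurable_continuous_onI linear_continuous_on)
  then have T'[measurable]: "T \<in> borel_measurable \<mu>"
    using law_measurable[OF assms(1)] by blast
  have "AE x in distr \<mu> borel T. x \<in> W'"
    using law_AE[OF assms(1)] assms(3,4) by (subst AE_distr_iff) auto
  moreover have "integrable \<mu> T"
    using integrable_bounded_linear[OF bl law_integrable_id[OF assms(1)]] .
  ultimately show ?thesis
    using law_prob_space[OF assms(1)]
    by (auto simp: integrable_laws_def integrable_distr_eq intro!: prob_space.prob_space_distr)
qed


section \<open>Measurable functions of linear growth\<close>

text \<open>A class that contains all zonoid functions, is stable under linear combinations and
  linear substitutions, and is integrable against every integrable law. It settles the side
  conditions whenever sums and integrals are exchanged.\<close>

definition tame :: "('a::euclidean_space \<Rightarrow> real) \<Rightarrow> bool" where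
  "tame f \<longleftrightarrow> f \<in> borel_measurable borel \<and> (\<exists>C. \<forall>u. \<bar>f u\<bar> \<le> C * norm u)"

lemma tame_measurable: "tame f \<Longrightarrow> f \<in> borel_measurable borel"
  by (simp add: tame_def)

lemma tame_compose:
  assumes "tame f" "linear T"
  shows "tame (\<lambda>u. f (T u))"
proof -
  have bl: "bounded_linear T" using assms(2) by (simp add: linear_conv_bounded_linear)
  then obtain K where K: "\<And>u. norm (T u) \<le> norm u * K" "K > 0"
    using bounded_linear.pos_bounded by blast
  obtain C where C: "\<And>u. \<bar>f u\<bar> \<le> C * norm u"
    using assms(1) by (auto simp: tame_def)
  have "\<bar>f (T u)\<bar> \<le> (\<bar>C\<bar> * K) * norm u" for u
  proof -
    have "\<bar>f (T u)\<bar> \<le> \<bar>C\<bar> * norm (T u)"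
      using C[of "T u"] by (meson abs_ge_self mult_right_mono norm_ge_zero order_trans)
    also have "\<dots> \<le> \<bar>C\<bar> * (norm u * K)"
      by (intro mult_left_mono K) simp
    finally show ?thesis by (simp add: mult_ac)
  qed
  moreover have "T \<in> borel_measurable borel"
    using bl by (intro borel_measurable_continuous_onI linear_continuous_on)
  ultimately show ?thesis
    using tame_measurable[OF assms(1)] unfolding tame_def
    by (auto intro: measurable_compose)
qed

lemma tame_integrable: "tame f \<Longrightarrow> \<mu> \<in> integrable_laws W \<Longrightarrow> integrable \<mu> f"
proof -
  assume "tame f" "\<mu> \<in> integrable_laws W"
  then obtain C where "\<And>u. \<bar>f u\<bar> \<le> C * norm u"
    by (auto simp: tame_def)
  then show ?thesis
    using \<open>tame f\<close> \<open>\<mu> \<in> integrable_laws W\<close> by (intro law_integrable[where C = C]) (auto simp: tame_def)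
qed

lemma tame_zero: "tame (\<lambda>_. 0)"
  by (auto simp: tame_def intro: exI[of _ 0])

lemma tame_lincomb: "tame f \<Longrightarrow> tame h \<Longrightarrow> tame (\<lambda>u. c * f u + h u)"
proof -
  assume "tame f" "tame h"
  then obtain C D where "\<And>u. \<bar>f u\<bar> \<le> C * norm u" "\<And>u. \<bar>h u\<bar> \<le> D * norm u"
    by (auto simp: tame_def)
  note CD = this
  have "\<bar>c * f u + h u\<bar> \<le> (\<bar>c\<bar> * C + D) * norm u" for u
  proof -
    have "\<bar>c * f u\<bar> \<le> \<bar>c\<bar> * (C * norm u)"
      unfolding abs_mult by (intro mult_left_mono CD) simp
    moreover have "\<bar>c * f u + h u\<bar> \<le> \<bar>c * f u\<bar> + \<bar>h u\<bar>"
      by (rule abs_triangle_ineq)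
    moreover have "(\<bar>c\<bar> * C + D) * norm u = \<bar>c\<bar> * (C * norm u) + D * norm u"
      by (simp add: algebra_simps)
    ultimately show ?thesis
      using CD(2)[of u] by linarith
  qed
  then show ?thesis
    using \<open>tame f\<close> \<open>tame h\<close> by (auto simp: tame_def)
qed

lemma tame_linear_span: "f \<in> linear_span S \<Longrightarrow> (\<And>g. g \<in> S \<Longrightarrow> tame g) \<Longrightarrow> tame f"
  by (induction rule: linear_span_induct) (auto intro: tame_zero tame_lincomb)

lemma tame_law_integral:
  assumes "\<mu> \<in> integrable_laws W" "\<phi> \<in> borel_measurable borel" "\<And>t. \<bar>\<phi> t\<bar> \<le> \<bar>t :: real\<bar>"
  shows "tame (\<lambda>u. \<integral>x. \<phi> (u \<bullet> x) \<partial>\<mu>)"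
proof -
  note [measurable] = assms(2)
  note [measurable_cong] = law_sets[OF assms(1)]
  interpret prob_space \<mu> by (rule law_prob_space[OF assms(1)])
  have "\<bar>\<integral>x. \<phi> (u \<bullet> x) \<partial>\<mu>\<bar> \<le> (\<integral>x. norm x \<partial>\<mu>) * norm u" for u
  proof -
    have b: "\<bar>\<phi> (u \<bullet> x)\<bar> \<le> norm u * norm x" for x
      using assms(3)[of "u \<bullet> x"] Cauchy_Schwarz_ineq2[of u x] by linarith
    have "\<bar>\<integral>x. \<phi> (u \<bullet> x) \<partial>\<mu>\<bar> \<le> (\<integral>x. \<bar>\<phi> (u \<bullet> x)\<bar> \<partial>\<mu>)"
      by (rule integral_abs_bound)
    also have "\<dots> \<le> (\<integral>x. norm u * norm x \<partial>\<mu>)"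
    proof (rule integral_mono)
      show "integrable \<mu> (\<lambda>x. \<bar>\<phi> (u \<bullet> x)\<bar>)"
        by (rule law_integrable[OF assms(1), where C = "norm u"]) (use b in auto)
      show "integrable \<mu> (\<lambda>x. norm u * norm x)"
        using law_integrable_id[OF assms(1)] by simp
    qed (rule b)
    also have "\<dots> = (\<integral>x. norm x \<partial>\<mu>) * norm u" by simp
    finally show ?thesis .
  qed
  moreover have "(\<lambda>u. \<integral>x. \<phi> (u \<bullet> x) \<partial>\<mu>) \<in> borel_measurable borel"
    by (rule borel_measurable_lebesgue_integral) measurable
  ultimately show ?thesis by (auto simp: tame_def)
qed

lemma max_0_measurable: "max 0 \<in> borel_measurable (borel :: real measure)"
  by measurable

lemma max_0_bound: "\<bar>max 0 t\<bar> \<le> \<bar>t :: real\<bar>"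
  by auto

lemma tame_zonoid_Z: "\<mu> \<in> integrable_laws W \<Longrightarrow> tame (zonoid_Z \<mu>)"
  using tame_law_integral[of \<mu> W "max 0"] by (simp add: zonoid_Z_def[abs_def] max_def)

lemma tame_zonoid_K: "\<mu> \<in> integrable_laws W \<Longrightarrow> tame (zonoid_K \<mu>)"
  using tame_lincomb[OF tame_law_integral[of \<mu> W abs] tame_zero, of "1/2"]
  by (simp add: zonoid_K_def[abs_def])

lemma zonoid_Z_distr:
  assumes "\<mu> \<in> integrable_laws W" "linear T" "\<And>x. u \<bullet> T x = v \<bullet> x"
  shows "zonoid_Z (distr \<mu> borel T) u = zonoid_Z \<mu> v"
proof -
  have "T \<in> borel_measurable borel"
    using assms(2) by (intro borel_measurable_continuous_onI linear_continuous_on) (simp add: linear_conv_bounded_linear)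
  then have [measurable]: "T \<in> borel_measurable \<mu>"
    using law_measurable[OF assms(1)] by blast
  show ?thesis
    by (simp add: zonoid_Z_def integral_distr assms(3))
qed

lemma zonoid_K_eq_Z:
  assumes "\<mu> \<in> integrable_laws W"
  shows "zonoid_K \<mu> u = 1 / 2 * zonoid_Z \<mu> u + 1 / 2 * zonoid_Z \<mu> (- u)"
proof -
  have i: "integrable \<mu> (\<lambda>x. max 0 (v \<bullet> x))" for v
    using law_integrable_id[OF assms] by simp
  have "zonoid_Z \<mu> u + zonoid_Z \<mu> (- u) = (\<integral>x. max 0 (u \<bullet> x) + max 0 (- u \<bullet> x) \<partial>\<mu>)"
    unfolding zonoid_Z_def by (rule Bochner_Integration.integral_add[OF i i, symmetric])
  also have "\<dots> = (\<integral>x. \<bar>u \<bullet> x\<bar> \<partial>\<mu>)"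
    by (intro Bochner_Integration.integral_cong) auto
  finally show ?thesis by (simp add: zonoid_K_def)
qed

text \<open>Integrate \<open>max 0 t = \<bar>t\<bar> / 2 + t / 2\<close>; the linear half is the
  support function of the center.\<close>

lemma zonoid_Z_eq_K:
  assumes "\<mu> \<in> integrable_laws W"
  shows "zonoid_Z \<mu> u = zonoid_K \<mu> u + u \<bullet> ((1 / 2) *\<^sub>R (\<integral>x. x \<partial>\<mu>))"
proof -
  have i: "integrable \<mu> (\<lambda>x. \<bar>u \<bullet> x\<bar>)" "integrable \<mu> (\<lambda>x. u \<bullet> x)"
    using law_integrable_id[OF assms] by simp_all
  have "zonoid_Z \<mu> u = (\<integral>x. 1 / 2 * \<bar>u \<bullet> x\<bar> + 1 / 2 * (u \<bullet> x) \<partial>\<mu>)"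
    unfolding zonoid_Z_def by (intro Bochner_Integration.integral_cong) auto
  also have "\<dots> = zonoid_K \<mu> u + u \<bullet> ((1 / 2) *\<^sub>R (\<integral>x. x \<partial>\<mu>))"
    using i law_integrable_id[OF assms] by (simp add: zonoid_K_def)
  finally show ?thesis .
qed

text \<open>The component \<open>z\<close> of the mean orthogonal to \<open>W\<close> satisfies
  \<open>z \<bullet> z = 0\<close>, because \<open>z \<bullet> x\<close> vanishes almost
  surely.\<close>

lemma law_mean_mem:
  assumes "\<mu> \<in> integrable_laws W" "subspace W"
  shows "(\<integral>x. x \<partial>\<mu>) \<in> W"
proof -
  obtain y z where yz: "y \<in> span W" "\<And>w. w \<in> span W \<Longrightarrow> orthogonal z w" "(\<integral>x. x \<partial>\<mu>) = y + z"
    using orthogonal_subspace_decomp_exists[of W "\<integral>x. x \<partial>\<mu>"] by metis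
  have "z \<bullet> (\<integral>x. x \<partial>\<mu>) = (\<integral>x. z \<bullet> x \<partial>\<mu>)"
    using law_integrable_id[OF assms(1)] by simp
  also have "\<dots> = (\<integral>x. 0 \<partial>\<mu>)"
  proof (rule integral_cong_AE)
    show "(\<lambda>x. z \<bullet> x) \<in> borel_measurable \<mu>"
      unfolding law_measurable[OF assms(1)] by measurable
    show "AE x in \<mu>. z \<bullet> x = 0"
      using law_AE[OF assms(1)] by eventually_elim (use yz(2) in \<open>auto simp: orthogonal_def span_base\<close>)
  qed simp
  finally have "z \<bullet> y + z \<bullet> z = 0" by (simp add: yz(3) inner_add_right)
  moreover have "z \<bullet> y = 0" using yz(1,2) by (simp add: orthogonal_def)
  ultimately have "z = 0" by simp
  then show ?thesis using yz assms(2) by (simp add: span_eq_iff[THEN iffD2])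
qed

subsection \<open>Products and pairings of zonoids\<close>

lemma wedge_bound:
  obtains K where "K > 0" "\<And>x y. norm (wedge x (y :: ('m::{finite,linorder}) ext)) \<le> K * norm x * norm y"
  using wedge.pos_bounded by (metis mult.commute mult.left_commute)

lemma wedge_measurable [measurable]:
  "(\<lambda>p. wedge (fst p) (snd p :: ('m::{finite,linorder}) ext)) \<in> borel_measurable (borel \<Otimes>\<^sub>M borel)"
  unfolding borel_prod
  by (intro borel_measurable_continuous_onI wedge.continuous_on continuous_intros)

text \<open>Fubini in both orders, after moving one factor to the other side as a contraction. The
  function \<open>\<phi>\<close> is kept general to serve \<open>max 0\<close> and the absolute
  value alike.\<close>

lemma wedge_law_integral:
  fixes \<mu> \<nu> :: "('m::{finite,linorder}) ext measure"
  assumes "\<mu> \<in> integrable_laws W" "\<nu> \<in> integrable_laws W'"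
    and \<phi>: "\<phi> \<in> borel_measurable borel" "\<And>t. \<bar>\<phi> t\<bar> \<le> \<bar>t :: real\<bar>"
  shows "(\<integral>z. \<phi> (u \<bullet> z) \<partial>wedge_law \<mu> \<nu>) = (\<integral>x. \<integral>y. \<phi> (contr x u \<bullet> y) \<partial>\<nu> \<partial>\<mu>)"
    and "(\<integral>z. \<phi> (u \<bullet> z) \<partial>wedge_law \<mu> \<nu>) = (\<integral>y. \<integral>x. \<phi> (contr_right y u \<bullet> x) \<partial>\<mu> \<partial>\<nu>)"
proof -
  note [measurable] = \<phi>(1)
  note [measurable_cong] = law_sets[OF assms(1)] law_sets[OF assms(2)]
  obtain K where K: "K > 0" "\<And>x y :: 'm ext. norm (wedge x y) \<le> K * norm x * norm y"
    using wedge_bound by blast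
  have b: "\<bar>\<phi> (u \<bullet> wedge x y)\<bar> \<le> norm u * K * norm x * norm y" for x y
  proof -
    have "\<bar>\<phi> (u \<bullet> wedge x y)\<bar> \<le> norm u * norm (wedge x y)"
      using \<phi>(2)[of "u \<bullet> wedge x y"] Cauchy_Schwarz_ineq2[of u "wedge x y"] by linarith
    also have "\<dots> \<le> norm u * (K * norm x * norm y)"
      by (intro mult_left_mono K) simp
    finally show ?thesis by (simp add: mult_ac)
  qed
  have [measurable]: "(\<lambda>(x, y). wedge x y) \<in> borel_measurable (\<mu> \<Otimes>\<^sub>M \<nu>)"
    using wedge_measurable by (simp add: split_beta')
  have "(\<integral>z. \<phi> (u \<bullet> z) \<partial>wedge_law \<mu> \<nu>) = (\<integral>p. \<phi> (u \<bullet> wedge (fst p) (snd p)) \<partial>(\<mu> \<Otimes>\<^sub>M \<nu>))"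
    unfolding wedge_law_def by (subst integral_distr) (auto simp: split_beta')
  moreover have m: "(\<lambda>p. \<phi> (u \<bullet> wedge (fst p) (snd p))) \<in> borel_measurable (borel \<Otimes>\<^sub>M borel)"
    by measurable
  ultimately show "(\<integral>z. \<phi> (u \<bullet> z) \<partial>wedge_law \<mu> \<nu>) = (\<integral>x. \<integral>y. \<phi> (contr x u \<bullet> y) \<partial>\<nu> \<partial>\<mu>)"
    "(\<integral>z. \<phi> (u \<bullet> z) \<partial>wedge_law \<mu> \<nu>) = (\<integral>y. \<integral>x. \<phi> (contr_right y u \<bullet> x) \<partial>\<mu> \<partial>\<nu>)"
    using law_pair_integral[OF assms(1,2) m b] by (simp_all add: inner_contr inner_contr_right)
qed

lemmas zonoid_Z_wedge_law =
  wedge_law_integral[where \<phi> = "max 0", OF _ _ max_0_measurable max_0_bound, folded zonoid_Z_def]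

lemma zonoid_K_wedge_law:
  fixes \<mu> \<nu> :: "('m::{finite,linorder}) ext measure"
  assumes "\<mu> \<in> integrable_laws W" "\<nu> \<in> integrable_laws W'"
  shows "zonoid_K (wedge_law \<mu> \<nu>) u = (\<integral>y. zonoid_K \<mu> (contr_right y u) \<partial>\<nu>)"
  using wedge_law_integral(2)[OF assms, of abs u] by (simp add: zonoid_K_def)

lemma wedge_law_mem:
  fixes \<mu> \<nu> :: "('m::{finite,linorder}) ext measure"
  assumes "\<mu> \<in> integrable_laws W" "\<nu> \<in> integrable_laws W'"
    and "AE x in \<mu>. x \<in> S" "AE y in \<nu>. y \<in> T" "S \<in> sets borel" "T \<in> sets borel" "U \<in> sets borel"
    and "\<And>x y. x \<in> S \<Longrightarrow> y \<in> T \<Longrightarrow> wedge x y \<in> U"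
  shows "wedge_law \<mu> \<nu> \<in> integrable_laws U"
proof -
  note [measurable] = assms(5-7)
  note [measurable_cong] = law_sets[OF assms(1)] law_sets[OF assms(2)]
  interpret \<mu>: prob_space \<mu> by (rule law_prob_space[OF assms(1)])
  interpret \<nu>: prob_space \<nu> by (rule law_prob_space[OF assms(2)])
  interpret pair_prob_space \<mu> \<nu> ..
  obtain K where K: "K > 0" "\<And>x y :: 'm ext. norm (wedge x y) \<le> K * norm x * norm y"
    using wedge_bound by blast
  have w[measurable]: "(\<lambda>(x, y). wedge x y) \<in> borel_measurable (\<mu> \<Otimes>\<^sub>M \<nu>)"
    using wedge_measurable by (simp add: split_beta')
  have "integrable (\<mu> \<Otimes>\<^sub>M \<nu>) (\<lambda>(x, y). wedge x y)"
    using assms wedge_measurable K by (intro law_pair_integrable[where C = K]) (auto simp: split_beta')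
  moreover have "AE p in \<mu> \<Otimes>\<^sub>M \<nu>. (case p of (x, y) \<Rightarrow> wedge x y) \<in> U"
  proof (rule AE_pair_measure)
    show "{p \<in> space (\<mu> \<Otimes>\<^sub>M \<nu>). (case p of (x, y) \<Rightarrow> wedge x y) \<in> U} \<in> sets (\<mu> \<Otimes>\<^sub>M \<nu>)"
      by measurable
    show "AE x in \<mu>. AE y in \<nu>. (case (x, y) of (x, y) \<Rightarrow> wedge x y) \<in> U"
      using assms(3)
    proof eventually_elim
      case (elim x)
      show ?case using assms(4) by eventually_elim (use elim assms(8) in auto)
    qed
  qed
  ultimately show ?thesis
    unfolding wedge_law_def integrable_laws_def
    by (auto simp: integrable_distr_eq AE_distr_iff prob_space_distr)
qed

subsection \<open>Grassmann zonoids\<close>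

text \<open>Simple vectors already lie in the exterior power, so that every fact about
  \<open>integrable_laws\<close> applies to Grassmann laws with the simple vectors as
  carrier.\<close>

lemma grassmann_laws_eq: "grassmann_laws V d = integrable_laws (simple_vectors V d)"
proof -
  have "AE x in \<mu>. x \<in> ext_power V d" if "AE x in \<mu>. x \<in> simple_vectors V d" for \<mu> :: "'a ext measure"
    using that by eventually_elim (use simple_vectors_subset in blast)
  then show ?thesis
    unfolding grassmann_laws_def integrable_laws_def mem_Collect_eq set_eq_iff by blast
qed

lemma grassmann_laws_subset: "grassmann_laws V d \<subseteq> integrable_laws (ext_power V d)"
  by (auto simp: grassmann_laws_def)

lemma zonoid_Z_return: "zonoid_Z (return borel w) u = max 0 (u \<bullet> w)"
  by (simp add: zonoid_Z_def integral_return)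

text \<open>For simple \<open>y\<close> the segments from \<open>0\<close> to \<open>y\<close> and
  from \<open>0\<close> to \<open>- y\<close> differ by the point \<open>y\<close>, as
  \<open>max 0 t - max 0 (- t) = t\<close>; simple vectors span the rest.\<close>

lemma point_in_span:
  assumes "p \<in> ext_power V d"
  shows "(\<lambda>u. u \<bullet> p) \<in> linear_span (zonoid_Z ` grassmann_laws V d)"
  using assms
proof (induction rule: ext_power_induct)
  case zero
  then show ?case by (simp add: linear_span_zero)
next
  case (add y z)
  have ret: "zonoid_Z (return borel x) \<in> linear_span (zonoid_Z ` grassmann_laws V d)"
    if "x \<in> simple_vectors V d" for x
    using that by (auto simp: grassmann_laws_eq intro!: linear_span_base return_law)
  have "(\<lambda>u. (zonoid_Z (return borel y) u - zonoid_Z (return borel (- y)) u) + u \<bullet> z)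
      \<in> linear_span (zonoid_Z ` grassmann_laws V d)"
    using add by (intro linear_span_add linear_span_diff ret simple_vectors_minus)
  moreover have "(zonoid_Z (return borel y) u - zonoid_Z (return borel (- y)) u) + u \<bullet> z = u \<bullet> (y + z)" for u
    by (simp add: zonoid_Z_return inner_add_right)
  ultimately show ?case by simp
qed

locale vector_subspace =
  fixes V :: "('m::{finite,linorder}) evec set"
  assumes subspace_V: "subspace V"
begin

lemma simple_borel: "simple_vectors V d \<in> sets borel"
  by (simp add: simple_vectors_borel closed_subspace subspace_V)

lemma reflect_law: "\<mu> \<in> grassmann_laws V d \<Longrightarrow> distr \<mu> borel uminus \<in> grassmann_laws V d"
  unfolding grassmann_laws_eq
  by (rule distr_law) (auto simp: simple_borel simple_vectors_minus linear_uminus)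

lemma zonoid_Z_reflect: "\<mu> \<in> integrable_laws W \<Longrightarrow> zonoid_Z (distr \<mu> borel uminus) u = zonoid_Z \<mu> (- u)"
  by (rule zonoid_Z_distr) (auto simp: linear_uminus)

lemma zonoid_K_in_span:
  assumes "\<mu> \<in> grassmann_laws V d"
  shows "zonoid_K \<mu> \<in> linear_span (zonoid_Z ` grassmann_laws V d)"
proof -
  have \<mu>: "\<mu> \<in> integrable_laws (ext_power V d)"
    using assms grassmann_laws_subset by blast
  have "(\<lambda>u. 1 / 2 * zonoid_Z \<mu> u + 1 / 2 * zonoid_Z (distr \<mu> borel uminus) u)
      \<in> linear_span (zonoid_Z ` grassmann_laws V d)"
    using assms reflect_law by (intro linear_span_add linear_span_scale linear_span_base) auto
  then show ?thesis
    by (simp add: zonoid_Z_reflect[OF \<mu>] zonoid_K_eq_Z[OF \<mu>, abs_def])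
qed

text \<open>The product is determined by the \<open>zonoid_Z\<close>, whereas Grassmann zonoids are
  defined through centered ones and points. Passing to the first kind of generator makes the
  bilinear extension applicable.\<close>

lemma grassmann_eq: "grassmann V d = linear_span (zonoid_Z ` grassmann_laws V d)"
proof
  show "grassmann V d \<subseteq> linear_span (zonoid_Z ` grassmann_laws V d)"
    unfolding grassmann_def
    by (intro linear_span_minimal) (auto intro!: linear_span_add zonoid_K_in_span point_in_span)
  show "linear_span (zonoid_Z ` grassmann_laws V d) \<subseteq> grassmann V d"
    unfolding grassmann_def
  proof (intro linear_span_minimal image_subsetI linear_span_base CollectI exI conjI)
    fix \<mu> assume \<mu>: "\<mu> \<in> grassmann_laws V d"
    then have \<mu>': "\<mu> \<in> integrable_laws (ext_power V d)"
      using grassmann_laws_subset by blast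
    show "zonoid_Z \<mu> = (\<lambda>u. zonoid_K \<mu> u + u \<bullet> ((1 / 2) *\<^sub>R (\<integral>x. x \<partial>\<mu>)))"
      using zonoid_Z_eq_K[OF \<mu>'] by blast
    show "(1 / 2) *\<^sub>R (\<integral>x. x \<partial>\<mu>) \<in> ext_power V d"
      using law_mean_mem[OF \<mu>' subspace_ext_power] subspace_scale[OF subspace_ext_power] by blast
  qed
qed

lemma grassmann_zero: "(\<lambda>_. 0) \<in> grassmann V d"
  and grassmann_add: "f \<in> grassmann V d \<Longrightarrow> h \<in> grassmann V d \<Longrightarrow> (\<lambda>u. f u + h u) \<in> grassmann V d"
  and grassmann_diff: "f \<in> grassmann V d \<Longrightarrow> h \<in> grassmann V d \<Longrightarrow> (\<lambda>u. f u - h u) \<in> grassmann V d"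
  and grassmann_scale: "f \<in> grassmann V d \<Longrightarrow> (\<lambda>u. c * f u) \<in> grassmann V d"
  by (simp_all add: grassmann_def linear_span_zero linear_span_add linear_span_diff linear_span_scale)

lemma grassmann_Z: "\<mu> \<in> grassmann_laws V d \<Longrightarrow> zonoid_Z \<mu> \<in> grassmann V d"
  by (auto simp: grassmann_eq intro: linear_span_base)

lemma grassmann_K: "\<mu> \<in> grassmann_laws V d \<Longrightarrow> zonoid_K \<mu> \<in> grassmann V d"
  by (simp add: grassmann_eq zonoid_K_in_span)

lemma grassmann_point: "p \<in> ext_power V d \<Longrightarrow> (\<lambda>u. u \<bullet> p) \<in> grassmann V d"
  by (simp add: grassmann_eq point_in_span)

lemma centered_subset_grassmann: "centered_grassmann V d \<subseteq> grassmann V d"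
  unfolding centered_grassmann_def grassmann_eq
  by (intro linear_span_minimal) (auto intro: zonoid_K_in_span)

lemma grassmann_represented:
  assumes "f \<in> grassmann V d"
  obtains N a \<mu> where "represents zonoid_Z (grassmann_laws V d) f N a \<mu>"
    "represents zonoid_Z (integrable_laws (ext_power V d)) f N a \<mu>"
  using assms representsE represents_mono[OF _ grassmann_laws_subset] unfolding grassmann_eq by metis

lemma grassmann_tame: "f \<in> grassmann V d \<Longrightarrow> tame f"
  unfolding grassmann_eq
  by (erule tame_linear_span) (use grassmann_laws_subset tame_zonoid_Z in blast)

lemma grassmann_scaleR:
  assumes "f \<in> grassmann V d" "c \<ge> 0"
  shows "f (c *\<^sub>R u) = c * f u"
  using assms(1) unfolding grassmann_eq
proof (induction rule: linear_span_induct)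
  case (add b g h)
  have "max 0 (c * t) = c * max 0 t" for t :: real
    using assms(2) by (auto simp: max_def zero_le_mult_iff)
  then have "g (c *\<^sub>R u) = c * g u"
    using add(1) by (auto simp: zonoid_Z_def)
  then show ?case using add(3) by (simp add: algebra_simps)
qed simp

lemma centered_even:
  assumes "f \<in> centered_grassmann V d"
  shows "f (- u) = f u"
  using assms unfolding centered_grassmann_def
  by (induction rule: linear_span_induct) (auto simp: zonoid_K_def)

lemma grassmann_decomp:
  assumes "f \<in> grassmann V d"
  shows "\<exists>k\<in>centered_grassmann V d. \<exists>p\<in>ext_power V d. f = (\<lambda>u. k u + u \<bullet> p)"
  using assms unfolding grassmann_def
proof (induction rule: linear_span_induct)
  case zero
  show ?case
    by (rule bexI[of _ "\<lambda>_. 0"], rule bexI[of _ 0])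
      (auto simp: centered_grassmann_def linear_span_zero subspace_0 subspace_ext_power)
next
  case (add c g h)
  obtain \<mu> q where g: "\<mu> \<in> grassmann_laws V d" "q \<in> ext_power V d" "g = (\<lambda>u. zonoid_K \<mu> u + u \<bullet> q)"
    using add(1) by blast
  obtain k p where h: "k \<in> centered_grassmann V d" "p \<in> ext_power V d" "h = (\<lambda>u. k u + u \<bullet> p)"
    using add(3) by blast
  show ?case
  proof (rule bexI[of _ "\<lambda>u. c * zonoid_K \<mu> u + k u"], rule bexI[of _ "c *\<^sub>R q + p"])
    show "(\<lambda>u. c * g u + h u) = (\<lambda>u. c * zonoid_K \<mu> u + k u + u \<bullet> (c *\<^sub>R q + p))"
      by (simp add: g(3) h(3) algebra_simps inner_add_right)
    show "c *\<^sub>R q + p \<in> ext_power V d"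
      using g h by (intro subspace_add subspace_scale subspace_ext_power)
    show "(\<lambda>u. c * zonoid_K \<mu> u + k u) \<in> centered_grassmann V d"
      using g(1) h(1) unfolding centered_grassmann_def
      by (intro linear_span_add linear_span_scale) (auto intro: linear_span_base)
  qed
qed

text \<open>Comparing the values at \<open>w\<close> and \<open>- w\<close> isolates the linear
  part, which therefore vanishes on simple vectors, hence on their span, which contains
  \<open>p\<close>. This reconciles the null ideal, defined by centered zonoids, with vanishing of
  arbitrary Grassmann zonoids.\<close>

lemma vanishing_imp_centered:
  assumes "h \<in> grassmann V d" "\<And>w. w \<in> simple_vectors V d \<Longrightarrow> h w = 0"
  shows "h \<in> centered_grassmann V d"
proof -
  obtain k p where kp: "k \<in> centered_grassmann V d" "p \<in> ext_power V d" "h = (\<lambda>u. k u + u \<bullet> p)"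
    using grassmann_decomp[OF assms(1)] by blast
  have w: "w \<bullet> p = 0" if "w \<in> simple_vectors V d" for w
    using assms(2)[OF that] assms(2)[OF simple_vectors_minus[OF that]] centered_even[OF kp(1), of w]
    by (simp add: kp(3))
  have "x \<bullet> p = 0" if "x \<in> ext_power V d" for x
    using that by (induction rule: ext_power_induct) (auto simp: w inner_add_left)
  then have "p \<bullet> p = 0" using kp(2) by blast
  then show ?thesis using kp by simp
qed

end

text \<open>The second formula shows that the value depends on the representation of the left factor
  only through \<open>f\<close>, the third does the same for \<open>g\<close>. Together they make
  the definite description meaningful.\<close>

lemma zonoid_wedge_eq:
  fixes V :: "('m::{finite,linorder}) evec set"
  assumes f: "represents zonoid_Z (integrable_laws (ext_power V d)) f N a \<mu>"
    and g: "represents zonoid_Z (integrable_laws (ext_power V e)) g M b \<nu>"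
  shows "zonoid_wedge V d e f g u = (\<Sum>i<N. \<Sum>j<M. a i * b j * zonoid_Z (wedge_law (\<mu> i) (\<nu> j)) u)"
    and "zonoid_wedge V d e f g u = (\<Sum>j<M. b j * (\<integral>y. f (contr_right y u) \<partial>\<nu> j))"
    and "zonoid_wedge V d e f g u = (\<Sum>i<N. a i * (\<integral>x. g (contr x u) \<partial>\<mu> i))"
proof -
  have F: "(\<Sum>i<N. a i * zonoid_Z (wedge_law (\<mu> i) \<nu>) u) = (\<integral>y. f (contr_right y u) \<partial>\<nu>)"
    if "represents zonoid_Z (integrable_laws (ext_power V d)) f N a \<mu>" "\<nu> \<in> integrable_laws (ext_power V e)" for N a \<mu> \<nu>
  proof -
    have lin: "linear (\<lambda>y. contr_right y u)"
      by (simp add: linear_iff contr_right.add_left contr_right.scaleR_left)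
    have \<mu>: "\<mu> i \<in> integrable_laws (ext_power V d)" if "i < N" for i
      using that \<open>represents _ _ f N a \<mu>\<close> by (simp add: represents_def)
    have "(\<integral>y. f (contr_right y u) \<partial>\<nu>) = (\<integral>y. (\<Sum>i<N. a i * zonoid_Z (\<mu> i) (contr_right y u)) \<partial>\<nu>)"
      using that(1) by (simp add: represents_def)
    also have "\<dots> = (\<Sum>i<N. \<integral>y. a i * zonoid_Z (\<mu> i) (contr_right y u) \<partial>\<nu>)"
      by (intro Bochner_Integration.integral_sum integrable_mult_right
          tame_integrable[OF tame_compose[OF tame_zonoid_Z[OF \<mu>] lin] that(2)]) auto
    also have "\<dots> = (\<Sum>i<N. a i * zonoid_Z (wedge_law (\<mu> i) \<nu>) u)"
      using zonoid_Z_wedge_law(2)[OF \<mu> that(2)] by (intro sum.cong) auto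
    finally show ?thesis ..
  qed
  have G: "(\<Sum>j<M. b j * zonoid_Z (wedge_law \<mu> (\<nu> j)) u) = (\<integral>x. g (contr x u) \<partial>\<mu>)"
    if "represents zonoid_Z (integrable_laws (ext_power V e)) g M b \<nu>" "\<mu> \<in> integrable_laws (ext_power V d)" for M b \<nu> \<mu>
  proof -
    have lin: "linear (\<lambda>x. contr x u)"
      by (simp add: linear_iff contr.add_left contr.scaleR_left)
    have \<nu>: "\<nu> j \<in> integrable_laws (ext_power V e)" if "j < M" for j
      using that \<open>represents _ _ g M b \<nu>\<close> by (simp add: represents_def)
    have "(\<integral>x. g (contr x u) \<partial>\<mu>) = (\<integral>x. (\<Sum>j<M. b j * zonoid_Z (\<nu> j) (contr x u)) \<partial>\<mu>)"
      using that(1) by (simp add: represents_def)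
    also have "\<dots> = (\<Sum>j<M. \<integral>x. b j * zonoid_Z (\<nu> j) (contr x u) \<partial>\<mu>)"
      by (intro Bochner_Integration.integral_sum integrable_mult_right
          tame_integrable[OF tame_compose[OF tame_zonoid_Z[OF \<nu>] lin] that(2)]) auto
    also have "\<dots> = (\<Sum>j<M. b j * zonoid_Z (wedge_law \<mu> (\<nu> j)) u)"
      using zonoid_Z_wedge_law(1)[OF that(2) \<nu>] by (intro sum.cong) auto
    finally show ?thesis ..
  qed
  note * = bilinear_extension_eq[where \<beta> = "\<lambda>\<mu> \<nu>. zonoid_Z (wedge_law \<mu> \<nu>) u"
      and F = "\<lambda>\<nu>. \<integral>y. f (contr_right y u) \<partial>\<nu>" and G = "\<lambda>\<mu>. \<integral>x. g (contr x u) \<partial>\<mu>", OF F G f g]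
  show "zonoid_wedge V d e f g u = (\<Sum>i<N. \<Sum>j<M. a i * b j * zonoid_Z (wedge_law (\<mu> i) (\<nu> j)) u)"
    and "zonoid_wedge V d e f g u = (\<Sum>j<M. b j * (\<integral>y. f (contr_right y u) \<partial>\<nu> j))"
    and "zonoid_wedge V d e f g u = (\<Sum>i<N. a i * (\<integral>x. g (contr x u) \<partial>\<mu> i))"
    unfolding zonoid_wedge_def using * by simp_all
qed

lemma zonoid_K_pairing:
  fixes \<mu> \<nu> :: "'a::euclidean_space measure"
  assumes "\<mu> \<in> integrable_laws W" "\<nu> \<in> integrable_laws W'"
  shows "(\<integral>z. \<bar>fst z \<bullet> snd z\<bar> \<partial>(\<mu> \<Otimes>\<^sub>M \<nu>)) = (\<integral>y. 2 * zonoid_K \<mu> y \<partial>\<nu>)"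
    and "(\<integral>z. \<bar>fst z \<bullet> snd z\<bar> \<partial>(\<mu> \<Otimes>\<^sub>M \<nu>)) = (\<integral>x. 2 * zonoid_K \<nu> x \<partial>\<mu>)"
proof -
  have b: "\<bar>\<bar>x \<bullet> y\<bar>\<bar> \<le> 1 * norm x * norm y" for x y :: 'a
    using Cauchy_Schwarz_ineq2[of x y] by simp
  have m: "(\<lambda>p. \<bar>fst p \<bullet> snd p\<bar>) \<in> borel_measurable (borel \<Otimes>\<^sub>M (borel :: 'a measure))"
    by measurable
  show "(\<integral>z. \<bar>fst z \<bullet> snd z\<bar> \<partial>(\<mu> \<Otimes>\<^sub>M \<nu>)) = (\<integral>y. 2 * zonoid_K \<mu> y \<partial>\<nu>)"
    "(\<integral>z. \<bar>fst z \<bullet> snd z\<bar> \<partial>(\<mu> \<Otimes>\<^sub>M \<nu>)) = (\<integral>x. 2 * zonoid_K \<nu> x \<partial>\<mu>)"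
    using law_pair_integral[OF assms m b] by (simp_all add: zonoid_K_def inner_commute)
qed

lemma zonoid_pairing_eq:
  fixes V :: "('m::{finite,linorder}) evec set"
  assumes f: "represents zonoid_K (integrable_laws (ext_power V d)) f N a \<mu>"
    and g: "represents zonoid_K (integrable_laws (ext_power V d)) g M b \<nu>"
  shows "zonoid_pairing V d f g = (\<Sum>j<M. b j * (\<integral>y. 2 * f y \<partial>\<nu> j))"
proof -
  let ?\<beta> = "\<lambda>\<mu> \<nu> :: 'm ext measure. \<integral>z. \<bar>fst z \<bullet> snd z\<bar> \<partial>(\<mu> \<Otimes>\<^sub>M \<nu>)"

  have F: "(\<Sum>i<N. a i * ?\<beta> (\<mu> i) \<nu>) = (\<integral>y. 2 * f y \<partial>\<nu>)"
    if "represents zonoid_K (integrable_laws (ext_power V d)) f N a \<mu>" "\<nu> \<in> integrable_laws (ext_power V d)" for f N a \<mu> \<nu>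
  proof -
    have \<mu>: "\<mu> i \<in> integrable_laws (ext_power V d)" if "i < N" for i
      using that \<open>represents _ _ f N a \<mu>\<close> by (simp add: represents_def)
    have "(\<integral>y. 2 * f y \<partial>\<nu>) = (\<integral>y. (\<Sum>i<N. a i * (2 * zonoid_K (\<mu> i) y)) \<partial>\<nu>)"
      using that(1) by (simp add: represents_def sum_distrib_left mult_ac)
    also have "\<dots> = (\<Sum>i<N. \<integral>y. a i * (2 * zonoid_K (\<mu> i) y) \<partial>\<nu>)"
      by (intro Bochner_Integration.integral_sum integrable_mult_right
          tame_integrable[OF tame_zonoid_K[OF \<mu>] that(2)]) auto
    also have "\<dots> = (\<Sum>i<N. a i * ?\<beta> (\<mu> i) \<nu>)"
      using zonoid_K_pairing(1)[OF \<mu> that(2)] by (intro sum.cong) auto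
    finally show ?thesis ..
  qed
  \<comment> \<open>By symmetry of the form, independence of the representation for one argument
    yields it for the other.\<close>
  have "?\<beta> \<mu> \<nu> = ?\<beta> \<nu> \<mu>"
    if "\<mu> \<in> integrable_laws (ext_power V d)" "\<nu> \<in> integrable_laws (ext_power V d)" for \<mu> \<nu>
    using zonoid_K_pairing(1)[OF that] zonoid_K_pairing(2)[OF that(2,1)] by simp
  then have G: "(\<Sum>j<M. b j * ?\<beta> \<mu> (\<nu> j)) = (\<integral>x. 2 * g x \<partial>\<mu>)"
    if "represents zonoid_K (integrable_laws (ext_power V d)) g M b \<nu>" "\<mu> \<in> integrable_laws (ext_power V d)" for M b \<nu> \<mu>
    using F[OF that] that by (simp add: represents_def)
  show ?thesis
    unfolding zonoid_pairing_def
    by (rule bilinear_extension_eq(2)[where \<beta> = ?\<beta> and G = "\<lambda>\<mu>. \<integral>x. 2 * g x \<partial>\<mu>", OF F G f g])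
qed

context vector_subspace
begin

lemma wedge_law_grassmann:
  assumes "\<mu> \<in> grassmann_laws V d" "\<nu> \<in> grassmann_laws V e"
  shows "wedge_law \<mu> \<nu> \<in> grassmann_laws V (d + e)"
  using assms unfolding grassmann_laws_eq
  by (intro wedge_law_mem[OF _ _ law_AE law_AE simple_borel simple_borel simple_borel]
      simple_vectors_wedge)

lemma grassmann_wedge:
  assumes "f \<in> grassmann V d" "g \<in> grassmann V e"
  shows "zonoid_wedge V d e f g \<in> grassmann V (d + e)"
proof -
  obtain N a \<mu> where f: "represents zonoid_Z (grassmann_laws V d) f N a \<mu>"
    "represents zonoid_Z (integrable_laws (ext_power V d)) f N a \<mu>"
    using grassmann_represented[OF assms(1)] by blast
  obtain M b \<nu> where g: "represents zonoid_Z (grassmann_laws V e) g M b \<nu>"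
    "represents zonoid_Z (integrable_laws (ext_power V e)) g M b \<nu>"
    using grassmann_represented[OF assms(2)] by blast
  have "zonoid_wedge V d e f g = (\<lambda>u. \<Sum>i<N. \<Sum>j<M. (a i * b j) * zonoid_Z (wedge_law (\<mu> i) (\<nu> j)) u)"
    using zonoid_wedge_eq(1)[OF f(2) g(2)] by blast
  also have "\<dots> \<in> grassmann V (d + e)"
    using f(1) g(1) unfolding grassmann_eq represents_def
    by (intro linear_span_sum linear_span_scale)
      (auto intro!: linear_span_base wedge_law_grassmann)
  finally show ?thesis .
qed

text \<open>The factors are exchanged one at a time, each with the integral formula in which it is
  evaluated at a contraction of \<open>u\<close>. Those contractions are almost surely simple, since
  \<open>u\<close> is simple and the laws live on simple vectors.\<close>

lemma zonoid_wedge_cong_simple: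
  assumes "f \<in> grassmann V d" "f' \<in> grassmann V d" "g \<in> grassmann V e" "g' \<in> grassmann V e"
    and ff: "\<And>w. w \<in> simple_vectors V d \<Longrightarrow> f w = f' w"
    and gg: "\<And>w. w \<in> simple_vectors V e \<Longrightarrow> g w = g' w"
    and u: "u \<in> simple_vectors V (d + e)"
  shows "zonoid_wedge V d e f g u = zonoid_wedge V d e f' g' u"
proof -
  obtain N a \<mu> where f: "represents zonoid_Z (grassmann_laws V d) f' N a \<mu>"
    "represents zonoid_Z (integrable_laws (ext_power V d)) f' N a \<mu>"
    using grassmann_represented[OF assms(2)] by blast
  obtain N0 a0 \<mu>0 where f0: "represents zonoid_Z (integrable_laws (ext_power V d)) f N0 a0 \<mu>0"
    using grassmann_represented[OF assms(1)] by blast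
  obtain M b \<nu> where g: "represents zonoid_Z (grassmann_laws V e) g M b \<nu>"
    "represents zonoid_Z (integrable_laws (ext_power V e)) g M b \<nu>"
    using grassmann_represented[OF assms(3)] by blast
  obtain M0 b0 \<nu>0 where g0: "represents zonoid_Z (integrable_laws (ext_power V e)) g' M0 b0 \<nu>0"
    using grassmann_represented[OF assms(4)] by blast
  have meas: "(\<lambda>y. h (T y)) \<in> borel_measurable \<kappa>"
    if "h \<in> grassmann V k" "linear T" "\<kappa> \<in> integrable_laws W" for h k T \<kappa> and W :: "'m ext set"
    using tame_measurable[OF tame_compose[OF grassmann_tame[OF that(1)] that(2)]] law_measurable[OF that(3)]
    by blast
  have lr: "linear (\<lambda>y. contr_right y u)" and ll: "linear (\<lambda>x. contr x u)"
    by (simp_all add: linear_iff contr_right.add_left contr_right.scaleR_left contr.add_left contr.scaleR_left)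
  have "zonoid_wedge V d e f g u = (\<Sum>j<M. b j * (\<integral>y. f (contr_right y u) \<partial>\<nu> j))"
    by (rule zonoid_wedge_eq(2)[OF f0 g(2)])
  also have "\<dots> = (\<Sum>j<M. b j * (\<integral>y. f' (contr_right y u) \<partial>\<nu> j))"
  proof (intro sum.cong refl)
    fix j assume "j \<in> {..<M}"
    then have \<nu>: "\<nu> j \<in> integrable_laws (simple_vectors V e)"
      using g(1) by (auto simp: represents_def grassmann_laws_eq)
    have "(\<integral>y. f (contr_right y u) \<partial>\<nu> j) = (\<integral>y. f' (contr_right y u) \<partial>\<nu> j)"
    proof (rule integral_cong_AE)
      show "AE y in \<nu> j. f (contr_right y u) = f' (contr_right y u)"
        using law_AE[OF \<nu>] by eventually_elim (intro ff contr_right_simple[OF subspace_V _ u])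
    qed (rule meas[OF assms(1) lr \<nu>] meas[OF assms(2) lr \<nu>])+
    then show "b j * (\<integral>y. f (contr_right y u) \<partial>\<nu> j) = b j * (\<integral>y. f' (contr_right y u) \<partial>\<nu> j)"
      by simp
  qed
  also have "\<dots> = zonoid_wedge V d e f' g u"
    by (rule zonoid_wedge_eq(2)[OF f(2) g(2), symmetric])
  also have "\<dots> = (\<Sum>i<N. a i * (\<integral>x. g (contr x u) \<partial>\<mu> i))"
    by (rule zonoid_wedge_eq(3)[OF f(2) g(2)])
  also have "\<dots> = (\<Sum>i<N. a i * (\<integral>x. g' (contr x u) \<partial>\<mu> i))"
  proof (intro sum.cong refl)
    fix i assume "i \<in> {..<N}"
    then have \<mu>: "\<mu> i \<in> integrable_laws (simple_vectors V d)"
      using f(1) by (auto simp: represents_def grassmann_laws_eq)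
    have "(\<integral>x. g (contr x u) \<partial>\<mu> i) = (\<integral>x. g' (contr x u) \<partial>\<mu> i)"
    proof (rule integral_cong_AE)
      show "AE x in \<mu> i. g (contr x u) = g' (contr x u)"
        using law_AE[OF \<mu>] by eventually_elim (intro gg contr_simple[OF subspace_V _ u])
    qed (rule meas[OF assms(3) ll \<mu>] meas[OF assms(4) ll \<mu>])+
    then show "a i * (\<integral>x. g (contr x u) \<partial>\<mu> i) = a i * (\<integral>x. g' (contr x u) \<partial>\<mu> i)"
      by simp
  qed
  also have "\<dots> = zonoid_wedge V d e f' g' u"
    by (rule zonoid_wedge_eq(3)[OF f(2) g0, symmetric])
  finally show ?thesis .
qed

text \<open>Pairing with the segments spanned by simple vectors shows that the null elements are those
  which vanish on all simple vectors; the odd part of a Grassmann zonoid is detected there too.\<close>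

lemma null_ideal_eq:
  "null_ideal V = {x. \<forall>d. x d \<in> grassmann V d \<and> (\<forall>w\<in>simple_vectors V d. x d w = 0)}"
proof (intro subset_antisym subsetI)
  fix x assume x: "x \<in> null_ideal V"
  have "x d w = 0" if w: "w \<in> simple_vectors V d" for d w
  proof -
    have xd: "x d \<in> centered_grassmann V d" using x by (simp add: null_ideal_def)
    then obtain N a \<mu> where "represents zonoid_K (grassmann_laws V d) (x d) N a \<mu>"
      unfolding centered_grassmann_def by (rule representsE)
    then have r: "represents zonoid_K (integrable_laws (ext_power V d)) (x d) N a \<mu>"
      using represents_mono grassmann_laws_subset by blast
    have w': "return borel w \<in> grassmann_laws V d"
      using w by (simp add: grassmann_laws_eq return_law)
    then have "represents zonoid_K (integrable_laws (ext_power V d)) (zonoid_K (return borel w)) 1 (\<lambda>_. 1) (\<lambda>_. return borel w)"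
      using grassmann_laws_subset by (intro represents_single) blast
    then have "zonoid_pairing V d (x d) (zonoid_K (return borel w)) = (\<integral>y. 2 * x d y \<partial>return borel w)"
      using zonoid_pairing_eq[OF r] by simp
    also have "\<dots> = 2 * x d w"
    proof -
      have "x d \<in> borel_measurable borel"
        using tame_measurable[OF grassmann_tame] xd centered_subset_grassmann by blast
      then show ?thesis by (subst integral_return) auto
    qed
    finally have "zonoid_pairing V d (x d) (zonoid_K (return borel w)) = 2 * x d w" .
    moreover have "zonoid_K (return borel w) \<in> centered_grassmann V d"
      using w' by (auto simp: centered_grassmann_def intro: linear_span_base)
    ultimately show ?thesis
      using x by (simp add: null_ideal_def)
  qed
  then show "x \<in> {x. \<forall>d. x d \<in> grassmann V d \<and> (\<forall>w\<in>simple_vectors V d. x d w = 0)}"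
    using x subsetD[OF centered_subset_grassmann] by (auto simp: null_ideal_def)
next
  fix x assume x: "x \<in> {x. \<forall>d. x d \<in> grassmann V d \<and> (\<forall>w\<in>simple_vectors V d. x d w = 0)}"
  then have c: "x d \<in> centered_grassmann V d" for d
    by (intro vanishing_imp_centered) auto
  have "zonoid_pairing V d (x d) L = 0" if L: "L \<in> centered_grassmann V d" for d L
  proof -
    obtain N a \<mu> where "represents zonoid_K (grassmann_laws V d) (x d) N a \<mu>"
      using c unfolding centered_grassmann_def by (rule representsE)
    then have r: "represents zonoid_K (integrable_laws (ext_power V d)) (x d) N a \<mu>"
      using represents_mono grassmann_laws_subset by blast
    obtain M b \<nu> where s: "represents zonoid_K (grassmann_laws V d) L M b \<nu>"
      using L unfolding centered_grassmann_def by (rule representsE)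
    then have s': "represents zonoid_K (integrable_laws (ext_power V d)) L M b \<nu>"
      using represents_mono grassmann_laws_subset by blast
    have "(\<integral>y. 2 * x d y \<partial>\<nu> j) = 0" if "j < M" for j
    proof -
      have "\<nu> j \<in> integrable_laws (simple_vectors V d)"
        using s that by (auto simp: represents_def grassmann_laws_eq)
      from law_AE[OF this] have "AE y in \<nu> j. 2 * x d y = 0"
        by eventually_elim (use x in auto)
      then show ?thesis by (rule integral_eq_zero_AE)
    qed
    then show ?thesis
      unfolding zonoid_pairing_eq[OF r s'] by simp
  qed
  then show "x \<in> null_ideal V"
    using c by (auto simp: null_ideal_def)
qed

end

subsection \<open>The quotient ring\<close>

lemma in_degree_same [simp]: "in_degree d f d = f"
  and in_degree_other: "e \<noteq> d \<Longrightarrow> in_degree d f e = (\<lambda>_. 0)"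
  by (simp_all add: in_degree_def)

context vector_subspace
begin

abbreviation "R \<equiv> grassmann_ring V"

text \<open>For members of \<open>carrier R\<close> this is congruence modulo the null ideal.
  Working with it keeps cosets out of all later computations.\<close>

definition agree :: "(nat \<Rightarrow> 'm ext \<Rightarrow> real) \<Rightarrow> (nat \<Rightarrow> 'm ext \<Rightarrow> real) \<Rightarrow> bool" where
  "agree x y \<longleftrightarrow> (\<forall>d. \<forall>w\<in>simple_vectors V d. x d w = y d w)"

lemma agreeI: "(\<And>d w. w \<in> simple_vectors V d \<Longrightarrow> x d w = y d w) \<Longrightarrow> agree x y"
  and agreeD: "agree x y \<Longrightarrow> w \<in> simple_vectors V d \<Longrightarrow> x d w = y d w"
  by (simp_all add: agree_def)

lemma agree_refl: "agree x x"
  by (simp add: agree_def)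

lemma R_carrier: "x \<in> carrier R \<longleftrightarrow> (\<forall>d. x d \<in> grassmann V d)"
  by (simp add: grassmann_ring_def)

lemma R_mult: "(x \<otimes>\<^bsub>R\<^esub> y) d = (\<lambda>u. \<Sum>i\<le>d. zonoid_wedge V i (d - i) (x i) (y (d - i)) u)"
  by (simp add: grassmann_ring_def)

lemma R_add: "x \<oplus>\<^bsub>R\<^esub> y = (\<lambda>d u. x d u + y d u)"
  and R_one: "\<one>\<^bsub>R\<^esub> = in_degree 0 (zonoid_Z (return borel (axis {} 1)))"
  by (simp_all add: grassmann_ring_def)

lemma R_mult_closed:
  assumes "x \<in> carrier R" "y \<in> carrier R"
  shows "x \<otimes>\<^bsub>R\<^esub> y \<in> carrier R"
  unfolding R_carrier R_mult
proof
  fix d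
  have "zonoid_wedge V i (d - i) (x i) (y (d - i)) \<in> grassmann V d" if "i \<le> d" for i
    using grassmann_wedge[of "x i" i "y (d - i)" "d - i"] assms that by (simp add: R_carrier)
  then show "(\<lambda>u. \<Sum>i\<le>d. zonoid_wedge V i (d - i) (x i) (y (d - i)) u) \<in> grassmann V d"
    unfolding grassmann_def by (intro linear_span_sum) auto
qed

lemma R_add_closed: "x \<in> carrier R \<Longrightarrow> y \<in> carrier R \<Longrightarrow> x \<oplus>\<^bsub>R\<^esub> y \<in> carrier R"
  by (simp add: R_carrier R_add grassmann_add)

lemma R_scale_closed: "x \<in> carrier R \<Longrightarrow> (\<lambda>d u. c * x d u) \<in> carrier R"
  by (simp add: R_carrier grassmann_scale)

lemma R_zero_closed: "(\<lambda>d u. 0) \<in> carrier R"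
  by (simp add: R_carrier grassmann_zero)

lemma in_degree_closed: "f \<in> grassmann V d \<Longrightarrow> in_degree d f \<in> carrier R"
  by (simp add: R_carrier in_degree_def grassmann_zero)

lemma one_grassmann: "zonoid_Z (return borel (axis {} 1)) \<in> grassmann V 0"
proof (rule grassmann_Z)
  have "axis {} 1 \<in> simple_vectors V 0"
    using simple_vectorsI[of "[]" 0 V 1] by simp
  then show "return borel (axis {} 1) \<in> grassmann_laws V 0"
    by (simp add: grassmann_laws_eq return_law)
qed

lemma R_one_closed: "\<one>\<^bsub>R\<^esub> \<in> carrier R"
  unfolding R_one by (intro in_degree_closed one_grassmann)

lemma R_mult_agree:
  assumes "x \<in> carrier R" "x' \<in> carrier R" "y \<in> carrier R" "y' \<in> carrier R" "agree x x'" "agree y y'"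
  shows "agree (x \<otimes>\<^bsub>R\<^esub> y) (x' \<otimes>\<^bsub>R\<^esub> y')"
proof (rule agreeI)
  fix d w assume w: "w \<in> simple_vectors V d"
  show "(x \<otimes>\<^bsub>R\<^esub> y) d w = (x' \<otimes>\<^bsub>R\<^esub> y') d w"
    unfolding R_mult
    using assms w by (intro sum.cong refl zonoid_wedge_cong_simple) (auto simp: R_carrier agree_def)
qed

lemma Q_class_eq: "x \<in> carrier R \<Longrightarrow> Q_class V x = {z \<in> carrier R. agree z x}"
proof (intro subset_antisym subsetI)
  fix z assume x: "x \<in> carrier R" and "z \<in> Q_class V x"
  then obtain h where "h \<in> null_ideal V" "z = h \<oplus>\<^bsub>R\<^esub> x"
    unfolding Q_class_def a_r_coset_def' by blast
  then show "z \<in> {z \<in> carrier R. agree z x}"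
    using x by (simp add: null_ideal_eq R_carrier R_add grassmann_add agree_def)
next
  fix z assume x: "x \<in> carrier R" and z: "z \<in> {z \<in> carrier R. agree z x}"
  have "(\<lambda>d u. z d u - x d u) \<in> null_ideal V"
    using x z by (simp add: null_ideal_eq R_carrier grassmann_diff agree_def)
  moreover have "z = (\<lambda>d u. z d u - x d u) \<oplus>\<^bsub>R\<^esub> x"
    by (simp add: R_add)
  ultimately show "z \<in> Q_class V x"
    unfolding Q_class_def a_r_coset_def' by blast
qed

lemma Q_class_self: "x \<in> carrier R \<Longrightarrow> x \<in> Q_class V x"
  by (simp add: Q_class_eq agree_refl)

lemma Q_class_eq_iff:
  assumes "x \<in> carrier R" "y \<in> carrier R"
  shows "Q_class V x = Q_class V y \<longleftrightarrow> agree x y"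
proof
  assume "Q_class V x = Q_class V y"
  then have "x \<in> Q_class V y"
    using Q_class_self[OF assms(1)] by simp
  then show "agree x y"
    by (simp add: Q_class_eq[OF assms(2)])
next
  assume "agree x y"
  then have "agree z x \<longleftrightarrow> agree z y" for z
    by (simp add: agree_def)
  then show "Q_class V x = Q_class V y"
    by (simp add: Q_class_eq assms)
qed

lemma Q_carrier: "carrier (Q_ring V) = Q_class V ` carrier R"
  unfolding Q_ring_def FactRing_def A_RCOSETS_def' Q_class_def by auto

lemma Q_one: "\<one>\<^bsub>Q_ring V\<^esub> = Q_class V \<one>\<^bsub>R\<^esub>"
  by (simp add: Q_ring_def FactRing_def Q_class_def)

lemma Q_zero: "\<zero>\<^bsub>Q_ring V\<^esub> = Q_class V (\<lambda>d u. 0)"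
  using Q_class_eq[OF R_zero_closed]
  by (auto simp: Q_ring_def FactRing_def null_ideal_eq agree_def R_carrier)

text \<open>The quotient multiplies cosets by uniting the cosets of all products of representatives.
  By \<open>R_mult_agree\<close> these all coincide, and the union is nonempty, so it is that one
  coset.\<close>

lemma Q_mult:
  assumes "x \<in> carrier R" "y \<in> carrier R"
  shows "Q_class V x \<otimes>\<^bsub>Q_ring V\<^esub> Q_class V y = Q_class V (x \<otimes>\<^bsub>R\<^esub> y)"
proof -
  have "Q_class V (a \<otimes>\<^bsub>R\<^esub> b) = Q_class V (x \<otimes>\<^bsub>R\<^esub> y)" if "a \<in> Q_class V x" "b \<in> Q_class V y" for a b
    using that assms by (subst Q_class_eq_iff) (auto simp: Q_class_eq intro: R_mult_closed R_mult_agree)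
  moreover have "Q_class V x \<otimes>\<^bsub>Q_ring V\<^esub> Q_class V y = (\<Union>a\<in>Q_class V x. \<Union>b\<in>Q_class V y. Q_class V (a \<otimes>\<^bsub>R\<^esub> b))"
    by (simp add: Q_ring_def FactRing_def rcoset_mult_def Q_class_def)
  moreover have "(\<Union>a\<in>A. \<Union>b\<in>B. F a b) = C"
    if "\<And>a b. a \<in> A \<Longrightarrow> b \<in> B \<Longrightarrow> F a b = C" "x \<in> A" "y \<in> B"
    for A B F and C :: "(nat \<Rightarrow> 'm ext \<Rightarrow> real) set"
    using that by blast
  from this[OF _ Q_class_self[OF assms(1)] Q_class_self[OF assms(2)]]
  have "(\<Union>a\<in>Q_class V x. \<Union>b\<in>Q_class V y. Q_class V (a \<otimes>\<^bsub>R\<^esub> b)) = Q_class V (x \<otimes>\<^bsub>R\<^esub> y)"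
    if "\<And>a b. a \<in> Q_class V x \<Longrightarrow> b \<in> Q_class V y \<Longrightarrow> Q_class V (a \<otimes>\<^bsub>R\<^esub> b) = Q_class V (x \<otimes>\<^bsub>R\<^esub> y)"
    using that .
  ultimately show ?thesis by (simp only:)
qed

lemma Q_add:
  assumes "x \<in> carrier R" "y \<in> carrier R"
  shows "Q_class V x \<oplus>\<^bsub>Q_ring V\<^esub> Q_class V y = Q_class V (x \<oplus>\<^bsub>R\<^esub> y)"
proof -
  have "Q_class V x \<oplus>\<^bsub>Q_ring V\<^esub> Q_class V y = (\<Union>a\<in>Q_class V x. \<Union>b\<in>Q_class V y. {a \<oplus>\<^bsub>R\<^esub> b})"
    by (simp add: Q_ring_def FactRing_def set_add_def')
  also have "\<dots> = Q_class V (x \<oplus>\<^bsub>R\<^esub> y)"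
  proof (intro subset_antisym subsetI)
    fix z assume "z \<in> (\<Union>a\<in>Q_class V x. \<Union>b\<in>Q_class V y. {a \<oplus>\<^bsub>R\<^esub> b})"
    then show "z \<in> Q_class V (x \<oplus>\<^bsub>R\<^esub> y)"
      using assms by (auto simp: Q_class_eq R_add_closed) (simp add: agree_def R_add)
  next
    fix z assume z: "z \<in> Q_class V (x \<oplus>\<^bsub>R\<^esub> y)"
    have "z \<in> carrier R" "agree z (x \<oplus>\<^bsub>R\<^esub> y)"
      using z Q_class_eq[OF R_add_closed[OF assms]] by simp_all
    then have "(\<lambda>d u. z d u - y d u) \<in> Q_class V x"
      using assms(2) by (simp add: Q_class_eq[OF assms(1)] agree_def R_add R_carrier grassmann_diff)
    moreover have "z = (\<lambda>d u. z d u - y d u) \<oplus>\<^bsub>R\<^esub> y"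
      by (simp add: R_add)
    ultimately show "z \<in> (\<Union>a\<in>Q_class V x. \<Union>b\<in>Q_class V y. {a \<oplus>\<^bsub>R\<^esub> b})"
      using Q_class_self[OF assms(2)] by blast
  qed
  finally show ?thesis .
qed

lemma Q_scale_class:
  assumes "x \<in> carrier R"
  shows "Q_scale V c (Q_class V x) = Q_class V (\<lambda>d u. c * x d u)"
proof -
  have "Q_class V (\<lambda>d u. c * a d u) = Q_class V (\<lambda>d u. c * x d u)" if "a \<in> Q_class V x" for a
    using that assms by (subst Q_class_eq_iff) (auto simp: Q_class_eq R_scale_closed agree_def)
  then show ?thesis
    using Q_class_self[OF assms] unfolding Q_scale_def by blast
qed

lemma R_pow_closed: "x \<in> carrier R \<Longrightarrow> x [^]\<^bsub>R\<^esub> (k::nat) \<in> carrier R"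
  by (induction k) (simp_all add: nat_pow_def R_one_closed R_mult_closed)

lemma Q_pow:
  assumes "x \<in> carrier R"
  shows "Q_class V x [^]\<^bsub>Q_ring V\<^esub> (k::nat) = Q_class V (x [^]\<^bsub>R\<^esub> k)"
proof (induction k)
  case (Suc k)
  then show ?case
    using Q_mult[OF R_pow_closed[OF assms, of k] assms] by (simp add: nat_pow_def)
qed (simp add: nat_pow_def Q_one)

lemma zonoid_wedge_zero_left:
  assumes "g \<in> grassmann V e"
  shows "zonoid_wedge V d e (\<lambda>_. 0) g u = 0"
proof -
  obtain M b \<nu> where g: "represents zonoid_Z (integrable_laws (ext_power V e)) g M b \<nu>"
    using grassmann_represented[OF assms] by blast
  have "represents zonoid_Z (integrable_laws (ext_power V d)) (\<lambda>_. 0) 0 (\<lambda>_. 0) (\<lambda>_. undefined)"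
    by (simp add: represents_def)
  from zonoid_wedge_eq(1)[OF this g] show ?thesis by simp
qed

lemma zonoid_wedge_zero_right:
  assumes "f \<in> grassmann V d"
  shows "zonoid_wedge V d e f (\<lambda>_. 0) u = 0"
proof -
  obtain N a \<mu> where f: "represents zonoid_Z (integrable_laws (ext_power V d)) f N a \<mu>"
    using grassmann_represented[OF assms] by blast
  have "represents zonoid_Z (integrable_laws (ext_power V e)) (\<lambda>_. 0) 0 (\<lambda>_. 0) (\<lambda>_. undefined)"
    by (simp add: represents_def)
  from zonoid_wedge_eq(1)[OF f this] show ?thesis by simp
qed

lemma in_degree_mult:
  assumes "f \<in> grassmann V d" "g \<in> grassmann V e"
  shows "in_degree d f \<otimes>\<^bsub>R\<^esub> in_degree e g = in_degree (d + e) (zonoid_wedge V d e f g)"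
proof (intro ext)
  fix k u
  have zero: "zonoid_wedge V i (k - i) (in_degree d f i) (in_degree e g (k - i)) u = 0"
    if "\<not> (i = d \<and> k - i = e)" for i
  proof (cases "i = d")
    case True
    then show ?thesis
      using that zonoid_wedge_zero_right[OF assms(1)] by (simp add: in_degree_other)
  next
    case False
    have "in_degree e g (k - i) \<in> grassmann V (k - i)"
      using in_degree_closed[OF assms(2)] by (simp add: R_carrier)
    then show ?thesis
      using False zonoid_wedge_zero_left by (simp add: in_degree_other)
  qed
  show "(in_degree d f \<otimes>\<^bsub>R\<^esub> in_degree e g) k u = in_degree (d + e) (zonoid_wedge V d e f g) k u"
  proof (cases "k = d + e")
    case True
    have "(\<Sum>i\<le>k. zonoid_wedge V i (k - i) (in_degree d f i) (in_degree e g (k - i)) u) =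
        (\<Sum>i\<in>{d}. zonoid_wedge V i (k - i) (in_degree d f i) (in_degree e g (k - i)) u)"
      using True zero by (intro sum.mono_neutral_right) auto
    then show ?thesis
      using True by (simp add: R_mult)
  next
    case False
    have "(\<Sum>i\<le>k. zonoid_wedge V i (k - i) (in_degree d f i) (in_degree e g (k - i)) u) = 0"
      using False by (intro sum.neutral ballI zero) auto
    then show ?thesis
      using False by (simp add: R_mult in_degree_other)
  qed
qed

lemma in_degree_agree:
  assumes "\<And>w. w \<in> simple_vectors V d \<Longrightarrow> f w = g w"
  shows "agree (in_degree d f) (in_degree d g)"
  using assms by (auto simp: agree_def in_degree_def)

subsection \<open>Symmetries\<close>

text \<open>The action on zonoid functions composes with the transpose, so that the transpose, which
  is the inverse, has to preserve \<open>V\<close> as well.\<close>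

definition symmetry :: "'m emat \<Rightarrow> bool" where
  "symmetry g \<longleftrightarrow> orthogonal_matrix g \<and> (\<forall>v\<in>V. g *v v \<in> V) \<and> (\<forall>v\<in>V. transpose g *v v \<in> V)"

lemma symmetry_transpose: "symmetry g \<Longrightarrow> symmetry (transpose g)"
  by (simp add: symmetry_def)

lemma symmetry_simple: "symmetry g \<Longrightarrow> w \<in> simple_vectors V d \<Longrightarrow> ext_map g w \<in> simple_vectors V d"
  using ext_map_simple_vectors[of w V d g V] by (simp add: symmetry_def)

lemma act_law:
  assumes "symmetry g" "\<mu> \<in> grassmann_laws V d"
  shows "distr \<mu> borel (ext_map g) \<in> grassmann_laws V d"
  using assms unfolding grassmann_laws_eq
  by (intro distr_law) (auto simp: linear_ext_map simple_borel symmetry_simple)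

lemma act_Z:
  "\<mu> \<in> integrable_laws W \<Longrightarrow> zonoid_Z (distr \<mu> borel (ext_map g)) u = zonoid_Z \<mu> (ext_map (transpose g) u)"
  by (rule zonoid_Z_distr) (auto simp: linear_ext_map ext_map_transpose_inner)

lemma act_represented:
  assumes "symmetry g" "represents zonoid_Z (grassmann_laws V d) f N a \<mu>"
  shows "represents zonoid_Z (grassmann_laws V d) (\<lambda>u. f (ext_map (transpose g) u)) N a
    (\<lambda>i. distr (\<mu> i) borel (ext_map g))"
proof -
  have "\<mu> i \<in> integrable_laws (ext_power V d)" if "i < N" for i
    using assms(2) that grassmann_laws_subset by (auto simp: represents_def)
  then have "zonoid_Z (distr (\<mu> i) borel (ext_map g)) u = zonoid_Z (\<mu> i) (ext_map (transpose g) u)"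
    if "i < N" for i u
    using that by (intro act_Z) blast
  then show ?thesis
    using assms(2) act_law[OF assms(1)] by (simp add: represents_def)
qed

lemma act_grassmann:
  assumes "symmetry g" "f \<in> grassmann V d"
  shows "(\<lambda>u. f (ext_map (transpose g) u)) \<in> grassmann V d"
proof -
  obtain N a \<mu> where "represents zonoid_Z (grassmann_laws V d) f N a \<mu>"
    using grassmann_represented[OF assms(2)] by blast
  from act_represented[OF assms(1) this] show ?thesis
    unfolding grassmann_eq by (rule represents_linear_span)
qed

text \<open>By \<open>contr_ext_map\<close>, contraction by a transported vector followed by the
  transposed map is contraction by the original vector after the transposed map. Hence the zonoid of
  the wedge of two transported laws is the transported zonoid of their wedge.\<close>

lemma act_wedge:
  assumes g: "symmetry g" and "f \<in> grassmann V d" "h \<in> grassmann V e"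
  shows "zonoid_wedge V d e (\<lambda>u. f (ext_map (transpose g) u)) (\<lambda>u. h (ext_map (transpose g) u)) u =
    zonoid_wedge V d e f h (ext_map (transpose g) u)"
proof -
  obtain N a \<mu> where f: "represents zonoid_Z (grassmann_laws V d) f N a \<mu>"
    "represents zonoid_Z (integrable_laws (ext_power V d)) f N a \<mu>"
    using grassmann_represented[OF assms(2)] by blast
  obtain M b \<nu> where h: "represents zonoid_Z (grassmann_laws V e) h M b \<nu>"
    "represents zonoid_Z (integrable_laws (ext_power V e)) h M b \<nu>"
    using grassmann_represented[OF assms(3)] by blast
  have "zonoid_Z (wedge_law (distr (\<mu> i) borel (ext_map g)) (distr (\<nu> j) borel (ext_map g))) u =
      zonoid_Z (wedge_law (\<mu> i) (\<nu> j)) (ext_map (transpose g) u)" if "i < N" "j < M" for i j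
  proof -
    have \<mu>: "\<mu> i \<in> grassmann_laws V d" and \<nu>: "\<nu> j \<in> grassmann_laws V e"
      using f h that by (auto simp: represents_def)
    note \<mu>' = subsetD[OF grassmann_laws_subset \<mu>] and \<nu>' = subsetD[OF grassmann_laws_subset \<nu>]
    note \<mu>g = subsetD[OF grassmann_laws_subset act_law[OF g \<mu>]]
      and \<nu>g = subsetD[OF grassmann_laws_subset act_law[OF g \<nu>]]
    have [measurable]: "ext_map g \<in> borel_measurable borel"
      by (intro borel_measurable_continuous_onI linear_continuous_on)
        (simp add: linear_conv_bounded_linear[symmetric] linear_ext_map)
    have [measurable]: "ext_map g \<in> borel_measurable (\<mu> i)"
      by (simp add: law_measurable[OF \<mu>'])
    have [measurable]: "(\<lambda>x. zonoid_Z (distr (\<nu> j) borel (ext_map g)) (contr x u)) \<in> borel_measurable borel"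
      by (intro tame_measurable tame_compose[OF tame_zonoid_Z[OF \<nu>g]])
        (simp add: linear_iff contr.add_left contr.scaleR_left)
    have "zonoid_Z (wedge_law (distr (\<mu> i) borel (ext_map g)) (distr (\<nu> j) borel (ext_map g))) u =
        (\<integral>x. zonoid_Z (distr (\<nu> j) borel (ext_map g)) (contr x u) \<partial>distr (\<mu> i) borel (ext_map g))"
      by (rule zonoid_Z_wedge_law(1)[OF \<mu>g \<nu>g])
    also have "\<dots> = (\<integral>x. zonoid_Z (distr (\<nu> j) borel (ext_map g)) (contr (ext_map g x) u) \<partial>\<mu> i)"
      by (rule integral_distr) measurable
    also have "\<dots> = (\<integral>x. zonoid_Z (\<nu> j) (contr x (ext_map (transpose g) u)) \<partial>\<mu> i)"
      by (simp add: act_Z[OF \<nu>'] contr_ext_map)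
    also have "\<dots> = zonoid_Z (wedge_law (\<mu> i) (\<nu> j)) (ext_map (transpose g) u)"
      by (rule zonoid_Z_wedge_law(1)[OF \<mu>' \<nu>', symmetric])
    finally show ?thesis .
  qed
  then show ?thesis
    unfolding zonoid_wedge_eq(1)[OF f(2) h(2)]
      zonoid_wedge_eq(1)[OF represents_mono[OF act_represented[OF g f(1)] grassmann_laws_subset]
        represents_mono[OF act_represented[OF g h(1)] grassmann_laws_subset]]
    by (intro sum.cong) auto
qed

lemma act_closed: "symmetry g \<Longrightarrow> x \<in> carrier R \<Longrightarrow> zonoid_act g x \<in> carrier R"
  by (simp add: R_carrier zonoid_act_def act_grassmann)

lemma act_agree: "symmetry g \<Longrightarrow> agree x y \<Longrightarrow> agree (zonoid_act g x) (zonoid_act g y)"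
  using symmetry_simple[OF symmetry_transpose] by (simp add: agree_def zonoid_act_def)

lemma act_mult:
  assumes "symmetry g" "x \<in> carrier R" "y \<in> carrier R"
  shows "zonoid_act g (x \<otimes>\<^bsub>R\<^esub> y) = zonoid_act g x \<otimes>\<^bsub>R\<^esub> zonoid_act g y"
  using assms(2,3) act_wedge[OF assms(1)]
  by (intro ext) (auto simp: zonoid_act_def R_mult R_carrier intro!: sum.cong)

lemma act_transpose:
  assumes "symmetry g"
  shows "zonoid_act g (zonoid_act (transpose g) x) = x"
  using assms
  by (simp add: zonoid_act_def symmetry_def orthogonal_matrix_def flip: ext_map_mult)

lemma act_Q_class:
  assumes "symmetry g" "x \<in> carrier R"
  shows "zonoid_act g ` Q_class V x = Q_class V (zonoid_act g x)"
proof (intro subset_antisym subsetI)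
  fix z assume "z \<in> zonoid_act g ` Q_class V x"
  then show "z \<in> Q_class V (zonoid_act g x)"
    using assms by (auto simp: Q_class_eq act_closed act_agree)
next
  fix z assume "z \<in> Q_class V (zonoid_act g x)"
  then have z: "z \<in> carrier R" "agree z (zonoid_act g x)"
    using assms by (auto simp: Q_class_eq act_closed)
  have g': "symmetry (transpose g)" by (rule symmetry_transpose[OF assms(1)])
  have "agree (zonoid_act (transpose g) z) (zonoid_act (transpose g) (zonoid_act g x))"
    by (rule act_agree[OF g' z(2)])
  then have "agree (zonoid_act (transpose g) z) x"
    using act_transpose[OF g'] by simp
  then have "zonoid_act (transpose g) z \<in> Q_class V x"
    using assms act_closed[OF g' z(1)] by (simp add: Q_class_eq)
  then show "z \<in> zonoid_act g ` Q_class V x"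
    using act_transpose[OF assms(1), of z] by (metis image_eqI)
qed

lemma act_Q_class_fixed:
  assumes "symmetry g" "x \<in> carrier R"
  shows "zonoid_act g ` Q_class V x = Q_class V x \<longleftrightarrow> agree (zonoid_act g x) x"
  using assms by (simp add: act_Q_class Q_class_eq_iff act_closed)

end

section \<open>Generated subalgebras and products with centered zonoids\<close>

lemma generated_subalgebra_mono:
  assumes "x \<in> generated_subalgebra R sc S" "S \<subseteq> T"
  shows "x \<in> generated_subalgebra R sc T"
  using assms(1) by induction (use assms(2) in \<open>auto intro: generated_subalgebra.intros\<close>)

lemma generated_subalgebra_pow:
  "x \<in> generated_subalgebra R sc S \<Longrightarrow> x [^]\<^bsub>R\<^esub> (k::nat) \<in> generated_subalgebra R sc S"
  by (induction k) (auto simp: nat_pow_def intro: generated_subalgebra.intros)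

context vector_subspace
begin

lemma grassmann_at_zero: "f \<in> grassmann V d \<Longrightarrow> f 0 = 0"
  using grassmann_scaleR[of f d 0 0] by simp

text \<open>A centered zonoid is the average of the \<open>zonoid_Z\<close> of the law and of its
  reflection; for even \<open>f\<close> both contribute the same integral.\<close>

lemma zonoid_wedge_K:
  assumes "f \<in> grassmann V d" "\<And>u. f (- u) = f u" "\<beta> \<in> grassmann_laws V e"
  shows "zonoid_wedge V d e f (zonoid_K \<beta>) u = (\<integral>y. f (contr_right y u) \<partial>\<beta>)"
proof -
  have \<beta>: "\<beta> \<in> integrable_laws (ext_power V e)" and \<beta>': "distr \<beta> borel uminus \<in> integrable_laws (ext_power V e)"
    using assms(3) reflect_law grassmann_laws_subset by blast+
  obtain N a \<mu> where f: "represents zonoid_Z (integrable_laws (ext_power V d)) f N a \<mu>"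
    using grassmann_represented[OF assms(1)] by blast
  have g: "represents zonoid_Z (integrable_laws (ext_power V e)) (zonoid_K \<beta>) 2 (\<lambda>_. 1 / 2)
      (\<lambda>i. if i = 0 then \<beta> else distr \<beta> borel uminus)"
    using \<beta> \<beta>' by (auto simp: represents_def zonoid_K_eq_Z[OF \<beta>] zonoid_Z_reflect[OF \<beta>] numeral_2_eq_2)
  have m: "(\<lambda>y. f (contr_right y u)) \<in> borel_measurable borel"
    by (intro tame_measurable tame_compose[OF grassmann_tame[OF assms(1)]])
      (simp add: linear_iff contr_right.add_left contr_right.scaleR_left)
  have "(\<integral>y. f (contr_right y u) \<partial>distr \<beta> borel uminus) = (\<integral>y. f (contr_right (- y) u) \<partial>\<beta>)"
    by (rule integral_distr[OF _ m]) (simp add: law_measurable[OF \<beta>])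
  also have "\<dots> = (\<integral>y. f (contr_right y u) \<partial>\<beta>)"
    by (simp add: contr_right.minus_left assms(2))
  finally show ?thesis
    using zonoid_wedge_eq(2)[OF f g] by (simp add: numeral_2_eq_2)
qed

lemma zonoid_wedge_one:
  assumes "g \<in> grassmann V e"
  shows "zonoid_wedge V 0 e (zonoid_Z (return borel (axis {} 1))) g u = g u"
proof -
  obtain M b \<nu> where g: "represents zonoid_Z (integrable_laws (ext_power V e)) g M b \<nu>"
    using grassmann_represented[OF assms] by blast
  have "axis {} 1 \<in> ext_power V 0"
    using simple_vectorsI[of "[]" 0 V 1] simple_vectors_subset by fastforce
  then have f: "represents zonoid_Z (integrable_laws (ext_power V 0)) (zonoid_Z (return borel (axis {} 1)))
      1 (\<lambda>_. 1) (\<lambda>_. return borel (axis {} 1))"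
    by (intro represents_single return_law)
  have m: "(\<lambda>x. g (contr x u)) \<in> borel_measurable borel"
    by (intro tame_measurable tame_compose[OF grassmann_tame[OF assms]])
      (simp add: linear_iff contr.add_left contr.scaleR_left)
  have "contr (axis {} 1) u = u"
    by (rule inner_eqI) (simp add: inner_contr)
  then show ?thesis
    using zonoid_wedge_eq(3)[OF f g, of u] m by (simp add: integral_return)
qed

lemma zonoid_K_nonneg: "zonoid_K \<mu> u \<ge> 0"
  by (simp add: zonoid_K_def)

end

subsection \<open>The cotangent space of the sphere\<close>

locale sphere_point =
  fixes pt :: "('m::{finite,linorder}) evec" and n :: nat
  assumes norm_pt: "norm pt = 1" and card_m: "CARD('m) = Suc n" and n_pos: "n \<ge> 1"

sublocale sphere_point \<subseteq> vector_subspace "cotangent pt"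
  by unfold_locales (rule subspace_cotangent)

context sphere_point
begin

abbreviation "V \<equiv> cotangent pt"

lemma stabilizer_symmetry: "g \<in> stabilizer pt \<Longrightarrow> symmetry g"
  by (simp add: symmetry_def stabilizer_orthogonal stabilizer_cotangent[OF stabilizer_transpose] stabilizer_cotangent
      del: transpose_matrix_vector)

definition proj :: "'m evec \<Rightarrow> 'm evec" where
  "proj x = x - (x \<bullet> pt) *\<^sub>R pt"

lemma linear_proj: "linear proj"
  by (simp add: linear_iff proj_def inner_add_left algebra_simps)

lemma proj_mem: "proj x \<in> V"
  using norm_pt by (simp add: proj_def cotangent_def inner_diff_left norm_eq_1)

lemma proj_id: "v \<in> V \<Longrightarrow> proj v = v"
  by (simp add: proj_def cotangent_def)

lemma proj_inner: "proj x \<bullet> y = x \<bullet> proj y"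
  by (simp add: proj_def inner_diff_left inner_diff_right inner_commute[of pt])

text \<open>As \<open>\<bar>u \<bullet> x\<bar>\<close> has Gaussian mean \<open>sqrt (2 / pi) * norm u\<close>, this factor makes the zonoid of the
  law below the unit ball.\<close>

definition ball_vector :: "'m evec \<Rightarrow> 'm ext" where
  "ball_vector x = ext_vec ((2 / sqrt (2 / pi)) *\<^sub>R proj x)"

lemma linear_ball_vector: "linear ball_vector"
  unfolding ball_vector_def
  by (simp add: linear_iff linear_add[OF linear_proj] linear_cmul[OF linear_proj] ext_vec_linear_simps
      scaleR_add_right)

definition beta :: "'m ext measure" where
  "beta = distr gauss_law borel ball_vector"

lemma gauss_law_mem: "gauss_law \<in> integrable_laws UNIV"
  by (simp add: integrable_laws_def prob_space_gauss_law integrable_gauss_law)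

lemma beta_law: "beta \<in> grassmann_laws V 1"
  unfolding beta_def grassmann_laws_eq
proof (rule distr_law[OF gauss_law_mem linear_ball_vector _ simple_borel])
  show "range ball_vector \<subseteq> simple_vectors V 1"
    unfolding simple_vectors_1[OF subspace_V] ball_vector_def
    using proj_mem subspace_scale[OF subspace_V] by blast
qed

text \<open>The self-adjoint projection moves over to \<open>u\<close>, and the scaling in
  \<open>ball_vector\<close> cancels the Gaussian constant together with the factor
  \<open>1 / 2\<close>.\<close>

lemma zonoid_K_beta: "zonoid_K beta u = norm (proj (ext_coords u))"
proof -
  have "ball_vector \<in> borel_measurable borel"
    using linear_ball_vector
    by (intro borel_measurable_continuous_onI linear_continuous_on) (simp add: linear_conv_bounded_linear)
  then have [measurable]: "ball_vector \<in> borel_measurable gauss_law"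
    by (simp add: law_measurable[OF gauss_law_mem])
  have "u \<bullet> ball_vector x = ((2 / sqrt (2 / pi)) *\<^sub>R proj (ext_coords u)) \<bullet> x" for x
    by (simp add: ball_vector_def inner_ext_vec proj_inner)
  then have "zonoid_K beta u = 1 / 2 * (\<integral>x. \<bar>((2 / sqrt (2 / pi)) *\<^sub>R proj (ext_coords u)) \<bullet> x\<bar> \<partial>gauss_law)"
    unfolding zonoid_K_def beta_def by (subst integral_distr) simp_all
  also have "\<dots> = norm (proj (ext_coords u))"
    unfolding gauss_law_average by simp
  finally show ?thesis .
qed

lemma support_fun_ball: "support_fun (ext_vec ` (V \<inter> cball 0 1)) u = norm (proj (ext_coords u))"
proof (rule antisym)
  have "0 \<in> V" by (rule subspace_0[OF subspace_V])
  then show "support_fun (ext_vec ` (V \<inter> cball 0 1)) u \<le> norm (proj (ext_coords u))"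
  proof (intro support_fun_least)
    fix x assume "x \<in> ext_vec ` (V \<inter> cball 0 1)"
    then obtain v where v: "x = ext_vec v" "v \<in> V" "norm v \<le> 1" by auto
    have "x \<bullet> u = proj (ext_coords u) \<bullet> v"
      using v by (simp add: inner_commute[of _ u] inner_ext_vec proj_inner proj_id)
    also have "\<dots> \<le> norm (proj (ext_coords u)) * norm v"
      by (rule norm_cauchy_schwarz)
    also have "\<dots> \<le> norm (proj (ext_coords u))"
      using v by (simp add: mult_left_le)
    finally show "x \<bullet> u \<le> norm (proj (ext_coords u))" .
  qed auto
  have "compact (ext_vec ` (V \<inter> cball 0 1))"
    using closed_cotangent[of pt]
    by (intro compact_continuous_image closed_Int_compact linear_continuous_on)
      (auto simp: linear_conv_bounded_linear[symmetric] linear_ext_vec)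
  \<comment> \<open>The maximiser is the normalised projection. If the projection vanishes, division
    by zero gives \<open>v = 0\<close>, and the argument still goes through.\<close>
  moreover define v where "v = (1 / norm (proj (ext_coords u))) *\<^sub>R proj (ext_coords u)"
  have "v \<in> V" "norm v \<le> 1"
    using proj_mem subspace_scale[OF subspace_V] by (auto simp: v_def)
  ultimately have "ext_vec v \<bullet> u \<le> support_fun (ext_vec ` (V \<inter> cball 0 1)) u"
    by (intro support_fun_upper) auto
  moreover have "ext_vec v \<bullet> u = proj (ext_coords u) \<bullet> v"
    using \<open>v \<in> V\<close> by (simp add: inner_commute[of _ u] inner_ext_vec proj_inner proj_id)
  moreover have "proj (ext_coords u) \<bullet> v = norm (proj (ext_coords u))"
    by (simp add: v_def dot_square_norm power2_eq_square)
  ultimately show "norm (proj (ext_coords u)) \<le> support_fun (ext_vec ` (V \<inter> cball 0 1)) u"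
    by simp
qed

lemma ball_element_eq: "ball_element V = in_degree 1 (zonoid_K beta)"
proof -
  have "support_fun (ext_vec ` (V \<inter> cball 0 1)) = zonoid_K beta"
    by (rule ext) (simp add: support_fun_ball zonoid_K_beta)
  then show ?thesis by (simp add: ball_element_def)
qed

text \<open>The index is one less than the degree.\<close>

primrec beta_pow :: "nat \<Rightarrow> 'm ext measure" where
  "beta_pow 0 = beta"
| "beta_pow (Suc k) = wedge_law (beta_pow k) beta"

lemma beta_pow_law: "beta_pow k \<in> grassmann_laws V (Suc k)"
proof (induction k)
  case 0
  then show ?case using beta_law by simp
next
  case (Suc k)
  then show ?case using wedge_law_grassmann[OF Suc beta_law] by simp
qed

lemma zonoid_K_even: "zonoid_K \<mu> (- u) = zonoid_K \<mu> u"
  by (simp add: zonoid_K_def)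

lemma zonoid_K_beta_pow_Suc: "zonoid_K (beta_pow (Suc k)) u = (\<integral>y. zonoid_K (beta_pow k) (contr_right y u) \<partial>beta)"
  using zonoid_K_wedge_law[OF subsetD[OF grassmann_laws_subset beta_pow_law]
      subsetD[OF grassmann_laws_subset beta_law]] by simp

text \<open>The zeroth power is the unit, a segment that is not centered, so the description by
  centered zonoids of \<open>beta_pow\<close> can only start with the first power.\<close>

lemma ball_element_pow: "ball_element V [^]\<^bsub>R\<^esub> (Suc k) = in_degree (Suc k) (zonoid_K (beta_pow k))"
proof (induction k)
  case 0
  have "ball_element V [^]\<^bsub>R\<^esub> (Suc 0) = \<one>\<^bsub>R\<^esub> \<otimes>\<^bsub>R\<^esub> ball_element V"
    by (simp add: nat_pow_def)
  also have "\<dots> = in_degree (0 + 1) (zonoid_wedge V 0 1 (zonoid_Z (return borel (axis {} 1))) (zonoid_K beta))"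
    unfolding R_one ball_element_eq by (rule in_degree_mult[OF one_grassmann grassmann_K[OF beta_law]])
  also have "zonoid_wedge V 0 1 (zonoid_Z (return borel (axis {} 1))) (zonoid_K beta) = zonoid_K beta"
    using zonoid_wedge_one[OF grassmann_K[OF beta_law]] by blast
  finally show ?case by simp
next
  case (Suc k)
  have "ball_element V [^]\<^bsub>R\<^esub> (Suc (Suc k)) = ball_element V [^]\<^bsub>R\<^esub> (Suc k) \<otimes>\<^bsub>R\<^esub> ball_element V"
    by (simp add: nat_pow_def)
  also have "\<dots> = in_degree (Suc k) (zonoid_K (beta_pow k)) \<otimes>\<^bsub>R\<^esub> in_degree 1 (zonoid_K beta)"
    unfolding Suc unfolding ball_element_eq ..
  also have "\<dots> = in_degree (Suc k + 1) (zonoid_wedge V (Suc k) 1 (zonoid_K (beta_pow k)) (zonoid_K beta))"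
    by (rule in_degree_mult[OF grassmann_K[OF beta_pow_law] grassmann_K[OF beta_law]])
  also have "zonoid_wedge V (Suc k) 1 (zonoid_K (beta_pow k)) (zonoid_K beta) = zonoid_K (beta_pow (Suc k))"
    using zonoid_wedge_K[OF grassmann_K[OF beta_pow_law] zonoid_K_even beta_law] zonoid_K_beta_pow_Suc
    by presburger
  finally show ?case by simp
qed

text \<open>If the integral over \<open>y\<close> vanishes, then by induction \<open>u\<close> is orthogonal to all \<open>x \<and> y\<close> with
  \<open>y \<in> V\<close>, in particular to itself.\<close>

lemma zonoid_K_beta_pow_pos:
  "u \<in> simple_vectors V (Suc k) \<Longrightarrow> u \<noteq> 0 \<Longrightarrow> zonoid_K (beta_pow k) u > 0"
proof (induction k arbitrary: u)
  case 0
  then obtain v where v: "u = ext_vec v" "v \<in> V"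
    using simple_vectors_1[OF subspace_V] by auto
  moreover have "v \<noteq> 0"
    using 0 v by (auto simp: ext_vec_linear_simps)
  ultimately show ?case
    by (simp add: zonoid_K_beta proj_id)
next
  case (Suc k)
  let ?f = "\<lambda>y. zonoid_K (beta_pow k) (contr_right y u)"
  have beta: "beta \<in> integrable_laws (simple_vectors V 1)" "beta \<in> integrable_laws (ext_power V 1)"
    using beta_law grassmann_laws_subset by (auto simp: grassmann_laws_eq)
  have "zonoid_K (beta_pow (Suc k)) u \<noteq> 0"
  proof
    assume "zonoid_K (beta_pow (Suc k)) u = 0"
    then have "(\<integral>y. ?f y \<partial>beta) = 0"
      by (simp only: zonoid_K_beta_pow_Suc)
    moreover have "integrable beta ?f"
      by (intro tame_integrable[OF tame_compose[OF grassmann_tame[OF grassmann_K[OF beta_pow_law]]] beta(1)])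
        (simp add: linear_iff contr_right.add_left contr_right.scaleR_left)
    ultimately have "AE y in beta. ?f y = 0"
      by (subst (asm) integral_nonneg_eq_0_iff_AE) (auto simp: zonoid_K_nonneg)
    moreover have "AE y in beta. y \<in> simple_vectors V 1"
      by (rule law_AE[OF beta(1)])
    ultimately have AE0: "AE y in beta. contr_right y u = 0"
    proof eventually_elim
      case (elim y)
      have "contr_right y u \<in> simple_vectors V (Suc k)"
        using contr_right_simple[OF subspace_V elim(2), of u "Suc k"] Suc.prems(1) by simp
      then show ?case using Suc.IH[of "contr_right y u"] elim(1) by auto
    qed
    have ortho: "u \<bullet> wedge x (ext_vec v) = 0" if "v \<in> V" for x v
    proof -
      have "AE y in beta. \<bar>contr x u \<bullet> y\<bar> = 0"
        using AE0
      proof eventually_elim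
        case (elim y)
        have "contr x u \<bullet> y = contr_right y u \<bullet> x"
          by (simp add: inner_contr inner_contr_right)
        then show ?case using elim by simp
      qed
      then have "zonoid_K beta (contr x u) = 0"
        unfolding zonoid_K_def by (subst integral_eq_zero_AE) simp_all
      then have "proj (ext_coords (contr x u)) = 0"
        by (simp add: zonoid_K_beta)
      moreover have "u \<bullet> wedge x (ext_vec v) = proj (ext_coords (contr x u)) \<bullet> v"
        using that by (simp add: proj_inner proj_id inner_ext_vec[symmetric] inner_contr)
      ultimately show ?thesis by simp
    qed
    obtain c vs where vs: "u = c *\<^sub>R wedges vs" "length vs = Suc (Suc k)" "set vs \<subseteq> V"
      using Suc.prems(1) by (auto simp: simple_vectors_def)
    then obtain v ws where ws: "vs = ws @ [v]"
      by (cases vs rule: rev_cases) auto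
    then have "u = wedge (c *\<^sub>R wedges ws) (ext_vec v)" "v \<in> V"
      using vs by (auto simp: wedges_append wedge.scaleR_left)
    then have "u \<bullet> u = 0" using ortho by metis
    then show False using Suc.prems(2) by simp
  qed
  then show ?case
    using zonoid_K_nonneg[of "beta_pow (Suc k)" u] by linarith
qed

subsection \<open>Invariant elements\<close>

text \<open>A coset fixed by the stabilizer need not have a fixed representative, so invariance is
  required only up to \<open>agree\<close>.\<close>

definition invariant :: "(nat \<Rightarrow> 'm ext \<Rightarrow> real) \<Rightarrow> bool" where
  "invariant x \<longleftrightarrow> x \<in> carrier R \<and> (\<forall>g\<in>stabilizer pt. agree (zonoid_act g x) x)"


lemma Q_class_mem_prob_ring:
  assumes "x \<in> carrier R"
  shows "Q_class V x \<in> prob_intersection_ring pt \<longleftrightarrow> invariant x"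
  using assms act_Q_class_fixed[OF stabilizer_symmetry]
  by (auto simp: prob_intersection_ring_def Q_carrier invariant_def)

lemma prob_ring_eq: "prob_intersection_ring pt = Q_class V ` {x. invariant x}"
proof (intro subset_antisym subsetI)
  fix X assume X: "X \<in> prob_intersection_ring pt"
  then obtain x where "x \<in> carrier R" "X = Q_class V x"
    by (auto simp: prob_intersection_ring_def Q_carrier)
  then show "X \<in> Q_class V ` {x. invariant x}"
    using X Q_class_mem_prob_ring by blast
next
  fix X assume "X \<in> Q_class V ` {x. invariant x}"
  then show "X \<in> prob_intersection_ring pt"
    using Q_class_mem_prob_ring by (auto simp: invariant_def)
qed

lemma invariant_mult:
  assumes "invariant x" "invariant y"
  shows "invariant (x \<otimes>\<^bsub>R\<^esub> y)"
  unfolding invariant_def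
proof (intro conjI ballI)
  show "x \<otimes>\<^bsub>R\<^esub> y \<in> carrier R"
    using assms by (simp add: invariant_def R_mult_closed)
  fix g assume g: "g \<in> stabilizer pt"
  show "agree (zonoid_act g (x \<otimes>\<^bsub>R\<^esub> y)) (x \<otimes>\<^bsub>R\<^esub> y)"
    using assms g act_mult[OF stabilizer_symmetry[OF g]] act_closed[OF stabilizer_symmetry[OF g]]
    by (auto simp: invariant_def intro!: R_mult_agree)
qed

lemma invariant_add: "invariant x \<Longrightarrow> invariant y \<Longrightarrow> invariant (x \<oplus>\<^bsub>R\<^esub> y)"
  by (auto simp: invariant_def R_add_closed) (simp add: R_add agree_def zonoid_act_def)

lemma invariant_scale: "invariant x \<Longrightarrow> invariant (\<lambda>d u. c * x d u)"
  by (auto simp: invariant_def R_scale_closed) (simp add: agree_def zonoid_act_def)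

lemma invariant_in_degree:
  "invariant (in_degree d f) \<longleftrightarrow> f \<in> grassmann V d \<and>
    (\<forall>g\<in>stabilizer pt. \<forall>w\<in>simple_vectors V d. f (ext_map (transpose g) w) = f w)"
proof
  assume i: "invariant (in_degree d f)"
  then have "in_degree d f d \<in> grassmann V d"
    unfolding invariant_def R_carrier by blast
  moreover have "f (ext_map (transpose g) w) = f w" if "g \<in> stabilizer pt" "w \<in> simple_vectors V d" for g w
    using i that agreeD[of "zonoid_act g (in_degree d f)" "in_degree d f" w d]
    by (simp add: invariant_def zonoid_act_def)
  ultimately show "f \<in> grassmann V d \<and>
    (\<forall>g\<in>stabilizer pt. \<forall>w\<in>simple_vectors V d. f (ext_map (transpose g) w) = f w)"
    by simp
next
  assume "f \<in> grassmann V d \<and>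
    (\<forall>g\<in>stabilizer pt. \<forall>w\<in>simple_vectors V d. f (ext_map (transpose g) w) = f w)"
  then show "invariant (in_degree d f)"
    by (auto simp: invariant_def in_degree_closed) (auto simp: agree_def zonoid_act_def in_degree_def)
qed

lemma invariant_component: "invariant x \<Longrightarrow> invariant (in_degree d (x d))"
  unfolding invariant_in_degree by (auto simp: invariant_def R_carrier agree_def zonoid_act_def)

lemma invariant_degree_0:
  assumes "f \<in> grassmann V 0"
  shows "invariant (in_degree 0 f)"
  using assms by (auto simp: invariant_in_degree simple_vectors_0 ext_map_linear_simps)

text \<open>Rotations fixing \<open>pt\<close> act trivially on the top exterior power, so that odd
  functions survive here too; they are the source of the orientation class.\<close>

lemma invariant_degree_n:
  assumes "f \<in> grassmann V n"
  shows "invariant (in_degree n f)"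
  using assms ext_map_ext_power_top[OF norm_pt card_m subsetD[OF simple_vectors_subset] stabilizer_transpose]
  by (auto simp: invariant_in_degree)

lemma invariant_one: "invariant \<one>\<^bsub>R\<^esub>"
  unfolding R_one by (rule invariant_degree_0[OF one_grassmann])

lemma invariant_ball: "invariant (ball_element V)"
proof -
  have "zonoid_K beta (ext_map (transpose g) w) = zonoid_K beta w"
    if g: "g \<in> stabilizer pt" and w: "w \<in> simple_vectors V 1" for g w
  proof -
    obtain v where v: "w = ext_vec v" "v \<in> V"
      using w simple_vectors_1[OF subspace_V] by auto
    have t: "transpose g \<in> stabilizer pt" by (rule stabilizer_transpose[OF g])
    have "ext_map (transpose g) w = ext_vec (transpose g *v v)"
      using ext_map_wedge_ext_vec[of "transpose g" v "axis {} 1"] by (simp add: v del: transpose_matrix_vector)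
    then show ?thesis
      using v stabilizer_cotangent[OF t v(2)] orthogonal_matrix_inner[OF stabilizer_orthogonal[OF t], of v v]
      by (simp add: zonoid_K_beta proj_id norm_eq_sqrt_inner del: transpose_matrix_vector)
  qed
  then show ?thesis
    unfolding ball_element_eq invariant_in_degree using grassmann_K[OF beta_law] by blast
qed

lemma invariant_pow: "invariant x \<Longrightarrow> invariant (x [^]\<^bsub>R\<^esub> (k::nat))"
  by (induction k) (simp_all add: nat_pow_def invariant_one invariant_mult)

lemma invariant_beta_pow: "invariant (in_degree (Suc k) (zonoid_K (beta_pow k)))"
  using invariant_pow[OF invariant_ball, of "Suc k"] by (simp only: ball_element_pow)

lemma invariant_equal_norm:
  assumes "invariant (in_degree d f)" "0 < d" "d < n"
    and "w \<in> simple_vectors V d" "w' \<in> simple_vectors V d" "norm w = norm w'"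
  shows "f w = f w'"
proof -
  obtain g where g: "g \<in> stabilizer pt" "ext_map g w = w'"
    using stabilizer_transitive[OF norm_pt assms(2) _ assms(6,4,5)] assms(3) card_m by auto
  then show ?thesis
    using assms(1,4) stabilizer_transpose[OF g(1)] unfolding invariant_in_degree
    by (metis transpose_transpose)
qed

text \<open>Simple vectors of equal norm form one orbit, and \<open>w\<close> is compared with
  \<open>norm w *\<^sub>R w0\<close>; positive homogeneity does the rest.\<close>

lemma invariant_middle:
  assumes "invariant (in_degree d f)" "0 < d" "d < n"
    and "w \<in> simple_vectors V d" "w0 \<in> simple_vectors V d" "norm w0 = 1"
  shows "f w = norm w * f w0"
proof -
  have "f w = f (norm w *\<^sub>R w0)"
    using assms by (intro invariant_equal_norm[OF assms(1)]) (auto intro: simple_vectors_scaleR)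
  also have "\<dots> = norm w * f w0"
    using assms(1) by (intro grassmann_scaleR) (auto simp: invariant_in_degree)
  finally show ?thesis .
qed

lemma simple_degree_high: "w \<in> simple_vectors V d \<Longrightarrow> d > n \<Longrightarrow> w = 0"
  using ext_power_high[OF norm_pt, of d w] simple_vectors_subset card_m by auto

lemma agree_zero_high:
  assumes "f \<in> grassmann V d" "d > n"
  shows "agree (in_degree d f) (\<lambda>d u. 0)"
  using assms simple_degree_high grassmann_at_zero[OF assms(1)] by (auto simp: agree_def in_degree_def)

end

subsection \<open>Length\<close>

text \<open>Exchanging the two integrals turns the inner one into the Gaussian mean of
  \<open>\<bar>u \<bullet> x\<bar>\<close>, a multiple of \<open>norm x\<close>. The length can thus
  be read off from the function alone.\<close>

lemma gauss_integral_zonoid_K: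
  fixes \<mu> :: "(real ^ 'k::finite) measure"
  assumes "\<mu> \<in> integrable_laws W"
  shows "(\<integral>u. zonoid_K \<mu> u \<partial>gauss_law) = sqrt (2 / pi) / 2 * (\<integral>x. norm x \<partial>\<mu>)"
proof -
  have g: "gauss_law \<in> integrable_laws (UNIV :: (real ^ 'k) set)"
    by (simp add: integrable_laws_def prob_space_gauss_law integrable_gauss_law)
  show ?thesis
    using zonoid_K_pairing[OF g assms] by (simp add: zonoid_K_def[of gauss_law] gauss_law_average)
qed

text \<open>The length is well defined since it is a fixed multiple of the Gaussian mean, which only depends
  on the support function and vanishes on points.\<close>

lemma zonoid_length_K:
  fixes \<mu> :: "(real ^ 'k::finite) measure"
  assumes \<mu>: "\<mu> \<in> integrable_laws W" and "0 \<in> W"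
  shows "zonoid_length W (zonoid_K \<mu>) = (\<integral>x. norm x \<partial>\<mu>)"
  unfolding zonoid_length_def
proof (rule the_equality)
  show "\<forall>(N::nat) c \<nu> p. (\<forall>i<N. \<nu> i \<in> integrable_laws W) \<and> p \<in> W \<and>
      zonoid_K \<mu> = (\<lambda>u. (\<Sum>i<N. c i * zonoid_K (\<nu> i) u) + u \<bullet> p) \<longrightarrow>
      (\<integral>x. norm x \<partial>\<mu>) = (\<Sum>i<N. c i * (\<integral>x. norm x \<partial>\<nu> i))"
  proof (intro allI impI, elim conjE)
    fix N :: nat and c \<nu> and p :: "real ^ 'k"
    assume \<nu>: "\<forall>i<N. \<nu> i \<in> integrable_laws W"
      and eq: "zonoid_K \<mu> = (\<lambda>u. (\<Sum>i<N. c i * zonoid_K (\<nu> i) u) + u \<bullet> p)"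
    have g: "gauss_law \<in> integrable_laws (UNIV :: (real ^ 'k) set)"
      by (simp add: integrable_laws_def prob_space_gauss_law integrable_gauss_law)
    have i: "integrable gauss_law (\<lambda>u. c i * zonoid_K (\<nu> i) u)" if "i < N" for i
      using that \<nu> by (intro integrable_mult_right tame_integrable[OF tame_zonoid_K g]) auto
    have "sqrt (2 / pi) / 2 * (\<integral>x. norm x \<partial>\<mu>) = (\<integral>u. (\<Sum>i<N. c i * zonoid_K (\<nu> i) u) + u \<bullet> p \<partial>gauss_law)"
      using gauss_integral_zonoid_K[OF \<mu>] by (simp add: eq)
    also have "\<dots> = (\<integral>u. (\<Sum>i<N. c i * zonoid_K (\<nu> i) u) \<partial>gauss_law) + (\<integral>u. u \<bullet> p \<partial>gauss_law)"
      using i integrable_gauss_law by (intro Bochner_Integration.integral_add Bochner_Integration.integrable_sum) auto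
    also have "(\<integral>u. u \<bullet> p \<partial>gauss_law) = 0"
      using gauss_law_odd[of p] by (simp add: inner_commute)
    also have "(\<integral>u. (\<Sum>i<N. c i * zonoid_K (\<nu> i) u) \<partial>gauss_law) = (\<Sum>i<N. c i * (\<integral>u. zonoid_K (\<nu> i) u \<partial>gauss_law))"
      using i by (subst Bochner_Integration.integral_sum) auto
    also have "\<dots> = (\<Sum>i<N. c i * (sqrt (2 / pi) / 2 * (\<integral>x. norm x \<partial>\<nu> i)))"
      using gauss_integral_zonoid_K \<nu> by (intro sum.cong) auto
    finally have "sqrt (2 / pi) / 2 * (\<integral>x. norm x \<partial>\<mu>) = sqrt (2 / pi) / 2 * (\<Sum>i<N. c i * (\<integral>x. norm x \<partial>\<nu> i))"
      by (simp add: sum_distrib_left mult_ac)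
    then show "(\<integral>x. norm x \<partial>\<mu>) = (\<Sum>i<N. c i * (\<integral>x. norm x \<partial>\<nu> i))"
      by simp
  qed
next
  fix r assume r: "\<forall>(N::nat) c \<nu> p. (\<forall>i<N. \<nu> i \<in> integrable_laws W) \<and> p \<in> W \<and>
      zonoid_K \<mu> = (\<lambda>u. (\<Sum>i<N. c i * zonoid_K (\<nu> i) u) + u \<bullet> p) \<longrightarrow>
      r = (\<Sum>i<N. c i * (\<integral>x. norm x \<partial>\<nu> i))"
  show "r = (\<integral>x. norm x \<partial>\<mu>)"
    using r[rule_format, of 1 "\<lambda>_. \<mu>" 0 "\<lambda>_. 1"] assms by simp
qed

subsection \<open>Generators and relations\<close>

context sphere_point
begin

abbreviation "ball_class \<equiv> Q_class V (ball_element V)"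

lemma prob_ring_one: "\<one>\<^bsub>Q_ring V\<^esub> \<in> prob_intersection_ring pt"
  unfolding Q_one prob_ring_eq using invariant_one by blast

lemma generated_subset_prob_ring:
  assumes "S \<subseteq> prob_intersection_ring pt"
  shows "generated_subalgebra (Q_ring V) (Q_scale V) S \<subseteq> prob_intersection_ring pt"
proof
  fix X assume "X \<in> generated_subalgebra (Q_ring V) (Q_scale V) S"
  then show "X \<in> prob_intersection_ring pt"
  proof induction
    case one
    show ?case by (rule prob_ring_one)
  next
    case (incl x)
    then show ?case using assms by blast
  next
    case (add X Y)
    then obtain x y where "invariant x" "invariant y" "X = Q_class V x" "Y = Q_class V y"
      unfolding prob_ring_eq by blast
    then show ?case
      unfolding prob_ring_eq using Q_add invariant_add by (auto simp: invariant_def)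
  next
    case (mult X Y)
    then obtain x y where xy: "invariant x" "invariant y" "X = Q_class V x" "Y = Q_class V y"
      unfolding prob_ring_eq by blast
    then have "X \<otimes>\<^bsub>Q_ring V\<^esub> Y = Q_class V (x \<otimes>\<^bsub>R\<^esub> y)"
      using Q_mult by (auto simp: invariant_def)
    then show ?case
      unfolding prob_ring_eq using invariant_mult[OF xy(1,2)] by blast
  next
    case (scale X c)
    then obtain x where x: "invariant x" "X = Q_class V x"
      unfolding prob_ring_eq by blast
    then have "Q_scale V c X = Q_class V (\<lambda>d u. c * x d u)"
      using Q_scale_class by (auto simp: invariant_def)
    then show ?case
      unfolding prob_ring_eq using invariant_scale[OF x(1)] by blast
  qed
qed

lemma zero_generated: "Q_class V (\<lambda>d u. 0) \<in> generated_subalgebra (Q_ring V) (Q_scale V) S"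
proof -
  have "Q_scale V 0 \<one>\<^bsub>Q_ring V\<^esub> = Q_class V (\<lambda>d u. 0)"
    unfolding Q_one Q_scale_class[OF R_one_closed] by simp
  then show ?thesis
    by (metis generated_subalgebra.one generated_subalgebra.scale)
qed

lemma ball_closed: "ball_element V \<in> carrier R"
  using invariant_ball by (simp add: invariant_def)

lemma ball_class_pow: "ball_class [^]\<^bsub>Q_ring V\<^esub> (Suc k) = Q_class V (in_degree (Suc k) (zonoid_K (beta_pow k)))"
  using Q_pow[OF ball_closed, of "Suc k"] by (simp only: ball_element_pow)

lemma ball_class_pow_scale:
  "Q_scale V c (ball_class [^]\<^bsub>Q_ring V\<^esub> (Suc k)) = Q_class V (in_degree (Suc k) (\<lambda>u. c * zonoid_K (beta_pow k) u))"
proof -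
  have "(\<lambda>d u. c * in_degree (Suc k) (zonoid_K (beta_pow k)) d u) = in_degree (Suc k) (\<lambda>u. c * zonoid_K (beta_pow k) u)"
    by (auto simp: in_degree_def)
  then show ?thesis
    unfolding ball_class_pow Q_scale_class[OF in_degree_closed[OF grassmann_K[OF beta_pow_law]]] by simp
qed

lemma orientation_closed: "\<omega> \<in> ext_power V n \<Longrightarrow> (\<lambda>u. 1 / 2 * (u \<bullet> \<omega>)) \<in> grassmann V n"
  by (intro grassmann_scale grassmann_point)

text \<open>Below degree \<open>n\<close> an invariant function is a multiple of the norm on simple
  vectors, as is the ball power of the same degree. In degree \<open>n\<close> its even and odd
  parts are multiples of the ball power and of the orientation.\<close>

lemma component_generated:
  assumes f: "invariant (in_degree d f)" and "d > 0"
    and \<omega>: "\<omega> \<in> ext_power V n" "norm \<omega> = 1"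
  shows "Q_class V (in_degree d f) \<in>
    generated_subalgebra (Q_ring V) (Q_scale V) {ball_class, Q_class V (orientation_element n \<omega>)}"
    (is "_ \<in> ?gen")
proof -
  obtain k where k: "d = Suc k" using \<open>d > 0\<close> by (cases d) auto
  have fg: "f \<in> grassmann V d" using f by (simp add: invariant_in_degree)
  have B: "Q_scale V c (ball_class [^]\<^bsub>Q_ring V\<^esub> d) \<in> ?gen" for c
    by (intro generated_subalgebra.scale generated_subalgebra_pow generated_subalgebra.incl) simp
  have zero: "Q_class V (in_degree d f) \<in> ?gen" if "agree (in_degree d f) (\<lambda>d u. 0)"
    using that zero_generated Q_class_eq_iff[OF in_degree_closed[OF fg] R_zero_closed] by metis
  \<comment> \<open>A degree in which every simple vector is zero has only the zero class, so the
    existence of unit simple vectors need not be established degree by degree.\<close>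
  consider "\<exists>w0\<in>simple_vectors V d. norm w0 = 1" | "\<forall>w\<in>simple_vectors V d. w = 0"
  proof (cases "\<forall>w\<in>simple_vectors V d. w = 0")
    case False
    then obtain w where "w \<in> simple_vectors V d" "w \<noteq> 0" by blast
    then have "(1 / norm w) *\<^sub>R w \<in> simple_vectors V d" "norm ((1 / norm w) *\<^sub>R w) = 1"
      by (auto intro: simple_vectors_scaleR)
    then show ?thesis using that(1) by blast
  qed (use that in blast)
  then show ?thesis
  proof cases
    case 2
    then show ?thesis
      using grassmann_at_zero[OF fg] by (intro zero) (auto simp: agree_def in_degree_def)
  next
    case 1
    then obtain w0 where w0: "w0 \<in> simple_vectors V d" "norm w0 = 1" by blast
    have pos: "zonoid_K (beta_pow k) w0 > 0"
      using zonoid_K_beta_pow_pos[of w0 k] w0 k norm_zero by fastforce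
    consider "d > n" | "d < n" | "d = n" by linarith
    then show ?thesis
    proof cases
      case 1
      then show ?thesis using agree_zero_high[OF fg] zero by blast
    next
      case 2
      define c where "c = f w0 / zonoid_K (beta_pow k) w0"
      have "f w = c * zonoid_K (beta_pow k) w" if "w \<in> simple_vectors V d" for w
        using invariant_middle[OF f \<open>d > 0\<close> 2 that w0] pos
          invariant_middle[OF invariant_beta_pow[of k, folded k] \<open>d > 0\<close> 2 that w0] by (simp add: c_def)
      then have "agree (in_degree d f) (in_degree d (\<lambda>u. c * zonoid_K (beta_pow k) u))"
        by (rule in_degree_agree)
      moreover have "(\<lambda>u. c * zonoid_K (beta_pow k) u) \<in> grassmann V d"
        unfolding k by (intro grassmann_scale grassmann_K beta_pow_law)
      ultimately have "Q_class V (in_degree d f) = Q_class V (in_degree d (\<lambda>u. c * zonoid_K (beta_pow k) u))"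
        using Q_class_eq_iff[OF in_degree_closed[OF fg] in_degree_closed] by blast
      then show ?thesis
        using B[of c] unfolding k ball_class_pow_scale by simp
    next
      case 3
      have "w0 \<in> ext_power V n" using w0 3 simple_vectors_subset by blast
      then obtain t where "w0 = t *\<^sub>R \<omega>"
        using ext_power_top_line[OF norm_pt card_m _ \<omega>(1)] \<omega>(2) by force
      then have "t \<noteq> 0" "\<omega> = (1 / t) *\<^sub>R w0" using w0(2) by auto
      \<comment> \<open>The top power is a line, so the simple vector \<open>w0\<close> is a nonzero
        multiple of \<open>\<omega>\<close>, which is therefore simple itself.\<close>
      then have \<omega>s: "\<omega> \<in> simple_vectors V d" using simple_vectors_scaleR[OF w0(1)] by metis
      have "\<omega> \<noteq> 0" using \<omega>(2) by auto
      define \<kappa> where "\<kappa> = zonoid_K (beta_pow k) \<omega>"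
      have "\<kappa> > 0"
        unfolding \<kappa>_def using zonoid_K_beta_pow_pos[of \<omega> k] \<omega>s k \<open>\<omega> \<noteq> 0\<close> by auto
      \<comment> \<open>Solves \<open>f \<omega> = a * \<kappa> + b / 2\<close> and
        \<open>f (- \<omega>) = a * \<kappa> - b / 2\<close>. The difference \<open>b\<close> is not
        halved, because the orientation element already carries the factor
        \<open>1 / 2\<close>.\<close>
      define a where "a = (f \<omega> + f (- \<omega>)) / (2 * \<kappa>)"
      define b where "b = f \<omega> - f (- \<omega>)"
      have Kg: "zonoid_K (beta_pow k) \<in> grassmann V d"
        unfolding k by (intro grassmann_K beta_pow_law)
      have f_eq: "f w = a * zonoid_K (beta_pow k) w + b * (1 / 2 * (w \<bullet> \<omega>))" if w: "w \<in> simple_vectors V d" for w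
      proof -
        have "w \<in> ext_power V n" using w 3 simple_vectors_subset by blast
        then obtain s where s: "w = s *\<^sub>R \<omega>"
          using ext_power_top_line[OF norm_pt card_m _ \<omega>(1) \<open>\<omega> \<noteq> 0\<close>] by blast
        have in1: "w \<bullet> \<omega> = s" using \<omega>(2) by (simp add: s norm_eq_1)
        show ?thesis
        proof (cases "s \<ge> 0")
          case True
          then have "f w = s * f \<omega>" "zonoid_K (beta_pow k) w = s * \<kappa>"
            unfolding s \<kappa>_def using grassmann_scaleR[OF fg] grassmann_scaleR[OF Kg] by auto
          then show ?thesis
            using \<open>\<kappa> > 0\<close> by (simp add: a_def b_def in1 field_simps)
        next
          case False
          have w': "w = (- s) *\<^sub>R (- \<omega>)" using s by simp
          have "f w = (- s) * f (- \<omega>)" "zonoid_K (beta_pow k) w = (- s) * zonoid_K (beta_pow k) (- \<omega>)"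
            unfolding w' using False by (intro grassmann_scaleR[OF fg] grassmann_scaleR[OF Kg], simp)+
          then have "f w = (- s) * f (- \<omega>)" "zonoid_K (beta_pow k) w = (- s) * \<kappa>"
            by (simp_all add: zonoid_K_even \<kappa>_def)
          then show ?thesis
            using \<open>\<kappa> > 0\<close> by (simp add: a_def b_def in1 field_simps)
        qed
      qed
      let ?x = "in_degree d (\<lambda>u. a * zonoid_K (beta_pow k) u)"
      let ?y = "\<lambda>e u. b * orientation_element n \<omega> e u"
      have xc: "?x \<in> carrier R" by (intro in_degree_closed grassmann_scale Kg)
      have oc: "orientation_element n \<omega> \<in> carrier R"
        unfolding orientation_element_def by (intro in_degree_closed orientation_closed \<omega>)
      then have yc: "?y \<in> carrier R" by (rule R_scale_closed)
      have "agree (in_degree d f) (?x \<oplus>\<^bsub>R\<^esub> ?y)"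
        using f_eq 3 by (auto simp: agree_def R_add in_degree_def orientation_element_def)
      then have "Q_class V (in_degree d f) = Q_class V (?x \<oplus>\<^bsub>R\<^esub> ?y)"
        using Q_class_eq_iff[OF in_degree_closed[OF fg] R_add_closed[OF xc yc]] by blast
      also have "\<dots> = Q_class V ?x \<oplus>\<^bsub>Q_ring V\<^esub> Q_class V ?y"
        by (rule Q_add[OF xc yc, symmetric])
      also have "Q_class V ?x = Q_scale V a (ball_class [^]\<^bsub>Q_ring V\<^esub> d)"
        unfolding k ball_class_pow_scale ..
      also have "Q_class V ?y = Q_scale V b (Q_class V (orientation_element n \<omega>))"
        by (rule Q_scale_class[OF oc, symmetric])
      finally show ?thesis
        using B[of a] by (auto intro: generated_subalgebra.intros)
    qed
  qed
qed

lemma prob_ring_generated: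
  assumes \<omega>: "\<omega> \<in> ext_power V n" "norm \<omega> = 1" and x: "invariant x"
  shows "Q_class V x \<in> generated_subalgebra (Q_ring V) (Q_scale V)
    ({ball_class, Q_class V (orientation_element n \<omega>)} \<union> (prob_intersection_ring pt \<inter> Q_degree V 0))"
    (is "_ \<in> ?gen")
proof -
  have xg: "x d \<in> grassmann V d" for d
    using x by (simp add: invariant_def R_carrier)
  have comp: "Q_class V (in_degree d (x d)) \<in> ?gen" for d
  proof (cases "d = 0")
    case True
    have "Q_class V (in_degree 0 (x 0)) \<in> prob_intersection_ring pt \<inter> Q_degree V 0"
      using invariant_component[OF x, of 0] xg[of 0] by (auto simp: prob_ring_eq Q_degree_def)
    then show ?thesis
      using True by (intro generated_subalgebra.incl) simp
  next
    case False
    then show ?thesis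
      using component_generated[OF invariant_component[OF x] _ \<omega>, of d]
      by (auto intro: generated_subalgebra_mono)
  qed
  \<comment> \<open>Truncations to the degrees below \<open>k\<close>. An element has components in
    all degrees, but only finite sums are generated; beyond degree \<open>n\<close> the components
    vanish on simple vectors.\<close>
  define y where "y k = (\<lambda>d. if d < k then x d else (\<lambda>_. 0))" for k :: nat
  have yc: "y k \<in> carrier R" for k
    using xg by (simp add: y_def R_carrier grassmann_zero)
  have "Q_class V (y k) \<in> ?gen" for k
  proof (induction k)
    case 0
    have "y 0 = (\<lambda>d u. 0)" by (simp add: y_def)
    then show ?case by (simp only: zero_generated)
  next
    case (Suc k)
    have "y (Suc k) = y k \<oplus>\<^bsub>R\<^esub> in_degree k (x k)"
      by (auto simp: y_def R_add in_degree_def fun_eq_iff less_Suc_eq)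
    then show ?case
      using Q_add[OF yc[of k] in_degree_closed[OF xg[of k]]] Suc comp[of k]
      by (metis generated_subalgebra.add)
  qed
  moreover have "agree x (y (Suc n))"
  proof (rule agreeI)
    fix d w assume w: "w \<in> simple_vectors V d"
    show "x d w = y (Suc n) d w"
    proof (cases "d < Suc n")
      case False
      then have "w = 0" using simple_degree_high[OF w] by simp
      then show ?thesis using False grassmann_at_zero[OF xg] by (simp add: y_def)
    qed (simp add: y_def)
  qed
  then have "Q_class V x = Q_class V (y (Suc n))"
    using x Q_class_eq_iff[OF _ yc] by (simp add: invariant_def)
  ultimately show ?thesis by metis
qed

lemma prob_ring_degree_generated:
  assumes \<omega>: "\<omega> \<in> ext_power V n" "norm \<omega> = 1" and "d > 0"
    and X: "X \<in> prob_intersection_ring pt \<inter> Q_degree V d"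
  shows "X \<in> generated_subalgebra (Q_ring V) (Q_scale V) {ball_class, Q_class V (orientation_element n \<omega>)}"
proof -
  obtain f where f: "f \<in> grassmann V d" "X = Q_class V (in_degree d f)"
    using X by (auto simp: Q_degree_def)
  then have "invariant (in_degree d f)"
    using X Q_class_mem_prob_ring[OF in_degree_closed] by blast
  then show ?thesis
    using component_generated[OF _ \<open>d > 0\<close> \<omega>] f(2) by blast
qed

lemma ball_class_mem: "ball_class \<in> prob_intersection_ring pt \<inter> Q_degree V 1"
  using invariant_ball grassmann_K[OF beta_law] by (auto simp: prob_ring_eq Q_degree_def ball_element_eq)

lemma orientation_class_mem:
  assumes "\<omega> \<in> ext_power V n"
  shows "Q_class V (orientation_element n \<omega>) \<in> prob_intersection_ring pt \<inter> Q_degree V n"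
  using orientation_closed[OF assms] invariant_degree_n[OF orientation_closed[OF assms]]
  unfolding prob_ring_eq Q_degree_def orientation_element_def by blast

lemma Q_class_high:
  assumes "f \<in> grassmann V d" "d > n"
  shows "Q_class V (in_degree d f) = \<zero>\<^bsub>Q_ring V\<^esub>"
  using agree_zero_high[OF assms] Q_class_eq_iff[OF in_degree_closed[OF assms(1)] R_zero_closed]
  unfolding Q_zero by blast

lemma ball_class_nilpotent: "ball_class [^]\<^bsub>Q_ring V\<^esub> (n + 1) = \<zero>\<^bsub>Q_ring V\<^esub>"
  using ball_class_pow[of n] Q_class_high[OF grassmann_K[OF beta_pow_law[of n]]] by simp

text \<open>The square sits in degree \<open>n + n\<close>, which exceeds \<open>n\<close> because
  \<open>n \<ge> 1\<close>.\<close>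

lemma orientation_class_square:
  assumes "\<omega> \<in> ext_power V n"
  shows "Q_class V (orientation_element n \<omega>) [^]\<^bsub>Q_ring V\<^esub> (2::nat) = \<zero>\<^bsub>Q_ring V\<^esub>"
proof -
  let ?h = "\<lambda>u. 1 / 2 * (u \<bullet> \<omega>)"
  have h: "?h \<in> grassmann V n" by (rule orientation_closed[OF assms])
  have w: "orientation_element n \<omega> \<in> carrier R"
    unfolding orientation_element_def by (rule in_degree_closed[OF h])
  have "orientation_element n \<omega> [^]\<^bsub>R\<^esub> (2::nat) = (\<one>\<^bsub>R\<^esub> \<otimes>\<^bsub>R\<^esub> in_degree n ?h) \<otimes>\<^bsub>R\<^esub> in_degree n ?h"
    by (simp add: nat_pow_def numeral_2_eq_2 orientation_element_def)
  also have "\<one>\<^bsub>R\<^esub> \<otimes>\<^bsub>R\<^esub> in_degree n ?h = in_degree n ?h"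
  proof -
    have "zonoid_wedge V 0 n (zonoid_Z (return borel (axis {} 1))) ?h = ?h"
      using zonoid_wedge_one[OF h] by blast
    then show ?thesis
      unfolding R_one using in_degree_mult[OF one_grassmann h] by simp
  qed
  also have "in_degree n ?h \<otimes>\<^bsub>R\<^esub> in_degree n ?h = in_degree (n + n) (zonoid_wedge V n n ?h ?h)"
    by (rule in_degree_mult[OF h h])
  finally show ?thesis
    using Q_pow[OF w, of 2] Q_class_high[OF grassmann_wedge[OF h h]] n_pos by simp
qed

end

subsection \<open>Classes of submanifolds\<close>

lemma continuous_on_wedges_image:
  fixes xs :: "'m::{finite,linorder} list"
  shows "continuous_on UNIV (\<lambda>g :: 'm emat. wedges (map (\<lambda>i. g *v axis i 1) xs))"
proof (induction xs)
  case (Cons i xs)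
  have "linear (\<lambda>g :: 'm emat. ext_vec (g *v axis i 1))"
    by (simp add: linear_iff matrix_vector_mult_add_rdistrib ext_vec_linear_simps
        scaleR_matrix_vector_assoc[symmetric])
  then have "continuous_on UNIV (\<lambda>g :: 'm emat. ext_vec (g *v axis i 1))"
    by (simp add: linear_continuous_on linear_conv_bounded_linear[symmetric])
  then show ?case
    using Cons by (simp add: wedge.continuous_on)
qed simp

lemma ext_map_measurable [measurable]:
  "(\<lambda>p. ext_map (fst p) (snd p)) \<in> borel_measurable (borel \<Otimes>\<^sub>M (borel :: ('m::{finite,linorder}) ext measure))"
proof -
  have "continuous_on UNIV (\<lambda>p :: 'm emat \<times> 'm ext. wedges (map (\<lambda>i. fst p *v axis i 1) (sorted_list_of_set S)))" for S
    using continuous_on_compose2[OF continuous_on_wedges_image[of "sorted_list_of_set S"] continuous_on_fst[OF continuous_on_id]]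
    by simp
  then have "continuous_on UNIV (\<lambda>p :: 'm emat \<times> 'm ext. ext_map (fst p) (snd p))"
    unfolding ext_map_def by (intro continuous_intros)
  then show ?thesis
    unfolding borel_prod by (rule borel_measurable_continuous_onI)
qed

lemma matrix_mult_measurable [measurable]: "(\<lambda>h. g ** h) \<in> borel_measurable (borel :: ('m::finite) emat measure)"
proof -
  have "linear (\<lambda>h :: 'm emat. g ** h)"
    by (simp add: linear_iff matrix_add_ldistrib scalar_matrix_assoc matrix_scalar_ac)
  then show ?thesis
    by (intro borel_measurable_continuous_onI linear_continuous_on) (simp add: linear_conv_bounded_linear)
qed

section \<open>Random simple vectors moved by the stabilizer\<close>

context sphere_point
begin

text \<open>Recording the norm makes the orbit laws bounded, hence integrable, and makes a multiple
  of the norm constant on them.\<close>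

definition unit_simple :: "nat \<Rightarrow> 'm ext set" where
  "unit_simple d = simple_vectors V d \<inter> sphere 0 1"

lemma unit_simple_borel: "unit_simple d \<in> sets borel"
  unfolding unit_simple_def using simple_borel by (intro sets.Int) auto

text \<open>The common shape of the two laws attached to a submanifold: a simple vector
  \<open>a z\<close> is moved by an independent uniform element of the stabilizer.\<close>

definition orbit_law :: "'m emat measure \<Rightarrow> 'z measure \<Rightarrow> ('z \<Rightarrow> 'm ext) \<Rightarrow> 'm ext measure" where
  "orbit_law \<mu> N a = distr (\<mu> \<Otimes>\<^sub>M N) borel (\<lambda>(h, z). ext_map h (a z))"

context
  fixes \<mu> :: "'m emat measure" and N :: "'z measure" and a :: "'z \<Rightarrow> 'm ext" and d :: nat
  assumes \<mu>: "uniform_law (stabilizer pt) \<mu>"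
    and N: "prob_space N" and a: "a \<in> borel_measurable N"
    and a_unit: "\<And>z. z \<in> space N \<Longrightarrow> a z \<in> unit_simple d"
begin

lemma orbit_measurable: "(\<lambda>(h, z). ext_map h (a z)) \<in> borel_measurable (\<mu> \<Otimes>\<^sub>M N)"
proof -
  note [measurable] = a
  have [measurable_cong]: "sets \<mu> = sets borel" using \<mu> by (simp add: uniform_law_def)
  have "(\<lambda>p. ext_map (fst p) (a (snd p))) \<in> borel_measurable (\<mu> \<Otimes>\<^sub>M N)"
    using measurable_compose[OF _ ext_map_measurable, of "\<lambda>p. (fst p, a (snd p))" "\<mu> \<Otimes>\<^sub>M N"] by simp
  then show ?thesis by (simp add: split_beta')
qed

lemma orbit_law_mem: "orbit_law \<mu> N a \<in> integrable_laws (unit_simple d)"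
proof -
  interpret \<mu>: prob_space \<mu> using \<mu> by (simp add: uniform_law_def)
  interpret N: prob_space N by (rule N)
  interpret pair_prob_space \<mu> N ..
  note [measurable] = orbit_measurable unit_simple_borel
  have AE_pair: "AE p in \<mu> \<Otimes>\<^sub>M N. (case p of (h, z) \<Rightarrow> ext_map h (a z)) \<in> unit_simple d"
  proof (rule AE_pair_measure)
    show "{p \<in> space (\<mu> \<Otimes>\<^sub>M N). (case p of (h, z) \<Rightarrow> ext_map h (a z)) \<in> unit_simple d} \<in> sets (\<mu> \<Otimes>\<^sub>M N)"
      by measurable
    have "AE h in \<mu>. h \<in> stabilizer pt" using \<mu> by (simp add: uniform_law_def)
    then show "AE h in \<mu>. AE z in N. (case (h, z) of (h, z) \<Rightarrow> ext_map h (a z)) \<in> unit_simple d"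
    proof eventually_elim
      case (elim h)
      show ?case
        using a_unit symmetry_simple[OF stabilizer_symmetry[OF elim]] norm_ext_map[OF stabilizer_orthogonal[OF elim]]
        by (intro AE_I2) (auto simp: unit_simple_def)
    qed
  qed
  have AE_law: "AE x in orbit_law \<mu> N a. x \<in> unit_simple d"
    unfolding orbit_law_def using AE_pair by (subst AE_distr_iff) auto
  have P: "prob_space (orbit_law \<mu> N a)"
    unfolding orbit_law_def by (intro prob_space_distr) simp
  interpret L: prob_space "orbit_law \<mu> N a" by (rule P)
  have "AE x in orbit_law \<mu> N a. norm x \<le> 1"
    using AE_law by eventually_elim (simp add: unit_simple_def)
  then have "integrable (orbit_law \<mu> N a) (\<lambda>x. x)"
    by (rule L.integrable_const_bound) (simp add: orbit_law_def)
  moreover have "sets (orbit_law \<mu> N a) = sets borel"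
    by (simp add: orbit_law_def)
  ultimately show ?thesis
    using P AE_law by (simp add: integrable_laws_def)
qed

lemma orbit_law_grassmann: "orbit_law \<mu> N a \<in> grassmann_laws V d"
proof -
  have "AE x in orbit_law \<mu> N a. x \<in> simple_vectors V d"
    using law_AE[OF orbit_law_mem] by eventually_elim (simp add: unit_simple_def)
  then show ?thesis
    using orbit_law_mem by (simp add: grassmann_laws_eq integrable_laws_def)
qed

text \<open>Left invariance of \<open>\<mu>\<close> passes to the product with \<open>N\<close>, and
  \<open>g\<close> followed into \<open>ext_map\<close> is absorbed into the group element.\<close>

lemma orbit_law_invariant:
  assumes g: "g \<in> stabilizer pt"
  shows "distr (orbit_law \<mu> N a) borel (ext_map g) = orbit_law \<mu> N a"
proof -
  interpret \<mu>: prob_space \<mu> using \<mu> by (simp add: uniform_law_def)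
  interpret N: prob_space N by (rule N)
  have s[measurable_cong]: "sets \<mu> = sets borel" using \<mu> by (simp add: uniform_law_def)
  have \<mu>g: "distr \<mu> \<mu> (\<lambda>h. g ** h) = \<mu>"
  proof -
    have "distr \<mu> \<mu> (\<lambda>h. g ** h) = distr \<mu> borel (\<lambda>h. g ** h)"
      by (rule distr_cong) (auto simp: s)
    then show ?thesis using \<mu> g by (simp add: uniform_law_def)
  qed
  have [measurable]: "(\<lambda>h. g ** h) \<in> measurable \<mu> \<mu>"
    by measurable
  have gm[measurable]: "ext_map g \<in> borel_measurable borel"
    by (intro borel_measurable_continuous_onI linear_continuous_on)
      (simp add: linear_conv_bounded_linear[symmetric] linear_ext_map)
  note [measurable] = orbit_measurable
  have pair: "distr (\<mu> \<Otimes>\<^sub>M N) (\<mu> \<Otimes>\<^sub>M N) (\<lambda>(h, z). (g ** h, z)) = \<mu> \<Otimes>\<^sub>M N"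
    using pair_measure_distr[of "\<lambda>h. g ** h" \<mu> \<mu> "\<lambda>z. z" N N] \<mu>g
    by (simp add: N.sigma_finite_measure_axioms)
  have "distr (orbit_law \<mu> N a) borel (ext_map g) = distr (\<mu> \<Otimes>\<^sub>M N) borel (\<lambda>(h, z). ext_map (g ** h) (a z))"
    unfolding orbit_law_def by (subst distr_distr) (auto simp: comp_def split_beta' ext_map_mult)
  also have "\<dots> = distr (distr (\<mu> \<Otimes>\<^sub>M N) (\<mu> \<Otimes>\<^sub>M N) (\<lambda>(h, z). (g ** h, z))) borel (\<lambda>(h, z). ext_map h (a z))"
    by (subst distr_distr) (auto simp: comp_def split_beta')
  finally show ?thesis
    unfolding pair orbit_law_def .
qed

lemma orbit_law_Z_invariant: "invariant (in_degree d (zonoid_Z (orbit_law \<mu> N a)))"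
proof -
  have "zonoid_Z (orbit_law \<mu> N a) (ext_map (transpose g) w) = zonoid_Z (orbit_law \<mu> N a) w"
    if "g \<in> stabilizer pt" for g w
    using act_Z[OF orbit_law_mem, of g w] orbit_law_invariant[OF that] by simp
  then show ?thesis
    by (simp add: invariant_in_degree grassmann_Z[OF orbit_law_grassmann])
qed

text \<open>\<open>w\<close> and \<open>- w\<close> have the same norm, so the invariant function
  \<open>zonoid_Z\<close> takes the same value at both and coincides with its even part.\<close>

lemma orbit_law_K_eq_Z:
  assumes "0 < d" "d < n" "w \<in> simple_vectors V d"
  shows "zonoid_K (orbit_law \<mu> N a) w = zonoid_Z (orbit_law \<mu> N a) w"
  using invariant_equal_norm[OF orbit_law_Z_invariant assms(1,2) simple_vectors_minus[OF assms(3)] assms(3)]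
  by (simp add: zonoid_K_eq_Z[OF orbit_law_mem])

text \<open>Both zonoids are multiples of the norm on simple vectors. Pairing them with each other
  determines the ratio of the factors.\<close>

lemma orbit_law_K_eq:
  assumes "d = Suc k" "d < n" "w \<in> simple_vectors V d"
  shows "zonoid_K (orbit_law \<mu> N a) w = 1 / (\<integral>x. norm x \<partial>beta_pow k) * zonoid_K (beta_pow k) w"
proof -
  let ?L = "orbit_law \<mu> N a"
  have "d > 0" using assms(1) by simp
  interpret N: prob_space N by (rule N)
  obtain z where "z \<in> space N" using N.not_empty by blast
  then have w0: "a z \<in> simple_vectors V d" "norm (a z) = 1"
    using a_unit by (auto simp: unit_simple_def)
  define w0 where "w0 = a z"
  have L: "?L \<in> integrable_laws (ext_power V d)"
    using orbit_law_grassmann grassmann_laws_subset by blast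
  have b: "beta_pow k \<in> integrable_laws (simple_vectors V d)" "beta_pow k \<in> integrable_laws (ext_power V d)"
    using beta_pow_law[of k] grassmann_laws_subset assms(1) by (auto simp: grassmann_laws_eq)
  define \<kappa> where "\<kappa> = zonoid_K ?L w0"
  define c where "c = zonoid_K (beta_pow k) w0"
  have KL: "zonoid_K ?L v = norm v * \<kappa>" if "v \<in> simple_vectors V d" for v
    using invariant_middle[OF orbit_law_Z_invariant \<open>d > 0\<close> \<open>d < n\<close> that w0]
    by (simp add: \<kappa>_def w0_def orbit_law_K_eq_Z[OF \<open>d > 0\<close> \<open>d < n\<close>] that w0)
  have Kb: "zonoid_K (beta_pow k) v = norm v * c" if "v \<in> simple_vectors V d" for v
    using invariant_middle[OF invariant_beta_pow[of k, folded assms(1)] \<open>d > 0\<close> \<open>d < n\<close> that w0]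
    by (simp add: c_def w0_def)
  have "c > 0"
    unfolding c_def w0_def using zonoid_K_beta_pow_pos[of "a z" k] w0 assms(1) norm_zero by fastforce
  have "(\<integral>x. zonoid_K (beta_pow k) x \<partial>?L) = (\<integral>y. zonoid_K ?L y \<partial>beta_pow k)"
    using zonoid_K_pairing[OF L b(2)] by simp
  also have "(\<integral>x. zonoid_K (beta_pow k) x \<partial>?L) = (\<integral>x. c \<partial>?L)"
  proof (rule integral_cong_AE)
    show "AE x in ?L. zonoid_K (beta_pow k) x = c"
      using law_AE[OF orbit_law_mem] by eventually_elim (simp add: unit_simple_def Kb)
    show "zonoid_K (beta_pow k) \<in> borel_measurable ?L"
      using tame_measurable[OF tame_zonoid_K[OF b(1)]] by (simp add: law_measurable[OF L])
  qed simp
  also have "\<dots> = c"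
    using law_prob_space[OF L] by (simp add: prob_space.prob_space)
  also have "(\<integral>y. zonoid_K ?L y \<partial>beta_pow k) = (\<integral>y. norm y * \<kappa> \<partial>beta_pow k)"
  proof (rule integral_cong_AE)
    show "AE y in beta_pow k. zonoid_K ?L y = norm y * \<kappa>"
      using law_AE[OF b(1)] by eventually_elim (rule KL)
    show "zonoid_K ?L \<in> borel_measurable (beta_pow k)"
      using tame_measurable[OF tame_zonoid_K[OF L]] by (simp add: law_measurable[OF b(1)])
    show "(\<lambda>y. norm y * \<kappa>) \<in> borel_measurable (beta_pow k)"
      by (simp add: law_measurable[OF b(1)])
  qed
  also have "\<dots> = \<kappa> * (\<integral>y. norm y \<partial>beta_pow k)"
    by simp
  finally have "c = \<kappa> * (\<integral>y. norm y \<partial>beta_pow k)" .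
  then show ?thesis
    using \<open>c > 0\<close> KL[OF assms(3)] Kb[OF assms(3)] by (auto simp: field_simps)
qed

end

text \<open>A rotation taking \<open>y\<close> to \<open>pt\<close> takes the orthogonal complement
  of \<open>y\<close> to that of \<open>pt\<close> and preserves norms.\<close>

lemma unit_conormal_transport:
  assumes "w \<in> unit_conormals d Y y" "rotation_matrix t" "t *v y = pt"
  shows "ext_map t w \<in> unit_simple d"
proof -
  obtain vs where vs: "norm w = 1" "length vs = d" "span (set vs) = conormal_space Y y" "w = wedges vs"
    using assms(1) by (auto simp: unit_conormals_def)
  have o: "orthogonal_matrix t" using assms(2) by (simp add: rotation_matrix_def)
  have "set vs \<subseteq> cotangent y"
    using vs(3) span_superset[of "set vs"] by (auto simp: conormal_space_def)
  then have "set (map ((*v) t) vs) \<subseteq> V"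
    using orthogonal_matrix_inner[OF o, of _ y] assms(3) by (auto simp: cotangent_def)
  then have "ext_map t w \<in> simple_vectors V d"
    using simple_vectorsI[of "map ((*v) t) vs" d V 1] vs by (simp add: ext_map_wedges)
  then show ?thesis
    using vs(1) norm_ext_map[OF o] by (simp add: unit_simple_def)
qed

lemma unit_simple_sign: "w \<in> unit_simple d \<Longrightarrow> e \<in> {1, - 1} \<Longrightarrow> e *\<^sub>R w \<in> unit_simple d"
  by (auto simp: unit_simple_def simple_vectors_minus)

end

section \<open>Uniform laws on submanifolds\<close>

lemma sets_hausdorff_measure [simp]: "sets (hausdorff_measure k) = sets borel"
  and space_hausdorff_measure [simp]: "space (hausdorff_measure k) = UNIV"
  using sets.sigma_sets_eq[of borel] by (simp_all add: hausdorff_measure_def)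

lemma uniform_on_prob_space:
  assumes "emeasure (hausdorff_measure k) Y < \<infinity>" "measure (hausdorff_measure k) Y \<noteq> 0"
  shows "prob_space (uniform_on k Y)"
proof -
  have "emeasure (hausdorff_measure k) Y \<noteq> 0"
    using assms(2) by (auto simp: measure_def)
  \<comment> \<open>A set outside the sigma-algebra would have measure zero by convention.\<close>
  moreover from this have "Y \<in> sets borel"
    using emeasure_neq_0_sets by fastforce
  ultimately show ?thesis
    unfolding uniform_on_def using assms(1)
    by (intro prob_space_uniform_measure) (auto simp: emeasure_restrict_space)
qed

lemma sets_uniform_on: "sets (uniform_on k Y) = sets (restrict_space borel Y)"
  by (simp add: uniform_on_def sets_restrict_space)

lemma space_uniform_on: "space (uniform_on k Y) = Y"
  by (simp add: uniform_on_def space_restrict_space)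

context sphere_point
begin

context
  fixes \<mu> :: "'m emat measure" and \<tau> :: "'m evec \<Rightarrow> 'm emat" and d k :: nat
    and Y :: "'m evec set" and \<nu> :: "'m evec \<Rightarrow> 'm ext"
  assumes \<mu>: "uniform_law (stabilizer pt) \<mu>"
    and \<tau>: "\<tau> \<in> borel_measurable (restrict_space borel (sphere 0 1))"
      "\<forall>y\<in>sphere 0 1. rotation_matrix (\<tau> y) \<and> \<tau> y *v y = pt"
    and d: "d = Suc k" "d < n"
    and Y: "Y \<subseteq> sphere 0 1" "emeasure (hausdorff_measure (n - d)) Y < \<infinity>"
    and \<nu>: "\<nu> \<in> borel_measurable (restrict_space borel Y)" "\<forall>y\<in>Y. \<nu> y \<in> unit_conormals d Y y"
    and vol: "volume_ratio n (n - d) Y \<noteq> 0"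
begin

text \<open>A nonzero volume ratio forces a nonzero volume of \<open>Y\<close>, so normalisation
  gives a probability measure.\<close>

lemma uniform_on_Y: "prob_space (uniform_on (n - d) Y)"
  using vol by (intro uniform_on_prob_space Y) (auto simp: volume_ratio_def)

lemma transported_conormal_measurable:
  "(\<lambda>y. ext_map (\<tau> y) (\<nu> y)) \<in> borel_measurable (uniform_on (n - d) Y)"
proof -
  have [measurable]: "\<nu> \<in> borel_measurable (uniform_on (n - d) Y)" "\<tau> \<in> borel_measurable (uniform_on (n - d) Y)"
    using \<nu>(1) measurable_restrict_mono[OF \<tau>(1) Y(1)] measurable_cong_sets[OF sets_uniform_on refl]
    by blast+
  show ?thesis
    using measurable_compose[OF _ ext_map_measurable, of "\<lambda>y. (\<tau> y, \<nu> y)" "uniform_on (n - d) Y"] by simp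
qed

lemma transported_conormal_unit: "y \<in> Y \<Longrightarrow> ext_map (\<tau> y) (\<nu> y) \<in> unit_simple d"
  using \<tau>(2) \<nu>(2) Y(1) by (intro unit_conormal_transport[of _ d Y y]) auto

lemma cooriented_law_orbit:
  "cooriented_law (n - d) \<mu> \<tau> Y \<nu> = orbit_law \<mu> (uniform_on (n - d) Y) (\<lambda>y. ext_map (\<tau> y) (\<nu> y))"
  by (simp add: cooriented_law_def orbit_law_def ext_map_mult)

text \<open>The random sign commutes with the linear map \<open>ext_map\<close>, so it can be
  absorbed into the vector that is moved, with pairs \<open>(y, e)\<close> as parameter.\<close>

lemma submanifold_law_orbit:
  "submanifold_law (n - d) \<mu> \<tau> Y \<nu> =
    orbit_law \<mu> (uniform_on (n - d) Y \<Otimes>\<^sub>M uniform_count_measure {1, - 1}) (\<lambda>(y, e). e *\<^sub>R ext_map (\<tau> y) (\<nu> y))"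
  by (simp add: submanifold_law_def orbit_law_def ext_map_mult ext_map_linear_simps split_beta')

lemma signed_conormal_measurable:
  "(\<lambda>(y, e). e *\<^sub>R ext_map (\<tau> y) (\<nu> y)) \<in>
    borel_measurable (uniform_on (n - d) Y \<Otimes>\<^sub>M uniform_count_measure {1, - 1 :: real})"
proof -
  note [measurable] = transported_conormal_measurable
  have [measurable]: "(\<lambda>e. e) \<in> borel_measurable (uniform_count_measure {1, - 1 :: real})"
    unfolding measurable_def by (auto simp: space_uniform_count_measure sets_uniform_count_measure)
  show ?thesis
    unfolding split_beta' by measurable
qed

lemma submanifold_prob_space:
  "prob_space (uniform_on (n - d) Y \<Otimes>\<^sub>M uniform_count_measure {1, - 1 :: real})"
proof -
  interpret A: prob_space "uniform_on (n - d) Y" by (rule uniform_on_Y)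
  interpret B: prob_space "uniform_count_measure {1, - 1 :: real}"
    by (rule prob_space_uniform_count_measure) auto
  interpret pair_prob_space "uniform_on (n - d) Y" "uniform_count_measure {1, - 1 :: real}" ..
  show ?thesis by (rule prob_space_axioms)
qed

lemma signed_conormal_unit:
  "z \<in> space (uniform_on (n - d) Y \<Otimes>\<^sub>M uniform_count_measure {1, - 1 :: real}) \<Longrightarrow>
    (case z of (y, e) \<Rightarrow> e *\<^sub>R ext_map (\<tau> y) (\<nu> y)) \<in> unit_simple d"
  using transported_conormal_unit unit_simple_sign
  by (auto simp: space_pair_measure space_uniform_on space_uniform_count_measure)

lemmas submanifold_orbit_facts = \<mu> submanifold_prob_space signed_conormal_measurable signed_conormal_unit

lemma transported_conormal_unit_space:
  "y \<in> space (uniform_on (n - d) Y) \<Longrightarrow> ext_map (\<tau> y) (\<nu> y) \<in> unit_simple d"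
  by (simp add: space_uniform_on transported_conormal_unit)

lemmas cooriented_orbit_facts =
  \<mu> uniform_on_Y transported_conormal_measurable transported_conormal_unit_space

lemma submanifold_law_grassmann: "submanifold_law (n - d) \<mu> \<tau> Y \<nu> \<in> grassmann_laws V d"
  unfolding submanifold_law_orbit by (rule orbit_law_grassmann[OF submanifold_orbit_facts])

lemma cooriented_law_grassmann: "cooriented_law (n - d) \<mu> \<tau> Y \<nu> \<in> grassmann_laws V d"
  unfolding cooriented_law_orbit
  by (rule orbit_law_grassmann[OF cooriented_orbit_facts])

lemma submanifold_law_K:
  "w \<in> simple_vectors V d \<Longrightarrow> zonoid_K (submanifold_law (n - d) \<mu> \<tau> Y \<nu>) w =
    1 / (\<integral>x. norm x \<partial>beta_pow k) * zonoid_K (beta_pow k) w"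
  unfolding submanifold_law_orbit by (rule orbit_law_K_eq[OF submanifold_orbit_facts d])

lemma cooriented_law_Z:
  "w \<in> simple_vectors V d \<Longrightarrow> zonoid_Z (cooriented_law (n - d) \<mu> \<tau> Y \<nu>) w =
    1 / (\<integral>x. norm x \<partial>beta_pow k) * zonoid_K (beta_pow k) w"
  using orbit_law_K_eq_Z[OF cooriented_orbit_facts, of w] orbit_law_K_eq[OF cooriented_orbit_facts d, of w] d
  unfolding cooriented_law_orbit by simp

end

text \<open>Identifies the mean norm, which arises from pairing an orbit law with a ball power, as
  the length in the asserted formula.\<close>

lemma zonoid_length_ball_pow:
  "zonoid_length (ext_power V (Suc k)) ((ball_element V [^]\<^bsub>R\<^esub> (Suc k)) (Suc k)) = (\<integral>x. norm x \<partial>beta_pow k)"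
  unfolding ball_element_pow in_degree_same
  by (rule zonoid_length_K[OF subsetD[OF grassmann_laws_subset beta_pow_law] subspace_0[OF subspace_ext_power]])

lemma submanifold_classes:
  assumes \<mu>: "uniform_law (stabilizer pt) \<mu>"
    and \<tau>: "\<tau> \<in> borel_measurable (restrict_space borel (sphere 0 1))"
      "\<forall>y\<in>sphere 0 1. rotation_matrix (\<tau> y) \<and> \<tau> y *v y = pt"
    and d: "0 < d" "d < n"
    and Y: "Y \<subseteq> sphere 0 1" "emeasure (hausdorff_measure (n - d)) Y < \<infinity>"
    and \<nu>: "\<nu> \<in> borel_measurable (restrict_space borel Y)" "\<forall>y\<in>Y. \<nu> y \<in> unit_conormals d Y y"
  shows "grassmann_class n d pt \<mu> \<tau> Y \<nu> =
      Q_scale V (volume_ratio n (n - d) Y *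
        (1 / zonoid_length (ext_power V d) ((ball_element V [^]\<^bsub>R\<^esub> d) d))) (ball_class [^]\<^bsub>Q_ring V\<^esub> d)"
    and "grassmann_class n d pt \<mu> \<tau> Y \<nu> = cooriented_class n d pt \<mu> \<tau> Y \<nu>"
proof -
  obtain k where k: "d = Suc k" using d by (cases d) auto
  let ?r = "volume_ratio n (n - d) Y" and ?l = "\<integral>x. norm x \<partial>beta_pow k"
  let ?f = "\<lambda>u. ?r * (1 / ?l) * zonoid_K (beta_pow k) u"
  have f: "?f \<in> grassmann V d"
    unfolding k by (intro grassmann_scale grassmann_K beta_pow_law)
  have K: "Q_class V (in_degree d (\<lambda>u. ?r * zonoid_K (submanifold_law (n - d) \<mu> \<tau> Y \<nu>) u)) = Q_class V (in_degree d ?f)"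
  \<comment> \<open>With ratio zero the law of \<open>Y\<close> may fail to be a probability law,
    but both functions are multiplied by zero and the classes agree trivially.\<close>
  proof (cases "?r = 0")
    case False
    note facts = \<mu> \<tau> k d(2) Y \<nu> False
    have "(\<lambda>u. ?r * zonoid_K (submanifold_law (n - d) \<mu> \<tau> Y \<nu>) u) \<in> grassmann V d"
      by (intro grassmann_scale grassmann_K submanifold_law_grassmann[OF facts])
    then show ?thesis
      using f submanifold_law_K[OF facts]
      by (subst Q_class_eq_iff) (auto intro!: in_degree_closed in_degree_agree)
  qed simp
  have Z: "Q_class V (in_degree d (\<lambda>u. ?r * zonoid_Z (cooriented_law (n - d) \<mu> \<tau> Y \<nu>) u)) = Q_class V (in_degree d ?f)"
  proof (cases "?r = 0")
    case False
    note facts = \<mu> \<tau> k d(2) Y \<nu> False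
    have "(\<lambda>u. ?r * zonoid_Z (cooriented_law (n - d) \<mu> \<tau> Y \<nu>) u) \<in> grassmann V d"
      by (intro grassmann_scale grassmann_Z cooriented_law_grassmann[OF facts])
    then show ?thesis
      using f cooriented_law_Z[OF facts]
      by (subst Q_class_eq_iff) (auto intro!: in_degree_closed in_degree_agree)
  qed simp
  show "grassmann_class n d pt \<mu> \<tau> Y \<nu> =
      Q_scale V (?r * (1 / zonoid_length (ext_power V d) ((ball_element V [^]\<^bsub>R\<^esub> d) d))) (ball_class [^]\<^bsub>Q_ring V\<^esub> d)"
    using K unfolding grassmann_class_def k zonoid_length_ball_pow ball_class_pow_scale .
  show "grassmann_class n d pt \<mu> \<tau> Y \<nu> = cooriented_class n d pt \<mu> \<tau> Y \<nu>"
    using K Z by (simp add: grassmann_class_def cooriented_class_def)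
qed

end

text \<open>Degree zero contains an even and an odd function on a line, of which \<open>B\<close>,
  \<open>W\<close> and the unit reach only the multiples of the unit. Hence the whole ring is
  generated after adjoining its elements of degree zero, while \<open>B\<close> and \<open>W\<close>
  alone suffice in positive degrees. One selection \<open>\<nu>\<close> of unit conormals serves
  both classes; the random sign makes the Grassmann class insensitive to the choice of
  signs.\<close>

theorem proposition5p11:
  fixes n :: nat and pt :: "real ^ ('m::{finite,linorder})" and \<omega> :: "'m ext"
  defines "V \<equiv> cotangent pt"
  defines "R \<equiv> grassmann_ring V" and "Q \<equiv> Q_ring V"
  defines "B \<equiv> Q_class V (ball_element V)" and "W \<equiv> Q_class V (orientation_element n \<omega>)"
  assumes "CARD('m) = n + 1" and "n \<ge> 1" and "norm pt = 1"
    and "\<omega> \<in> ext_power V n" and "norm \<omega> = 1"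
  shows
    "B \<in> prob_intersection_ring pt \<inter> Q_degree V 1 \<and>
     W \<in> prob_intersection_ring pt \<inter> Q_degree V n \<and>
     prob_intersection_ring pt =
       generated_subalgebra Q (Q_scale V) ({B, W} \<union> (prob_intersection_ring pt \<inter> Q_degree V 0)) \<and>
     (\<forall>d>0. prob_intersection_ring pt \<inter> Q_degree V d \<subseteq> generated_subalgebra Q (Q_scale V) {B, W}) \<and>
     B [^]\<^bsub>Q\<^esub> (n + 1) = \<zero>\<^bsub>Q\<^esub> \<and>
     W [^]\<^bsub>Q\<^esub> (2::nat) = \<zero>\<^bsub>Q\<^esub> \<and>
     (\<forall>\<mu> \<tau> d Y \<nu>.
        uniform_law (stabilizer pt) \<mu> \<and>
        \<tau> \<in> borel_measurable (restrict_space borel (sphere 0 1)) \<and>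
        (\<forall>y\<in>sphere 0 1. rotation_matrix (\<tau> y) \<and> \<tau> y *v y = pt) \<and>
        0 < d \<and> d < n \<and>
        Y \<subseteq> sphere 0 1 \<and> smooth_submanifold (n - d) Y \<and>
        emeasure (hausdorff_measure (n - d)) Y < \<infinity> \<and>
        \<nu> \<in> borel_measurable (restrict_space borel Y) \<and> (\<forall>y\<in>Y. \<nu> y \<in> unit_conormals d Y y) \<longrightarrow>
        grassmann_class n d pt \<mu> \<tau> Y \<nu> =
          Q_scale V (volume_ratio n (n - d) Y *
              (1 / zonoid_length (ext_power V d) ((ball_element V [^]\<^bsub>R\<^esub> d) d)))
            (B [^]\<^bsub>Q\<^esub> d) \<and>
        (continuous_on Y \<nu> \<longrightarrow> grassmann_class n d pt \<mu> \<tau> Y \<nu> = cooriented_class n d pt \<mu> \<tau> Y \<nu>))"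
proof -
  interpret S: sphere_point pt n
    using assms by unfold_locales auto
  note \<omega> = \<open>\<omega> \<in> ext_power V n\<close>[unfolded V_def] \<open>norm \<omega> = 1\<close>
  have B: "B \<in> prob_intersection_ring pt \<inter> Q_degree V 1"
    unfolding B_def V_def by (rule S.ball_class_mem)
  have W: "W \<in> prob_intersection_ring pt \<inter> Q_degree V n"
    unfolding W_def V_def by (rule S.orientation_class_mem[OF \<omega>(1)])
  have gen: "prob_intersection_ring pt =
      generated_subalgebra Q (Q_scale V) ({B, W} \<union> (prob_intersection_ring pt \<inter> Q_degree V 0))"
  proof
    show "prob_intersection_ring pt \<subseteq>
        generated_subalgebra Q (Q_scale V) ({B, W} \<union> (prob_intersection_ring pt \<inter> Q_degree V 0))"
      unfolding B_def W_def Q_def V_def using S.prob_ring_generated[OF \<omega>] by (subst S.prob_ring_eq) blast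
    show "generated_subalgebra Q (Q_scale V) ({B, W} \<union> (prob_intersection_ring pt \<inter> Q_degree V 0))
        \<subseteq> prob_intersection_ring pt"
      unfolding Q_def V_def by (rule S.generated_subset_prob_ring) (use B W in \<open>auto simp: V_def\<close>)
  qed
  have deg: "\<forall>d>0. prob_intersection_ring pt \<inter> Q_degree V d \<subseteq> generated_subalgebra Q (Q_scale V) {B, W}"
    unfolding B_def W_def Q_def V_def using S.prob_ring_degree_generated[OF \<omega>] by blast
  have B0: "B [^]\<^bsub>Q\<^esub> (n + 1) = \<zero>\<^bsub>Q\<^esub>"
    unfolding B_def Q_def V_def by (rule S.ball_class_nilpotent)
  have W0: "W [^]\<^bsub>Q\<^esub> (2::nat) = \<zero>\<^bsub>Q\<^esub>"
    unfolding W_def Q_def V_def by (rule S.orientation_class_square[OF \<omega>(1)])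
  show ?thesis
  proof (intro conjI B W gen deg B0 W0 allI impI)
    fix \<mu> \<tau> d and Y :: "'m evec set" and \<nu> :: "'m evec \<Rightarrow> 'm ext"
    assume "uniform_law (stabilizer pt) \<mu> \<and>
        \<tau> \<in> borel_measurable (restrict_space borel (sphere 0 1)) \<and>
        (\<forall>y\<in>sphere 0 1. rotation_matrix (\<tau> y) \<and> \<tau> y *v y = pt) \<and>
        0 < d \<and> d < n \<and>
        Y \<subseteq> sphere 0 1 \<and> smooth_submanifold (n - d) Y \<and>
        emeasure (hausdorff_measure (n - d)) Y < \<infinity> \<and>
        \<nu> \<in> borel_measurable (restrict_space borel Y) \<and> (\<forall>y\<in>Y. \<nu> y \<in> unit_conormals d Y y)"
    note * = this[THEN conjunct1] this[THEN conjunct2, THEN conjunct1]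
      this[THEN conjunct2, THEN conjunct2, THEN conjunct1]
    from \<open>_ \<and> _\<close> have **: "0 < d" "d < n" "Y \<subseteq> sphere 0 1" "emeasure (hausdorff_measure (n - d)) Y < \<infinity>"
      "\<nu> \<in> borel_measurable (restrict_space borel Y)" "\<forall>y\<in>Y. \<nu> y \<in> unit_conormals d Y y"
      by - (elim conjE, assumption)+
    show "grassmann_class n d pt \<mu> \<tau> Y \<nu> =
          Q_scale V (volume_ratio n (n - d) Y *
              (1 / zonoid_length (ext_power V d) ((ball_element V [^]\<^bsub>R\<^esub> d) d)))
            (B [^]\<^bsub>Q\<^esub> d)"
      unfolding B_def Q_def R_def V_def by (rule S.submanifold_classes(1)[OF * **])
    show "grassmann_class n d pt \<mu> \<tau> Y \<nu> = cooriented_class n d pt \<mu> \<tau> Y \<nu>"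
      by (rule S.submanifold_classes(2)[OF * **])
  qed
qed

end
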